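(* Let $w<0$ and let $P(t)=\sum_{k=0}^{\infty}a_k e^{2\pi i b_k t}$, where $a_k\in\mathbb{C}$, $a_0=1$, $b_0=0$, and $b_k>0$ for every $k\geq 1$. Suppose that $$\sum_{k=1}^{\infty}|a_k|e^{2\pi |w| b_k}<1 .$$ Let $g(t)=\dfrac{P(t)}{t-iw}$. Then the frame set of $g$ is $$\mathcal{F}_g=\{(\alpha,\beta)\,:\,\alpha,\beta>0,\ \alpha\beta\leq 1\}.$$
   Context: For $g\in L^2(\mathbb{R})$ and $(x,\omega)\in\mathbb{R}^2$ put $\pi_{x,\omega}g(t)=e^{2\pi i\omega t}g(t-x)$. For $\alpha,\beta>0$ the Gabor system is $\mathcal{G}(g;\alpha,\beta)=\{\pi_{\alpha n,\beta m}g\}_{m,n\in\mathbb{Z}}$. It is a (Gabor) frame if there are constants $A,B>0$ with $A\|f\|_2^2\leq\sum_{m,n\in\mathbb{Z}}|(f,\pi_{\alpha n,\beta m}g)|^2\leq B\|f\|_2^2$ for all $f\in L^2(\mathbb{R})$. The frame set of $g$ is $\mathcal{F}_g=\{(\alpha,\beta):\alpha,\beta>0,\ \mathcal{G}(g;\alpha,\beta)\text{ is a frame}\}$. *)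

theory Defs
  imports "HOL-Analysis.Analysis"
begin

definition L2 :: "(real \<Rightarrow> complex) \<Rightarrow> bool" where
  "L2 f \<longleftrightarrow> f \<in> borel_measurable lborel \<and> integrable lborel (\<lambda>t. (cmod (f t))\<^sup>2)"

definition L2_normsq :: "(real \<Rightarrow> complex) \<Rightarrow> real" where
  "L2_normsq f = (LINT t|lborel. (cmod (f t))\<^sup>2)"

definition L2_inner :: "(real \<Rightarrow> complex) \<Rightarrow> (real \<Rightarrow> complex) \<Rightarrow> complex" where
  "L2_inner f g = (LINT t|lborel. f t * cnj (g t))"

definition tf_shift :: "real \<Rightarrow> real \<Rightarrow> (real \<Rightarrow> complex) \<Rightarrow> (real \<Rightarrow> complex)" where
  "tf_shift x \<omega> g = (\<lambda>t. exp (2 * pi * \<i> * of_real (\<omega> * t)) * g (t - x))"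

definition gabor_frame :: "(real \<Rightarrow> complex) \<Rightarrow> real \<Rightarrow> real \<Rightarrow> bool" where
  "gabor_frame g \<alpha> \<beta> \<longleftrightarrow>
     (\<exists>A B. A > 0 \<and> B > 0 \<and>
        (\<forall>f. L2 f \<longrightarrow>
           (\<lambda>(m::int, n::int). (cmod (L2_inner f (tf_shift (\<alpha> * of_int n) (\<beta> * of_int m) g)))\<^sup>2) summable_on UNIV \<and>
           A * L2_normsq f \<le> (\<Sum>\<^sub>\<infinity>(m::int, n::int). (cmod (L2_inner f (tf_shift (\<alpha> * of_int n) (\<beta> * of_int m) g)))\<^sup>2) \<and>
           (\<Sum>\<^sub>\<infinity>(m::int, n::int). (cmod (L2_inner f (tf_shift (\<alpha> * of_int n) (\<beta> * of_int m) g)))\<^sup>2) \<le> B * L2_normsq f))"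

definition frame_set :: "(real \<Rightarrow> complex) \<Rightarrow> (real \<times> real) set" where
  "frame_set g = {(\<alpha>, \<beta>). \<alpha> > 0 \<and> \<beta> > 0 \<and> gabor_frame g \<alpha> \<beta>}"

end

theory Submission
  imports Defs
begin

text \<open>
  On the Fourier side the window becomes a multiple of
  \<open>\<gamma> s = exp (- c s) (\<Sum>k. e k [b k < s])\<close> with \<open>c = 2 \<pi> |w|\<close> and \<open>e k = a k exp (c b k)\<close>. After
  rescaling to \<open>\<alpha> = 1\<close> (so that \<open>\<beta>\<close> stands for \<open>\<alpha> \<beta>\<close>), Parseval's identity on the circle turns the sum
  of the squared Gabor coefficients into the integral over \<open>\<xi>\<close> in \<open>[0, 1)\<close> of \<open>\<Sum>m. |T m|\<^sup>2\<close>, where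
  \<open>T m = \<Sum>j. x j cnj (\<gamma> (\<xi> + j - \<beta> m))\<close> and \<open>x j = F (\<xi> + j)\<close>. The exponential decay of \<open>\<gamma>\<close> and the
  Schur test give the upper bound.

  If \<open>\<beta> \<le> 1\<close>, every interval \<open>(\<beta> m, \<beta> (m + 1)]\<close> contains at most one point \<open>\<xi> + j\<close>. Hence
  \<open>T m - exp (- c \<beta>) T (m + 1)\<close>, for the \<open>m\<close> belonging to \<open>j\<close> and multiplied by a bounded factor, equals
  \<open>x j\<close> plus a perturbation of Schur norm at most \<open>\<Sum>k\<ge>1. |e k| < 1\<close>; this gives the lower bound.

  If \<open>\<beta> > 1\<close>, take \<open>x\<close> supported on \<open>0, \<dots>, N - 1\<close>. The equations \<open>T m = 0\<close> for \<open>m \<ge> - R\<close> are fewer than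
  \<open>N\<close> when \<open>N\<close> is large, so they have a nonzero solution, and the values \<open>T m\<close> for \<open>m < - R\<close> are
  exponentially small in \<open>R\<close>, uniformly in \<open>N\<close>. This contradicts a lower frame bound.
\<close>

section \<open>Parseval's identity on the circle\<close>

text \<open>The exponential weight in the hypothesis is the natural one. Up to a constant,
  \<open>a k * ec (b k * t)\<close> divided by \<open>t - \<i> * w\<close> is the transform of
  \<open>a k * exp (c * b k)\<close> times \<open>exp (- c * s)\<close> on the half-line
  \<open>s > b k\<close>. Subtracting \<open>exp (- c * \<beta>)\<close> times the copy moved by
  \<beta> cuts each half-line down to an interval of length \<beta>, and for \<beta> \<le> 1 such an
  interval meets a coset of the integers at most once. The \<open>k\<close>-th term is then a
  weighted partial permutation matrix of norm at most \<open>cmod (e k)\<close>, so the terms with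
  \<open>k \<ge> 1\<close> perturb the identity by less than 1.

  The transform is defined by an integral, hence used only on integrable functions, and no inversion
  formula enters. For the frame bounds, Fubini moves the transform from the window to an
  \<open>f\<close> that is both integrable and square integrable, and truncation extends the bounds
  to all of \<open>L2\<close>. For the counterexample, \<open>f\<close> is itself the transform of
  an explicit \<open>F\<close> of bounded support, and the polarized Plancherel identity
  applies.\<close>

lemma borel_measurable_cnj [measurable (raw)]:
  "f \<in> borel_measurable M \<Longrightarrow> (\<lambda>x. cnj (f x)) \<in> borel_measurable M"
  by (rule measurable_compose[OF _ borel_measurable_continuous_onI]) (auto intro: continuous_intros)

text \<open>An extended nonnegative integral, meaningful for every function; finiteness expresses
  square integrability. It serves \<open>circ\<close>, \<open>lborel\<close> and
  \<open>count_space\<close> alike.\<close>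

definition l2sq :: "'a measure \<Rightarrow> ('a \<Rightarrow> complex) \<Rightarrow> ennreal" where
  "l2sq M f = (\<integral>\<^sup>+x. ennreal ((cmod (f x))\<^sup>2) \<partial>M)"

lemma cmod_add_power2_le: "(cmod (x + y))\<^sup>2 \<le> 2 * (cmod x)\<^sup>2 + 2 * (cmod y)\<^sup>2"
proof -
  have "(cmod (x + y))\<^sup>2 \<le> (cmod x + cmod y)\<^sup>2"
    by (intro power_mono norm_triangle_ineq norm_ge_zero)
  also have "\<dots> \<le> 2 * (cmod x)\<^sup>2 + 2 * (cmod y)\<^sup>2"
    using sum_squares_bound[of "cmod x" "cmod y"] by (simp add: power2_sum)
  finally show ?thesis .
qed

lemma l2sq_add_le:
  assumes [measurable]: "f \<in> borel_measurable M" "g \<in> borel_measurable M"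
  shows "l2sq M (\<lambda>x. f x + g x) \<le> 2 * l2sq M f + 2 * l2sq M g"
proof -
  have "l2sq M (\<lambda>x. f x + g x) \<le> (\<integral>\<^sup>+x. 2 * ennreal ((cmod (f x))\<^sup>2) + 2 * ennreal ((cmod (g x))\<^sup>2) \<partial>M)"
    unfolding l2sq_def
  proof (intro nn_integral_mono)
    fix x
    have "ennreal ((cmod (f x + g x))\<^sup>2) \<le> ennreal (2 * (cmod (f x))\<^sup>2 + 2 * (cmod (g x))\<^sup>2)"
      by (intro ennreal_leI cmod_add_power2_le)
    then show "ennreal ((cmod (f x + g x))\<^sup>2) \<le> 2 * ennreal ((cmod (f x))\<^sup>2) + 2 * ennreal ((cmod (g x))\<^sup>2)"
      by (simp add: ennreal_plus ennreal_mult)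
  qed
  also have "\<dots> = 2 * l2sq M f + 2 * l2sq M g"
    unfolding l2sq_def by (simp add: nn_integral_add nn_integral_cmult)
  finally show ?thesis .
qed

lemma l2sq_cong: "(\<And>x. x \<in> space M \<Longrightarrow> cmod (f x) = cmod (g x)) \<Longrightarrow> l2sq M f = l2sq M g"
  unfolding l2sq_def by (intro nn_integral_cong) simp

lemma l2sq_cmult:
  assumes [measurable]: "f \<in> borel_measurable M"
  shows "l2sq M (\<lambda>x. c * f x) = ennreal ((cmod c)\<^sup>2) * l2sq M f"
  unfolding l2sq_def
  by (simp add: norm_mult power_mult_distrib ennreal_mult nn_integral_cmult)

definition ec :: "real \<Rightarrow> complex" where "ec x = cis (2 * pi * x)"

lemma norm_ec [simp]: "cmod (ec x) = 1"
  by (simp add: ec_def)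

lemma ec_add: "ec (x + y) = ec x * ec y"
  by (simp add: ec_def cis_mult distrib_left)

lemma cnj_ec: "cnj (ec x) = ec (- x)"
  by (simp add: ec_def cis_cnj)

lemma ec_0 [simp]: "ec 0 = 1"
  by (simp add: ec_def)

lemma ec_of_int [simp]: "ec (of_int n) = 1"
  by (simp add: ec_def cis_multiple_2pi)

lemma continuous_on_ec [continuous_intros]: "continuous_on A f \<Longrightarrow> continuous_on A (\<lambda>x. ec (f x))"
  unfolding ec_def by (intro continuous_intros)

lemma measurable_ec [measurable]: "ec \<in> borel_measurable borel"
  by (intro borel_measurable_continuous_onI continuous_intros)

lemma ec_conv_exp: "ec x = exp (2 * pi * \<i> * of_real x)"
  by (simp add: ec_def cis_conv_exp mult_ac)

text \<open>The circle is modelled inside the line: values outside the interval are ignored, and the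
  interval is half-open so that its integer translates tile the line.\<close>

definition circ :: "real measure" where
  "circ = density lborel (indicator {0..<1})"

lemma sets_circ [measurable_cong, simp]: "sets circ = sets borel"
  by (simp add: circ_def)

lemma space_circ [simp]: "space circ = UNIV"
  by (simp add: circ_def)

lemma emeasure_circ: "A \<in> sets borel \<Longrightarrow> emeasure circ A = emeasure lborel ({0..<1} \<inter> A)"
  unfolding circ_def by (subst emeasure_density) (auto simp: nn_integral_indicator' indicator_inter_arith[symmetric])

interpretation circ: finite_measure circ
  by standard (simp add: emeasure_circ)

lemma emeasure_circ_UNIV [simp]: "emeasure circ UNIV = 1"
  by (simp add: emeasure_circ)

lemma measure_circ [simp]: "measure circ UNIV = 1"
  by (simp add: measure_def emeasure_circ)

lemma AE_circ: "AE x in circ. x \<in> {0..<1}"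
  unfolding circ_def by (subst AE_density) (auto simp: indicator_def)

lemma integral_ec_int: "(LINT x|circ. ec (of_int n * x)) = (if n = 0 then 1 else 0)"
proof (cases "n = 0")
  case True
  then show ?thesis by simp
next
  case False
  have eq: "(LINT x|circ. ec (of_int n * x)) = (LINT x|lborel. indicator {0..<1} x *\<^sub>R ec (of_int n * x))"
    unfolding circ_def
    by (subst integral_density[of _ _ "indicator {0..<1}", unfolded ennreal_indicator]) auto
  also have "\<dots> = (LINT x|lborel. indicator {0..1} x *\<^sub>R ec (of_int n * x))"
  proof (rule integral_cong_AE)
    show "AE x in lborel. indicator {0..<1} x *\<^sub>R ec (of_int n * x) = indicator {0..1} x *\<^sub>R ec (of_int n * x)"
      using AE_lborel_singleton[of 1] by eventually_elim (auto simp: indicator_def)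
  qed measurable
  also have "\<dots> = ec (of_int n * 1) / (2 * pi * \<i> * of_int n) - ec (of_int n * 0) / (2 * pi * \<i> * of_int n)"
  proof (rule integral_FTC_Icc)
    show "(0::real) \<le> 1" by simp
    show "continuous_on {0..1} (\<lambda>x. ec (of_int n * x))"
      by (intro continuous_intros)
    fix x :: real
    let ?k = "2 * pi * \<i> * of_int n"
    have k: "?k \<noteq> 0" using False by simp
    have "((\<lambda>z. exp (?k * z) / ?k) has_field_derivative exp (?k * of_real x)) (at (of_real x))"
      using k by (auto intro!: derivative_eq_intros)
    then have "((\<lambda>x. exp (?k * of_real x) / ?k) has_vector_derivative exp (?k * of_real x)) (at x within {0..1})"
      by (rule has_vector_derivative_real_field)
    then show "((\<lambda>x. ec (of_int n * x) / (2 * pi * \<i> * of_int n)) has_vector_derivative ec (of_int n * x)) (at x within {0..1})"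
      by (simp add: ec_conv_exp mult_ac)
  qed
  also have "\<dots> = 0" by simp
  finally show ?thesis using False by simp
qed

section \<open>Density of trigonometric polynomials in the square integrable functions on the
  circle\<close>

definition trig_approx :: "(real \<Rightarrow> complex) \<Rightarrow> bool" where
  "trig_approx f \<longleftrightarrow> (\<forall>\<epsilon>>0. \<exists>S p. finite S \<and>
     l2sq circ (\<lambda>x. f x - (\<Sum>n\<in>S. p n * ec (of_int n * x))) < \<epsilon>)"

text \<open>Generating the sums of \<open>trig_approx\<close> inductively makes closure under
  products, and under real polynomials in \<open>Re\<close> and \<open>Im\<close> of
  \<open>ec\<close>, a matter of rule induction; \<open>trig_imp_sum\<close> leads back to explicit
  sums.\<close>

inductive trig :: "(real \<Rightarrow> complex) \<Rightarrow> bool" where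
  trig_ec: "trig (\<lambda>x. c * ec (of_int n * x))"
| trig_add: "trig f \<Longrightarrow> trig g \<Longrightarrow> trig (\<lambda>x. f x + g x)"

lemma trig_const: "trig (\<lambda>x. c)"
  using trig_ec[of c 0] by simp

lemma trig_ec_mult: "trig f \<Longrightarrow> trig (\<lambda>x. (c * ec (of_int n * x)) * f x)"
proof (induction rule: trig.induct)
  case (trig_ec d m)
  have "(\<lambda>x. c * ec (of_int n * x) * (d * ec (of_int m * x))) = (\<lambda>x. (c * d) * ec (of_int (n + m) * x))"
    by (simp add: ec_add distrib_right algebra_simps flip: of_int_add)
       (simp add: ec_add distrib_left mult_ac)
  then show ?case by (metis trig.trig_ec)
next
  case (trig_add f g)
  then show ?case by (simp add: distrib_left trig.trig_add)
qed

lemma trig_mult: "trig f \<Longrightarrow> trig g \<Longrightarrow> trig (\<lambda>x. f x * g x)"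
proof (induction rule: trig.induct)
  case (trig_ec c n)
  then show ?case by (rule trig_ec_mult)
next
  case (trig_add f g)
  then show ?case by (simp add: distrib_right trig.trig_add)
qed

lemma trig_imp_sum: "trig f \<Longrightarrow> \<exists>S p. finite S \<and> (\<forall>x. f x = (\<Sum>n\<in>S. p n * ec (of_int n * x)))"
proof (induction rule: trig.induct)
  case (trig_ec c n)
  show ?case by (intro exI[of _ "{n}"] exI[of _ "\<lambda>_. c"]) simp
next
  case (trig_add f g)
  then obtain S p T q where *: "finite S" "\<And>x. f x = (\<Sum>n\<in>S. p n * ec (of_int n * x))"
    "finite T" "\<And>x. g x = (\<Sum>n\<in>T. q n * ec (of_int n * x))" by auto
  have "f x + g x = (\<Sum>n\<in>S \<union> T. ((if n \<in> S then p n else 0) + (if n \<in> T then q n else 0)) * ec (of_int n * x))" for x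
  proof -
    have "f x = (\<Sum>n\<in>S \<union> T. (if n \<in> S then p n else 0) * ec (of_int n * x))"
      unfolding * using *(1,3) by (intro sum.mono_neutral_cong_left) auto
    moreover have "g x = (\<Sum>n\<in>S \<union> T. (if n \<in> T then q n else 0) * ec (of_int n * x))"
      unfolding * using *(1,3) by (intro sum.mono_neutral_cong_left) auto
    ultimately show ?thesis by (simp add: distrib_right sum.distrib)
  qed
  then show ?case using *(1,3) by (intro exI[of _ "S \<union> T"] exI) auto
qed

lemma trig_sum: "trig (\<lambda>x. \<Sum>n\<in>S. p n * ec (of_int n * x))"
  by (induction S rule: infinite_finite_induct) (auto intro: trig_const trig_add trig_ec)

lemma trig_approx_alt:
  "trig_approx f \<longleftrightarrow> (\<forall>\<epsilon>>0. \<exists>q. trig q \<and> l2sq circ (\<lambda>x. f x - q x) < \<epsilon>)"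
  unfolding trig_approx_def
proof (intro iffI allI impI)
  fix \<epsilon> :: ennreal assume "\<epsilon> > 0"
  moreover assume "\<forall>\<epsilon>>0. \<exists>S p. finite S \<and> l2sq circ (\<lambda>x. f x - (\<Sum>n\<in>S. p n * ec (of_int n * x))) < \<epsilon>"
  ultimately obtain S p where "l2sq circ (\<lambda>x. f x - (\<Sum>n\<in>S. p n * ec (of_int n * x))) < \<epsilon>" by blast
  then show "\<exists>q. trig q \<and> l2sq circ (\<lambda>x. f x - q x) < \<epsilon>"
    using trig_sum by (intro exI conjI)
next
  fix \<epsilon> :: ennreal assume "\<epsilon> > 0"
  moreover assume "\<forall>\<epsilon>>0. \<exists>q. trig q \<and> l2sq circ (\<lambda>x. f x - q x) < \<epsilon>"
  ultimately obtain q where q: "trig q" "l2sq circ (\<lambda>x. f x - q x) < \<epsilon>" by blast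
  from trig_imp_sum[OF q(1)] obtain S p where "finite S" "\<And>x. q x = (\<Sum>n\<in>S. p n * ec (of_int n * x))" by blast
  then show "\<exists>S p. finite S \<and> l2sq circ (\<lambda>x. f x - (\<Sum>n\<in>S. p n * ec (of_int n * x))) < \<epsilon>"
    using q(2) by (intro exI[of _ S] exI[of _ p]) simp
qed

lemma trig_measurable: "trig f \<Longrightarrow> f \<in> borel_measurable borel"
  by (induction rule: trig.induct) auto

lemma trig_approx_of_close:
  assumes [measurable]: "f \<in> borel_measurable borel"
    and close: "\<And>\<epsilon>. \<epsilon> > 0 \<Longrightarrow> \<exists>g. g \<in> borel_measurable borel \<and> trig_approx g \<and> l2sq circ (\<lambda>x. f x - g x) < \<epsilon>"
  shows "trig_approx f"
  unfolding trig_approx_alt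
proof (intro allI impI)
  fix \<epsilon> :: ennreal assume e: "\<epsilon> > 0"
  \<comment> \<open>\<open>l2sq_add_le\<close> doubles both errors, hence a quarter of \<epsilon>;
    as \<epsilon> is extended, the value \<open>top\<close> is a separate case.\<close>
  then obtain \<delta> where d: "\<delta> > 0" "4 * \<delta> \<le> \<epsilon>"
  proof (cases "\<epsilon> = top")
    case True then show ?thesis using that[of 1] by simp
  next
    case False
    then obtain r where r: "\<epsilon> = ennreal r" "r > 0"
      using e by (cases \<epsilon>) auto
    then have "4 * ennreal (r / 4) = \<epsilon>"
      by (simp add: ennreal_mult[symmetric] flip: ennreal_numeral)
    then show ?thesis using that[of "ennreal (r / 4)"] r by auto
  qed
  from close[OF d(1)] obtain g where [measurable]: "g \<in> borel_measurable borel"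
    and g: "trig_approx g" "l2sq circ (\<lambda>x. f x - g x) < \<delta>" by blast
  from g(1) d(1) obtain q where q: "trig q" "l2sq circ (\<lambda>x. g x - q x) < \<delta>"
    unfolding trig_approx_alt by blast
  note [measurable] = trig_measurable[OF q(1)]
  have "l2sq circ (\<lambda>x. f x - q x) \<le> 2 * l2sq circ (\<lambda>x. f x - g x) + 2 * l2sq circ (\<lambda>x. g x - q x)"
    using l2sq_add_le[of "\<lambda>x. f x - g x" circ "\<lambda>x. g x - q x"] by simp
  also have "\<dots> < 2 * \<delta> + 2 * \<delta>"
    using g(2) q(2) by (intro add_strict_mono ennreal_mult_strict_left_mono) auto
  also have "\<dots> \<le> \<epsilon>" using d(2) by (simp add: distrib_right[symmetric])
  finally show "\<exists>q. trig q \<and> l2sq circ (\<lambda>x. f x - q x) < \<epsilon>" using q(1) by blast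
qed

text \<open>Dominated convergence in a form that serves all three later limits: cut-offs of open
  sets, disjoint unions, and simple functions.\<close>

lemma trig_approx_lim:
  assumes [measurable]: "f \<in> borel_measurable borel" "\<And>i. s i \<in> borel_measurable borel" "w \<in> borel_measurable borel"
    and s: "\<And>i. trig_approx (s i)"
    and lim: "AE x in circ. (\<lambda>i. s i x) \<longlonglongrightarrow> f x"
    and bound: "\<And>i. AE x in circ. cmod (s i x) \<le> w x" "AE x in circ. cmod (f x) \<le> w x"
    and fin: "(\<integral>\<^sup>+x. ennreal ((w x)\<^sup>2) \<partial>circ) < \<infinity>"
  shows "trig_approx f"
proof (rule trig_approx_of_close)
  have "(\<lambda>i. l2sq circ (\<lambda>x. f x - s i x)) \<longlonglongrightarrow> (\<integral>\<^sup>+x. 0 \<partial>circ)"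
    unfolding l2sq_def
  proof (rule nn_integral_dominated_convergence[where w="\<lambda>x. 4 * ennreal ((w x)\<^sup>2)"])
    fix i
    show "AE x in circ. ennreal ((cmod (f x - s i x))\<^sup>2) \<le> 4 * ennreal ((w x)\<^sup>2)"
      using bound(1)[of i] bound(2)
    proof eventually_elim
      case (elim x)
      have "(cmod (f x - s i x))\<^sup>2 \<le> (w x + w x)\<^sup>2"
        using elim norm_triangle_ineq4[of "f x" "s i x"] by (intro power_mono) auto
      then have "ennreal ((cmod (f x - s i x))\<^sup>2) \<le> ennreal (4 * (w x)\<^sup>2)"
        by (intro ennreal_leI) (simp add: power2_eq_square algebra_simps)
      then show ?case by (simp add: ennreal_mult)
    qed
    show "(\<integral>\<^sup>+x. 4 * ennreal ((w x)\<^sup>2) \<partial>circ) < \<infinity>"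
      using fin by (simp add: nn_integral_cmult ennreal_mult_less_top)
    show "AE x in circ. (\<lambda>i. ennreal ((cmod (f x - s i x))\<^sup>2)) \<longlonglongrightarrow> 0"
      using lim
    proof eventually_elim
      case (elim x)
      have "(\<lambda>i. ennreal ((cmod (f x - s i x))\<^sup>2)) \<longlonglongrightarrow> ennreal ((cmod (f x - f x))\<^sup>2)"
        by (intro tendsto_intros tendsto_ennrealI elim)
      then show ?case by simp
    qed
  qed auto
  then have *: "(\<lambda>i. l2sq circ (\<lambda>x. f x - s i x)) \<longlonglongrightarrow> 0" by simp
  then show "\<exists>g. g \<in> borel_measurable borel \<and> trig_approx g \<and> l2sq circ (\<lambda>x. f x - g x) < \<epsilon>"
    if that0: "\<epsilon> > 0" for \<epsilon> :: ennreal
  proof -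
    obtain i where "l2sq circ (\<lambda>x. f x - s i x) < \<epsilon>"
      using eventually_happens'[OF sequentially_bot order_tendstoD(2)[OF * that0]] by blast
    then show ?thesis using s assms(2) by (intro exI[of _ "s i"]) auto
  qed
qed auto

lemma trig_approx_trig: "trig f \<Longrightarrow> trig_approx f"
  unfolding trig_approx_alt by (auto intro!: exI[of _ f] simp: l2sq_def)

lemma trig_approx_add:
  assumes [measurable]: "f \<in> borel_measurable borel" "g \<in> borel_measurable borel"
    and f: "trig_approx f" and g: "trig_approx g"
  shows "trig_approx (\<lambda>x. f x + g x)"
proof -
  have *: "trig_approx (\<lambda>x. f x + q x)" if q: "trig q" for q
    unfolding trig_approx_alt
  proof (intro allI impI)
    fix \<epsilon> :: ennreal assume "\<epsilon> > 0"
    with f obtain p where "trig p" "l2sq circ (\<lambda>x. f x - p x) < \<epsilon>" unfolding trig_approx_alt by blast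
    then show "\<exists>r. trig r \<and> l2sq circ (\<lambda>x. f x + q x - r x) < \<epsilon>"
      using q by (intro exI[of _ "\<lambda>x. p x + q x"]) (auto intro: trig_add simp: add_diff_add)
  qed
  show ?thesis
  proof (rule trig_approx_of_close)
    fix \<epsilon> :: ennreal assume "\<epsilon> > 0"
    with g obtain q where q: "trig q" "l2sq circ (\<lambda>x. g x - q x) < \<epsilon>" unfolding trig_approx_alt by blast
    then show "\<exists>h. h \<in> borel_measurable borel \<and> trig_approx h \<and> l2sq circ (\<lambda>x. f x + g x - h x) < \<epsilon>"
      using trig_measurable[OF q(1)] *[OF q(1)] by (intro exI[of _ "\<lambda>x. f x + q x"]) auto
  qed simp
qed

lemma trig_approx_cmult:
  assumes [measurable]: "f \<in> borel_measurable borel" and f: "trig_approx f"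
  shows "trig_approx (\<lambda>x. c * f x)"
proof (cases "c = 0")
  case True
  then show ?thesis using trig_approx_trig[OF trig_const[of 0]] by simp
next
  case False
  show ?thesis
    unfolding trig_approx_alt
  proof (intro allI impI)
    fix \<epsilon> :: ennreal assume e: "\<epsilon> > 0"
    let ?k = "ennreal ((cmod c)\<^sup>2)"
    have k: "?k > 0" "?k < top" using False by auto
    have "\<epsilon> / ?k > 0" using e k by (simp add: ennreal_zero_less_divide)
    with f obtain p where p: "trig p" "l2sq circ (\<lambda>x. f x - p x) < \<epsilon> / ?k" unfolding trig_approx_alt by blast
    note [measurable] = trig_measurable[OF p(1)]
    have "l2sq circ (\<lambda>x. c * f x - c * p x) = ?k * l2sq circ (\<lambda>x. f x - p x)"
      by (subst l2sq_cmult[symmetric]) (auto simp: right_diff_distrib)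
    also have "\<dots> < ?k * (\<epsilon> / ?k)" using p(2) k by (intro ennreal_mult_strict_left_mono) auto
    also have "\<dots> = \<epsilon>" using k by (simp add: ennreal_times_divide mult.commute ennreal_mult_divide_eq)
    finally show "\<exists>q. trig q \<and> l2sq circ (\<lambda>x. c * f x - q x) < \<epsilon>"
      using trig_mult[OF trig_const p(1)] by blast
  qed
qed

lemma trig_approx_cong:
  assumes "trig_approx f" "\<And>x. x \<in> {0..<1} \<Longrightarrow> f x = g x"
  shows "trig_approx g"
proof -
  have "l2sq circ (\<lambda>x. f x - q x) = l2sq circ (\<lambda>x. g x - q x)" for q
    unfolding l2sq_def using AE_circ by (intro nn_integral_cong_AE) (auto simp: assms(2))
  then show ?thesis using assms(1) unfolding trig_approx_def by simp
qed

text \<open>Supplies the linear case in the induction over real polynomial functions: everything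
  reduces to \<open>Re\<close> and \<open>Im\<close>, which are trigonometric on the circle.\<close>

lemma complex_linear_eq: "bounded_linear h \<Longrightarrow> h z = Re z * h 1 + Im z * h \<i>" for h :: "complex \<Rightarrow> real"
proof -
  assume h: "bounded_linear h"
  have "h z = h (Re z *\<^sub>R 1 + Im z *\<^sub>R \<i>)"
    by (rule arg_cong[where f=h]) (simp add: complex_eq_iff)
  then show ?thesis
    by (simp add: bounded_linear.linear[OF h] linear_add linear_scale)
qed

lemma trig_Re_Im_ec: "trig (\<lambda>x. complex_of_real (Re (ec x)))" "trig (\<lambda>x. complex_of_real (Im (ec x)))"
proof -
  have 1: "trig (\<lambda>x. (1/2) * ec (of_int 1 * x) + (1/2) * ec (of_int (-1) * x))"
    by (intro trig_add trig_ec)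
  have 2: "trig (\<lambda>x. (- \<i>/2) * ec (of_int 1 * x) + (\<i>/2) * ec (of_int (-1) * x))"
    by (intro trig_add trig_ec)
  have "(\<lambda>x. (1/2) * ec (of_int 1 * x) + (1/2) * ec (of_int (-1) * x)) = (\<lambda>x. complex_of_real (Re (ec x)))"
    by (auto simp: ec_def complex_eq_iff)
  with 1 show "trig (\<lambda>x. complex_of_real (Re (ec x)))" by simp
  have "(\<lambda>x. (- \<i>/2) * ec (of_int 1 * x) + (\<i>/2) * ec (of_int (-1) * x)) = (\<lambda>x. complex_of_real (Im (ec x)))"
    by (auto simp: ec_def complex_eq_iff)
  with 2 show "trig (\<lambda>x. complex_of_real (Im (ec x)))" by simp
qed

lemma trig_polynomial_ec: "real_polynomial_function q \<Longrightarrow> trig (\<lambda>x. complex_of_real (q (ec x)))"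
proof (induction rule: real_polynomial_function.induct)
  case (linear h)
  have "trig (\<lambda>x. complex_of_real (Re (ec x)) * complex_of_real (h 1) + complex_of_real (Im (ec x)) * complex_of_real (h \<i>))"
    by (intro trig_add trig_mult trig_Re_Im_ec trig_const)
  then show ?case by (subst complex_linear_eq[OF linear]) simp
next
  case (const c)
  then show ?case by (rule trig_const)
next
  case (add f g)
  then show ?case using trig_add by simp
next
  case (mult f g)
  then show ?case using trig_mult by simp
qed

text \<open>Stone-Weierstrass on the unit circle as a compact subset of the plane. A uniform error
  \<open>sqrt r\<close> costs at most \<open>r\<close> in \<open>l2sq\<close> because
  \<open>circ\<close> has total mass 1.\<close>

lemma trig_approx_continuous:
  assumes f: "continuous_on UNIV (f :: complex \<Rightarrow> real)"
  shows "trig_approx (\<lambda>x. complex_of_real (f (ec x)))"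
proof (rule trig_approx_of_close)
  note [measurable] = borel_measurable_continuous_onI[OF f]
  show "(\<lambda>x. complex_of_real (f (ec x))) \<in> borel_measurable borel" by measurable
  fix \<epsilon> :: ennreal assume e: "\<epsilon> > 0"
  obtain r where r: "r > 0" "ennreal r < \<epsilon>"
    using e dense[of 0 \<epsilon>] by (metis ennreal_cases ennreal_less_zero_iff not_less top_greatest)
  obtain q where q: "real_polynomial_function q" "\<And>z. z \<in> sphere 0 1 \<Longrightarrow> \<bar>f z - q z\<bar> < sqrt r"
    using Stone_Weierstrass_real_polynomial_function[of "sphere 0 1" f "sqrt r"] r continuous_on_subset[OF f]
    by (metis compact_sphere real_sqrt_gt_0_iff subset_UNIV)
  have "l2sq circ (\<lambda>x. complex_of_real (f (ec x)) - complex_of_real (q (ec x))) \<le> (\<integral>\<^sup>+x. ennreal r \<partial>circ)"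
    unfolding l2sq_def
  proof (intro nn_integral_mono ennreal_leI)
    fix x
    have "\<bar>f (ec x) - q (ec x)\<bar> \<le> sqrt r" using q(2)[of "ec x"] by simp
    then have "\<bar>f (ec x) - q (ec x)\<bar>\<^sup>2 \<le> (sqrt r)\<^sup>2" by (intro power_mono) auto
    then show "(cmod (complex_of_real (f (ec x)) - complex_of_real (q (ec x))))\<^sup>2 \<le> r"
      using r by (simp flip: of_real_diff)
  qed
  also have "\<dots> < \<epsilon>" using r by (simp add: emeasure_circ)
  finally show "\<exists>g. g \<in> borel_measurable borel \<and> trig_approx g \<and> l2sq circ (\<lambda>x. complex_of_real (f (ec x)) - g x) < \<epsilon>"
    using trig_approx_trig[OF trig_polynomial_ec[OF q(1)]] trig_measurable[OF trig_polynomial_ec[OF q(1)]] by blast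
qed

text \<open>Dynkin's argument: the open sets are closed under intersection and generate the Borel
  sets, and approximability of the indicator survives complements and countable disjoint
  unions.\<close>

lemma trig_approx_indicator_vimage:
  assumes "B \<in> sets (borel :: complex measure)"
  shows "trig_approx (\<lambda>x. indicator B (ec x))"
proof -
  have B: "B \<in> sigma_sets UNIV {S. open (S :: complex set)}"
    using assms by (simp add: borel_def)
  have I: "Int_stable {S. open (S :: complex set)}"
    by (auto simp: Int_stable_def)
  have P: "{S. open (S :: complex set)} \<subseteq> Pow UNIV" by simp
  from I P B show ?thesis
  proof (induction rule: sigma_sets_induct_disjoint)
    case (basic U)
    then have U: "open U" by simp
    show ?case
    \<comment> \<open>\<open>infdist\<close> to the empty set is 0 by convention, so the cut-offs
      below would vanish for the whole plane.\<close>
    proof (cases "U = UNIV")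
      case True
      then show ?thesis using trig_approx_trig[OF trig_const[of 1]] by simp
    next
      case False
      then have ne: "- U \<noteq> {}" by auto
      let ?s = "\<lambda>i z. min 1 (of_nat i * infdist z (- U))"
      have s: "continuous_on UNIV (?s i)" for i
        by (intro continuous_intros)
      have [measurable]: "U \<in> sets borel" using U by simp
      have [measurable]: "(\<lambda>x. ?s i (ec x)) \<in> borel_measurable borel" for i
        using borel_measurable_continuous_onI[OF s[of i]] by measurable
      show ?thesis
      proof (rule trig_approx_lim[where w="\<lambda>_. 1" and s="\<lambda>i x. complex_of_real (?s i (ec x))"])
        show "trig_approx (\<lambda>x. complex_of_real (?s i (ec x)))" for i
          by (rule trig_approx_continuous[OF s])
        have "(\<lambda>i. ?s i z) \<longlonglongrightarrow> indicator U z" for z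
        proof (cases "z \<in> U")
          case True
          then have p: "infdist z (- U) > 0"
            using in_closed_iff_infdist_zero[of "- U" z] U ne infdist_nonneg[of z "- U"]
            by (auto simp: closed_def less_le)
          obtain n where n: "1 \<le> of_nat n * infdist z (- U)"
            using reals_Archimedean3[OF p] by (metis less_imp_le)
          have "\<forall>\<^sub>F i in sequentially. ?s i z = 1"
            using eventually_ge_at_top[of n]
          proof eventually_elim
            case (elim i)
            then have "of_nat n * infdist z (- U) \<le> of_nat i * infdist z (- U)"
              using p by (intro mult_right_mono) auto
            with n show ?case by simp
          qed
          then show ?thesis using True by (simp add: tendsto_eventually)
        next
          case False
          then show ?thesis by simp
        qed
        then have "(\<lambda>i. complex_of_real (?s i z)) \<longlonglongrightarrow> complex_of_real (indicator U z)" for z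
          by (intro tendsto_of_real)
        moreover have "complex_of_real (indicator U z) = indicator U z" for z
          by (simp add: indicator_def)
        ultimately show "AE x in circ. (\<lambda>i. complex_of_real (?s i (ec x))) \<longlonglongrightarrow> indicator U (ec x)"
          by simp
        show "AE x in circ. cmod (complex_of_real (?s i (ec x))) \<le> 1" for i
          by (simp add: infdist_nonneg)
        show "(\<integral>\<^sup>+x. ennreal (1\<^sup>2) \<partial>circ) < \<infinity>" by (simp add: emeasure_circ)
      qed (auto simp: indicator_def)
    qed
  next
    case empty
    then show ?case using trig_approx_trig[OF trig_const[of 0]] by simp
  next
    case (compl A)
    then have [measurable]: "A \<in> sets borel" by (simp add: borel_def)
    have "trig_approx (\<lambda>x. 1 + (-1) * indicator A (ec x))"
      by (intro trig_approx_add trig_approx_cmult compl(2) trig_approx_trig[OF trig_const]) auto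
    then show ?case by (rule trig_approx_cong) (auto simp: indicator_def)
  next
    case (union A)
    then have A[measurable]: "A i \<in> sets borel" for i by (auto simp: borel_def)
    have *: "trig_approx (\<lambda>x. \<Sum>i<n. indicator (A i) (ec x))" for n :: nat
    proof (induction n)
      case 0
      then show ?case using trig_approx_trig[OF trig_const[of 0]] by simp
    next
      case (Suc n)
      then show ?case by (simp add: trig_approx_add union(3))
    qed
    have sum_eq: "(\<Sum>i<n. indicator (A i) z) = (indicator (\<Union>i<n. A i) z :: complex)" for n z
      using union(1) by (subst indicator_UN_disjoint) (auto intro: disjoint_family_on_mono)
    show ?case
    proof (rule trig_approx_lim[where w="\<lambda>_. 1", OF _ _ _ *])
      have "(\<lambda>n. indicator (\<Union>i<n. A i) z :: complex) \<longlonglongrightarrow> indicator (\<Union>i. A i) z" for z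
        by (rule LIMSEQ_indicator_UN)
      then show "AE x in circ. (\<lambda>n. \<Sum>i<n. indicator (A i) (ec x)) \<longlonglongrightarrow> (indicator (\<Union>i. A i) (ec x) :: complex)"
        unfolding sum_eq by simp
      show "AE x in circ. cmod (\<Sum>i<n. indicator (A i) (ec x)) \<le> 1" for n
        unfolding sum_eq by (simp add: indicator_def)
      show "(\<integral>\<^sup>+x. ennreal (1\<^sup>2) \<partial>circ) < \<infinity>" by (simp add: emeasure_circ)
    qed (auto simp: indicator_def)
  qed
qed

text \<open>The inverse of \<open>ec\<close> on \<open>[0, 1)\<close>; it moves indicator functions from the unit interval to the circle,
  where the Stone--Weierstrass theorem applies.\<close>

definition circ_arg :: "complex \<Rightarrow> real" where
  "circ_arg z = (if Im z \<ge> 0 then arccos (max (-1) (min 1 (Re z))) / (2 * pi)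
     else 1 - arccos (max (-1) (min 1 (Re z))) / (2 * pi))"

lemma measurable_circ_arg [measurable]: "circ_arg \<in> borel_measurable borel"
proof -
  have "continuous_on UNIV (\<lambda>z :: complex. arccos (max (-1) (min 1 (Re z))))"
    by (intro continuous_intros) auto
  from borel_measurable_continuous_onI[OF this] show ?thesis
    unfolding circ_arg_def by measurable
qed

lemma circ_arg_ec:
  assumes "x \<in> {0..<1}"
  shows "circ_arg (ec x) = x"
proof (cases "x \<le> 1 / 2")
  case True
  then have "2 * pi * x \<le> pi" by (simp add: field_simps)
  then have "sin (2 * pi * x) \<ge> 0" "arccos (cos (2 * pi * x)) = 2 * pi * x"
    using assms by (auto intro!: sin_ge_zero arccos_cos)
  then show ?thesis by (simp add: circ_arg_def ec_def)
next
  case False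
  then have *: "2 * pi * x > pi" "2 * pi * x < 2 * pi"  using assms by auto
  have "sin (2 * pi * x) < 0" using * by (intro sin_lt_zero) auto
  moreover have "arccos (cos (2 * pi * x)) = arccos (cos (2 * pi - 2 * pi * x))" by simp
  moreover have "\<dots> = 2 * pi - 2 * pi * x" using * by (intro arccos_cos) auto
  ultimately show ?thesis by (simp add: circ_arg_def ec_def field_simps)
qed

lemma trig_approx_indicator:
  assumes "A \<in> sets borel"
  shows "trig_approx (\<lambda>x. c * indicator A x)"
proof -
  let ?B = "circ_arg -` A"
  have "?B \<in> sets borel" using measurable_sets[OF measurable_circ_arg, of A] assms by simp
  from trig_approx_indicator_vimage[OF this] have "trig_approx (\<lambda>x. c * indicator ?B (ec x))"
    using \<open>?B \<in> sets borel\<close> by (intro trig_approx_cmult) auto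
  then show ?thesis
    by (rule trig_approx_cong) (auto simp: indicator_def circ_arg_ec)
qed

lemma trig_approx_sum:
  assumes "finite I" "\<And>i. i \<in> I \<Longrightarrow> f i \<in> borel_measurable borel" "\<And>i. i \<in> I \<Longrightarrow> trig_approx (f i)"
  shows "trig_approx (\<lambda>x. \<Sum>i\<in>I. f i x)"
  using assms
proof (induction I)
  case empty
  then show ?case using trig_approx_trig[OF trig_const[of 0]] by simp
next
  case (insert i I)
  then show ?case by (simp add: trig_approx_add)
qed

text \<open>Simple functions converging to \<open>f\<close> and bounded by
  \<open>2 * cmod (f x)\<close> come with the dominating function that
  \<open>trig_approx_lim\<close> asks for.\<close>

lemma trig_approx_l2:
  assumes f[measurable]: "f \<in> borel_measurable borel" and fin: "l2sq circ f < \<infinity>"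
  shows "trig_approx f"
proof -
  obtain s where s: "\<And>i. simple_function borel (s i)" "\<And>x. (\<lambda>i. s i x) \<longlonglongrightarrow> f x"
    "\<And>i x. cmod (s i x) \<le> 2 * cmod (f x)"
    using borel_measurable_implies_sequence_metric[OF f, of 0] unfolding norm_conv_dist
    by (metis UNIV_I space_borel)
  have [measurable]: "s i \<in> borel_measurable borel" for i
    using s(1) by (rule borel_measurable_simple_function)
  have 4: "(\<integral>\<^sup>+x. ennreal ((2 * cmod (f x))\<^sup>2) \<partial>circ) < \<infinity>"
  proof -
    have "(\<integral>\<^sup>+x. ennreal ((2 * cmod (f x))\<^sup>2) \<partial>circ) = 4 * l2sq circ f"
      unfolding l2sq_def by (simp add: power_mult_distrib ennreal_mult nn_integral_cmult)
    then show ?thesis using fin by (simp add: ennreal_mult_less_top)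
  qed
  have "trig_approx (s i)" for i
  proof -
    have "s i x = (\<Sum>y\<in>range (s i). y * indicator (s i -` {y}) x)" for x
    proof -
      have "(\<Sum>y\<in>range (s i). y * indicator (s i -` {y}) x) = (\<Sum>y\<in>range (s i). if y = s i x then y else 0)"
        by (intro sum.cong) (auto simp: indicator_def)
      then show ?thesis using s(1)[of i] by (simp add: simple_function_def)
    qed
    then have eq: "s i = (\<lambda>x. \<Sum>y\<in>range (s i). y * indicator (s i -` {y}) x)" by blast
    have m: "s i -` {y} \<in> sets borel" for y
      using measurable_sets[of "s i" borel borel "{y}"] by simp
    show ?thesis
      apply (subst eq)
      using s(1)[of i] m by (intro trig_approx_sum trig_approx_indicator) (auto simp: simple_function_def)
  qed
  then show ?thesis
    using 4 s by (intro trig_approx_lim[of f s "\<lambda>x. 2 * cmod (f x)"])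
      (auto intro: order_trans[of _ "2 * cmod (f _)"])
qed

section \<open>Fourier coefficients and Parseval's identity\<close>

lemma sum_le_nn_integral_count_space:
  fixes f :: "'a \<Rightarrow> ennreal"
  assumes "finite F"
  shows "sum f F \<le> (\<integral>\<^sup>+x. f x \<partial>count_space UNIV)"
proof -
  have "sum f F = (\<integral>\<^sup>+x. f x * indicator F x \<partial>count_space UNIV)"
    using assms by (subst nn_integral_indicator_finite) (auto simp: one_ennreal_def[symmetric])
  also have "\<dots> \<le> (\<integral>\<^sup>+x. f x \<partial>count_space UNIV)"
    by (intro nn_integral_mono) (auto simp: indicator_def)
  finally show ?thesis .
qed

lemma nn_integral_count_space_le:
  fixes f :: "'a::countable \<Rightarrow> ennreal"
  assumes inf: "infinite (UNIV :: 'a set)" and le: "\<And>F. finite F \<Longrightarrow> sum f F \<le> B"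
  shows "(\<integral>\<^sup>+x. f x \<partial>count_space UNIV) \<le> B"
proof -
  let ?g = "from_nat_into (UNIV :: 'a set)"
  have g: "bij_betw ?g UNIV UNIV"
    using inf by (intro bij_betw_from_nat_into) simp_all
  have "(\<integral>\<^sup>+x. f x \<partial>count_space UNIV) = (\<Sum>n. f (?g n))"
    by (simp add: nn_integral_bij_count_space[OF g, symmetric] nn_integral_count_space_nat)
  also have "\<dots> \<le> B"
  proof (rule suminf_le_const)
    fix n
    have "(\<Sum>i<n. f (?g i)) = sum f (?g ` {..<n})"
      using g by (subst sum.reindex) (auto simp: bij_betw_def intro: inj_on_subset)
    then show "(\<Sum>i<n. f (?g i)) \<le> B" using le by simp
  qed simp
  finally show ?thesis .
qed

lemma l2sq_integrable:
  assumes [measurable]: "f \<in> borel_measurable M" and "l2sq M f < \<infinity>"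
  shows "integrable M (\<lambda>x. (cmod (f x))\<^sup>2)"
  using assms unfolding l2sq_def by (intro integrableI_bounded) auto

lemma l2sq_eq_integral:
  assumes [measurable]: "f \<in> borel_measurable M" and "l2sq M f < \<infinity>"
  shows "l2sq M f = ennreal (LINT x|M. (cmod (f x))\<^sup>2)"
  unfolding l2sq_def by (intro nn_integral_eq_integral l2sq_integrable assms) auto

lemma integrable_l2_mult:
  assumes [measurable]: "f \<in> borel_measurable M" "g \<in> borel_measurable M"
    and "l2sq M f < \<infinity>" "l2sq M g < \<infinity>"
  shows "integrable M (\<lambda>x. f x * g x)"
proof (rule Bochner_Integration.integrable_bound)
  show "integrable M (\<lambda>x. (cmod (f x))\<^sup>2 + (cmod (g x))\<^sup>2)"
    by (intro Bochner_Integration.integrable_add l2sq_integrable assms)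
  have "cmod (f x * g x) \<le> (cmod (f x))\<^sup>2 + (cmod (g x))\<^sup>2" for x
    using sum_squares_bound[of "cmod (f x)" "cmod (g x)"] mult_nonneg_nonneg[OF norm_ge_zero norm_ge_zero, of "f x" "g x"]
    unfolding norm_mult mult.assoc by linarith
  then show "AE x in M. norm (f x * g x) \<le> norm ((cmod (f x))\<^sup>2 + (cmod (g x))\<^sup>2)"
    by simp
qed measurable

definition fcoeff :: "(real \<Rightarrow> complex) \<Rightarrow> int \<Rightarrow> complex" where
  "fcoeff f n = (LINT x|circ. f x * ec (of_int n * x))"

lemma l2sq_circ_ec: "l2sq circ (\<lambda>x. ec (h x)) = 1"
  by (simp add: l2sq_def emeasure_circ)

lemma integrable_circ_ec [simp]: "integrable circ (\<lambda>x. ec (of_int n * x))"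
  by (rule circ.integrable_const_bound[where B=1]) auto

text \<open>Expanding the square gives both halves of Parseval: \<open>p = c\<close> yields Bessel's
  inequality, and dropping the last sum bounds \<open>l2sq circ f\<close> by an approximation error
  plus the coefficients. Sums stand on both sides because subtraction in \<open>ennreal\<close> is
  truncated. The sign in \<open>c\<close> reflects that \<open>fcoeff\<close> integrates against
  \<open>ec\<close> without conjugation.\<close>

lemma l2sq_circ_diff_trig:
  assumes f[measurable]: "f \<in> borel_measurable borel" and fin: "l2sq circ f < \<infinity>" and S: "finite S"
  defines "c \<equiv> \<lambda>n. fcoeff f (- n)"
  shows "l2sq circ (\<lambda>x. f x - (\<Sum>n\<in>S. p n * ec (of_int n * x))) + ennreal (\<Sum>n\<in>S. (cmod (c n))\<^sup>2)
     = l2sq circ f + ennreal (\<Sum>n\<in>S. (cmod (c n - p n))\<^sup>2)"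
proof -
  let ?q = "\<lambda>x. \<Sum>n\<in>S. p n * ec (of_int n * x)"
  have q[measurable]: "?q \<in> borel_measurable borel" by measurable
  have i1: "integrable circ (\<lambda>x. f x * ec (of_int n * x))" for n
    by (intro integrable_l2_mult fin) (auto simp: l2sq_circ_ec)
  have i2: "integrable circ (\<lambda>x. cnj (f x) * ec (of_int n * x))" for n
    by (intro integrable_l2_mult) (use fin in \<open>auto simp: l2sq_circ_ec l2sq_def\<close>)
  have i2': "(LINT x|circ. cnj (f x) * ec (of_int n * x)) = cnj (c n)" for n
  proof -
    have "cnj (c n) = (LINT x|circ. cnj (f x * ec (of_int (- n) * x)))"
      unfolding c_def fcoeff_def by (simp del: complex_cnj_mult)
    then show ?thesis by (simp add: cnj_ec)
  qed
  have i3: "integrable circ (\<lambda>x. complex_of_real ((cmod (f x))\<^sup>2))"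
    using l2sq_integrable[OF _ fin] by (intro integrable_of_real) simp
  have expand: "complex_of_real ((cmod (f x - ?q x))\<^sup>2) = complex_of_real ((cmod (f x))\<^sup>2)
      - (\<Sum>n\<in>S. cnj (p n) * (f x * ec (of_int (- n) * x))) - (\<Sum>n\<in>S. p n * (cnj (f x) * ec (of_int n * x)))
      + (\<Sum>n\<in>S. \<Sum>m\<in>S. p n * cnj (p m) * ec (of_int (n - m) * x))" for x
  proof -
    have "(\<Sum>n\<in>S. \<Sum>m\<in>S. p n * cnj (p m) * ec (of_int (n - m) * x)) = ?q x * cnj (?q x)"
    proof -
      have "ec (of_int (n - m) * x) = ec (of_int n * x) * ec (- (of_int m * x))" for n m
        by (simp add: left_diff_distrib flip: ec_add)
      then show ?thesis by (simp only: cnj_sum complex_cnj_mult cnj_ec sum_product mult_ac)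
    qed
    moreover have "(\<Sum>n\<in>S. cnj (p n) * (f x * ec (of_int (- n) * x))) = f x * cnj (?q x)"
      by (simp add: sum_distrib_left cnj_ec mult_ac)
    moreover have "(\<Sum>n\<in>S. p n * (cnj (f x) * ec (of_int n * x))) = ?q x * cnj (f x)"
      by (simp add: sum_distrib_left sum_distrib_right mult_ac)
    ultimately show ?thesis
      unfolding complex_norm_square by (simp add: algebra_simps)
  qed
  have int: "integrable circ (\<lambda>x. complex_of_real ((cmod (f x - ?q x))\<^sup>2))"
    unfolding expand
    by (intro Bochner_Integration.integrable_add Bochner_Integration.integrable_diff
        Bochner_Integration.integrable_sum integrable_mult_right i1 i2 i3 integrable_circ_ec)
  have "(LINT x|circ. complex_of_real ((cmod (f x - ?q x))\<^sup>2)) = (LINT x|circ. complex_of_real ((cmod (f x))\<^sup>2))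
      - (\<Sum>n\<in>S. cnj (p n) * c n) - (\<Sum>n\<in>S. p n * cnj (c n)) + (\<Sum>n\<in>S. p n * cnj (p n))"
  proof -
    have "(LINT x|circ. (\<Sum>n\<in>S. \<Sum>m\<in>S. p n * cnj (p m) * ec (of_int (n - m) * x)))
       = (\<Sum>n\<in>S. \<Sum>m\<in>S. p n * cnj (p m) * (if n - m = 0 then 1 else 0))"
      by (simp add: Bochner_Integration.integral_sum integral_ec_int del: of_int_diff)
    also have "\<dots> = (\<Sum>n\<in>S. p n * cnj (p n))"
      using S by (intro sum.cong) (simp_all add: if_distrib cong: if_cong)
    finally have 1: "(LINT x|circ. (\<Sum>n\<in>S. \<Sum>m\<in>S. p n * cnj (p m) * ec (of_int (n - m) * x))) = (\<Sum>n\<in>S. p n * cnj (p n))" .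
    have 2: "(LINT x|circ. (\<Sum>n\<in>S. p n * (cnj (f x) * ec (of_int n * x)))) = (\<Sum>n\<in>S. p n * cnj (c n))"
      using i2 by (simp add: Bochner_Integration.integral_sum i2')
    have 3: "(LINT x|circ. (\<Sum>n\<in>S. cnj (p n) * (f x * ec (of_int (- n) * x)))) = (\<Sum>n\<in>S. cnj (p n) * c n)"
      using i1[of "- _"] by (simp add: Bochner_Integration.integral_sum c_def fcoeff_def)
    show ?thesis
      unfolding expand 1[symmetric] 2[symmetric] 3[symmetric]
      by (subst Bochner_Integration.integral_add Bochner_Integration.integral_diff,
          (intro Bochner_Integration.integrable_add Bochner_Integration.integrable_diff
        Bochner_Integration.integrable_sum integrable_mult_right i1 i2 i3 integrable_circ_ec)+)+ (rule refl)
  qed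
  moreover have "(\<Sum>n\<in>S. complex_of_real ((cmod (c n - p n))\<^sup>2)) = (\<Sum>n\<in>S. complex_of_real ((cmod (c n))\<^sup>2))
     - (\<Sum>n\<in>S. cnj (p n) * c n) - (\<Sum>n\<in>S. p n * cnj (c n)) + (\<Sum>n\<in>S. p n * cnj (p n))"
    unfolding complex_norm_square
    by (simp add: sum_subtractf[symmetric] sum.distrib[symmetric] algebra_simps)
  ultimately have "complex_of_real ((LINT x|circ. (cmod (f x - ?q x))\<^sup>2) + (\<Sum>n\<in>S. (cmod (c n))\<^sup>2)) =
      complex_of_real ((LINT x|circ. (cmod (f x))\<^sup>2) + (\<Sum>n\<in>S. (cmod (c n - p n))\<^sup>2))"
    unfolding integral_complex_of_real of_real_add of_real_sum by algebra
  then have eq: "(LINT x|circ. (cmod (f x - ?q x))\<^sup>2) + (\<Sum>n\<in>S. (cmod (c n))\<^sup>2) =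
      (LINT x|circ. (cmod (f x))\<^sup>2) + (\<Sum>n\<in>S. (cmod (c n - p n))\<^sup>2)"
    unfolding of_real_eq_iff .
  have "l2sq circ (\<lambda>x. f x - ?q x) = ennreal (LINT x|circ. (cmod (f x - ?q x))\<^sup>2)"
    unfolding l2sq_def using integrable_Re[OF int] by (intro nn_integral_eq_integral) simp_all
  then show ?thesis
    unfolding l2sq_eq_integral[OF _ fin, simplified] using eq
    by (simp add: sum_nonneg flip: ennreal_plus)
qed

theorem parseval_circ:
  assumes f[measurable]: "f \<in> borel_measurable borel" and fin: "l2sq circ f < \<infinity>"
  shows "(\<integral>\<^sup>+n. ennreal ((cmod (fcoeff f n))\<^sup>2) \<partial>count_space UNIV) = l2sq circ f"
proof -
  have "bij_betw (uminus :: int \<Rightarrow> int) UNIV UNIV" by (simp add: bij_uminus)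
  from nn_integral_bij_count_space[OF this, symmetric, of "\<lambda>n. ennreal ((cmod (fcoeff f n))\<^sup>2)"]
  have flip: "(\<integral>\<^sup>+n. ennreal ((cmod (fcoeff f n))\<^sup>2) \<partial>count_space UNIV) =
    (\<integral>\<^sup>+n. ennreal ((cmod (fcoeff f (- n)))\<^sup>2) \<partial>count_space UNIV)" .
  show ?thesis
    unfolding flip
  proof (rule antisym)
    show "(\<integral>\<^sup>+n. ennreal ((cmod (fcoeff f (- n)))\<^sup>2) \<partial>count_space UNIV) \<le> l2sq circ f"
    proof (rule nn_integral_count_space_le)
      fix F :: "int set" assume F: "finite F"
      have "ennreal (\<Sum>n\<in>F. (cmod (fcoeff f (- n)))\<^sup>2) \<le> l2sq circ f"
      proof -
        have "l2sq circ f = ennreal (\<Sum>n\<in>F. (cmod (fcoeff f (- n)))\<^sup>2) +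
            l2sq circ (\<lambda>x. f x - (\<Sum>n\<in>F. fcoeff f (- n) * ec (of_int n * x)))"
          using l2sq_circ_diff_trig[OF f fin F, of "\<lambda>n. fcoeff f (- n)"] by (simp add: add.commute)
        then show ?thesis unfolding le_iff_add by (rule exI)
      qed
      then show "(\<Sum>n\<in>F. ennreal ((cmod (fcoeff f (- n)))\<^sup>2)) \<le> l2sq circ f"
        by (simp add: sum_ennreal)
    qed (rule infinite_UNIV_int)
  next
    show "l2sq circ f \<le> (\<integral>\<^sup>+n. ennreal ((cmod (fcoeff f (- n)))\<^sup>2) \<partial>count_space UNIV)"
    proof (rule ennreal_le_epsilon)
      fix e :: real assume "0 < e"
      with trig_approx_l2[OF f fin] obtain S p where S: "finite S"
        and le: "l2sq circ (\<lambda>x. f x - (\<Sum>n\<in>S. p n * ec (of_int n * x))) < ennreal e"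
        unfolding trig_approx_def by (auto dest!: spec[of _ "ennreal e"])
      \<comment> \<open>The nonnegative sum over \<open>c n - p n\<close> is dropped from the
        expansion, leaving only the approximation error to pay for.\<close>
      have "l2sq circ f \<le> l2sq circ (\<lambda>x. f x - (\<Sum>n\<in>S. p n * ec (of_int n * x))) + ennreal (\<Sum>n\<in>S. (cmod (fcoeff f (- n)))\<^sup>2)"
        unfolding l2sq_circ_diff_trig[OF f fin S] by (rule add_increasing2) simp_all
      also have "\<dots> \<le> ennreal e + (\<integral>\<^sup>+n. ennreal ((cmod (fcoeff f (- n)))\<^sup>2) \<partial>count_space UNIV)"
        using sum_le_nn_integral_count_space[OF S, of "\<lambda>n. ennreal ((cmod (fcoeff f (- n)))\<^sup>2)"] le
        by (intro add_mono) (simp_all add: sum_ennreal)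
      finally show "l2sq circ f \<le> (\<integral>\<^sup>+n. ennreal ((cmod (fcoeff f (- n)))\<^sup>2) \<partial>count_space UNIV) + ennreal e"
        by (simp add: add.commute)
    qed
  qed
qed

section \<open>Periodization and Plancherel's theorem\<close>

interpretation count_int: sigma_finite_measure "count_space (UNIV :: int set)"
  by (rule sigma_finite_measure_count_space)

interpretation circ_int: pair_sigma_finite circ "count_space (UNIV :: int set)" ..

interpretation circ2: pair_sigma_finite circ circ ..

text \<open>The translates of the unit interval partition the line, so their indicators sum to 1 at
  every \<open>y\<close>; Tonelli and a translation fold each piece back.\<close>

lemma nn_integral_lborel_unfold:
  assumes [measurable]: "f \<in> borel_measurable borel"
  shows "(\<integral>\<^sup>+y. f y \<partial>lborel) = (\<integral>\<^sup>+x. \<integral>\<^sup>+j. f (x + of_int j) \<partial>count_space UNIV \<partial>circ)"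
proof -
  have one: "(\<integral>\<^sup>+j. indicator {0..<1} (y - of_int j) \<partial>count_space UNIV) = (1 :: ennreal)" for y :: real
  proof -
    have "indicator {0..<1} (y - of_int j) = (indicator {\<lfloor>y\<rfloor>} j :: ennreal)" for j :: int
    proof -
      have "y - of_int j \<in> {0..<1} \<longleftrightarrow> j = \<lfloor>y\<rfloor>"
        by (simp add: eq_commute[of j] floor_eq_iff) linarith
      then show ?thesis by (simp add: indicator_def)
    qed
    then show ?thesis by simp
  qed
  have "(\<integral>\<^sup>+y. f y \<partial>lborel) = (\<integral>\<^sup>+y. \<integral>\<^sup>+j. f y * indicator {0..<1} (y - of_int j) \<partial>count_space UNIV \<partial>lborel)"
    by (simp add: nn_integral_cmult one)
  also have "\<dots> = (\<integral>\<^sup>+j. \<integral>\<^sup>+y. f y * indicator {0..<1} (y - of_int j) \<partial>lborel \<partial>count_space UNIV)"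
    by (intro nn_integral_count_space_nn_integral) auto
  also have "\<dots> = (\<integral>\<^sup>+j. \<integral>\<^sup>+x. f (x + of_int j) \<partial>circ \<partial>count_space UNIV)"
  proof (intro nn_integral_cong)
    fix j :: int
    have "(\<integral>\<^sup>+y. f y * indicator {0..<1} (y - of_int j) \<partial>lborel) = (\<integral>\<^sup>+x. f (of_int j + x) * indicator {0..<1} x \<partial>lborel)"
      by (subst nn_integral_real_affine[of _ 1 "of_int j"]) auto
    also have "\<dots> = (\<integral>\<^sup>+x. f (x + of_int j) \<partial>circ)"
      unfolding circ_def by (simp add: nn_integral_density mult.commute add.commute)
    finally show "(\<integral>\<^sup>+y. f y * indicator {0..<1} (y - of_int j) \<partial>lborel) = (\<integral>\<^sup>+x. f (x + of_int j) \<partial>circ)" .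
  qed
  also have "\<dots> = (\<integral>\<^sup>+x. \<integral>\<^sup>+j. f (x + of_int j) \<partial>count_space UNIV \<partial>circ)"
    by (intro nn_integral_count_space_nn_integral[symmetric]) auto
  finally show ?thesis .
qed

lemma measurable_unfold [measurable]:
  "(\<lambda>(x, j). x + of_int j) \<in> circ \<Otimes>\<^sub>M count_space (UNIV :: int set) \<rightarrow>\<^sub>M (borel :: real measure)"
  by measurable

text \<open>Upgrades the folding formula to an equality of measures, so that integrability, Bochner
  integrals and Fubini carry over to complex functions through \<open>distr\<close>.\<close>

lemma lborel_eq_distr_unfold:
  "lborel = distr (circ \<Otimes>\<^sub>M count_space (UNIV :: int set)) borel (\<lambda>(x, j). x + of_int j)"
proof (rule measure_eqI)
  fix A assume "A \<in> sets (lborel :: real measure)"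
  then have [measurable]: "A \<in> sets borel" by simp
  have "emeasure (distr (circ \<Otimes>\<^sub>M count_space (UNIV :: int set)) borel (\<lambda>(x, j). x + of_int j)) A
    = (\<integral>\<^sup>+y. indicator A y \<partial>distr (circ \<Otimes>\<^sub>M count_space (UNIV :: int set)) borel (\<lambda>(x, j). x + of_int j))"
    by simp
  also have "\<dots> = (\<integral>\<^sup>+p. indicator A (case p of (x, j) \<Rightarrow> x + of_int j) \<partial>(circ \<Otimes>\<^sub>M count_space (UNIV :: int set)))"
    by (rule nn_integral_distr) measurable
  also have "\<dots> = (\<integral>\<^sup>+x. \<integral>\<^sup>+j. indicator A (x + of_int j) \<partial>count_space UNIV \<partial>circ)"
    by (subst count_int.nn_integral_fst[symmetric]) auto
  also have "\<dots> = emeasure lborel A"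
    by (subst nn_integral_lborel_unfold[symmetric]) auto
  finally show "emeasure lborel A = emeasure (distr (circ \<Otimes>\<^sub>M count_space (UNIV :: int set)) borel (\<lambda>(x, j). x + of_int j)) A" ..
qed simp

lemma integrable_lborel_unfold:
  fixes f :: "real \<Rightarrow> complex"
  assumes "integrable lborel f"
  shows "integrable (circ \<Otimes>\<^sub>M count_space UNIV) (\<lambda>(x, j :: int). f (x + of_int j))"
proof -
  have [measurable]: "f \<in> borel_measurable borel" using assms by auto
  from assms have "integrable (distr (circ \<Otimes>\<^sub>M count_space (UNIV :: int set)) borel (\<lambda>(x, j). x + of_int j)) f"
    by (subst (asm) lborel_eq_distr_unfold)
  then have "integrable (circ \<Otimes>\<^sub>M count_space UNIV) (\<lambda>p. f (case p of (x, j :: int) \<Rightarrow> x + of_int j))"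
    by (subst (asm) integrable_distr_eq) auto
  then show ?thesis by (simp add: case_prod_beta')
qed

lemma integral_lborel_unfold:
  fixes f :: "real \<Rightarrow> complex"
  assumes "integrable lborel f"
  shows "(LINT y|lborel. f y) = (LINT x|circ. LINT j|count_space (UNIV :: int set). f (x + of_int j))"
proof -
  have [measurable]: "f \<in> borel_measurable borel" using assms by auto
  have "(LINT y|lborel. f y) = (LINT p|(circ \<Otimes>\<^sub>M count_space (UNIV :: int set)). f (case p of (x, j) \<Rightarrow> x + of_int j))"
    by (subst lborel_eq_distr_unfold, subst integral_distr) auto
  also have "\<dots> = (LINT x|circ. LINT j|count_space (UNIV :: int set). f (x + of_int j))"
    using circ_int.integral_fst'[OF integrable_lborel_unfold[OF assms]] by (simp add: case_prod_beta')
  finally show ?thesis .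
qed

lemma AE_integrable_unfold:
  fixes f :: "real \<Rightarrow> complex"
  assumes "integrable lborel f"
  shows "AE x in circ. integrable (count_space UNIV) (\<lambda>j :: int. f (x + of_int j))"
  using circ_int.AE_integrable_fst'[OF integrable_lborel_unfold[OF assms]] by simp

lemma measurable_pair_int:
  assumes "\<And>j. (\<lambda>x. f x j) \<in> M \<rightarrow>\<^sub>M N"
  shows "(\<lambda>(x, j). f x j) \<in> M \<Otimes>\<^sub>M count_space (UNIV :: int set) \<rightarrow>\<^sub>M N"
  unfolding case_prod_beta'
  by (rule measurable_compose_countable[where f="\<lambda>j p. f (fst p) j" and g=snd])
     (auto intro: measurable_compose[OF measurable_fst assms])

lemma measurable_lint_int [measurable (raw)]:
  fixes f :: "'a \<Rightarrow> int \<Rightarrow> complex"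
  assumes [measurable]: "\<And>j. (\<lambda>x. f x j) \<in> borel_measurable M"
  shows "(\<lambda>x. LINT j|count_space UNIV. f x j) \<in> borel_measurable M"
  by (rule count_int.borel_measurable_lebesgue_integral) (rule measurable_pair_int, measurable)

text \<open>Moving \<open>y\<close> by an integer leaves \<open>ec (of_int n * y)\<close> unchanged,
  so the transform of \<open>G\<close> at the integers consists of the Fourier coefficients of its
  periodization \<open>U\<close>.\<close>

lemma parseval_unfold:
  fixes G :: "real \<Rightarrow> complex"
  assumes G: "integrable lborel G"
  defines "U \<equiv> \<lambda>x. LINT j|count_space (UNIV :: int set). G (x + of_int j)"
  assumes fin: "l2sq circ U < \<infinity>"
  shows "(\<integral>\<^sup>+n. ennreal ((cmod (LINT y|lborel. G y * ec (of_int n * y)))\<^sup>2) \<partial>count_space UNIV) = l2sq circ U"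
proof -
  have [measurable]: "G \<in> borel_measurable borel" using G by auto
  have [measurable]: "U \<in> borel_measurable borel" unfolding U_def by measurable
  have "(LINT y|lborel. G y * ec (of_int n * y)) = fcoeff U n" for n
  proof -
    have "integrable lborel (\<lambda>y. G y * ec (of_int n * y))"
      by (rule Bochner_Integration.integrable_bound[OF G]) (auto simp: norm_mult)
    then have "(LINT y|lborel. G y * ec (of_int n * y)) =
       (LINT x|circ. LINT j|count_space (UNIV :: int set). G (x + of_int j) * ec (of_int n * (x + of_int j)))"
      by (rule integral_lborel_unfold)
    also have "\<dots> = (LINT x|circ. LINT j|count_space (UNIV :: int set). G (x + of_int j) * ec (of_int n * x))"
      by (simp add: distrib_left ec_add flip: of_int_mult)
    also have "\<dots> = fcoeff U n"
      unfolding fcoeff_def U_def by simp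
    finally show ?thesis .
  qed
  then show ?thesis using parseval_circ[OF _ fin] by simp
qed

section \<open>The Fourier transform on the line\<close>

definition ft :: "(real \<Rightarrow> complex) \<Rightarrow> real \<Rightarrow> complex" where
  "ft f y = (LINT x|lborel. f x * ec (y * x))"

lemma measurable_ft [measurable]:
  assumes [measurable]: "f \<in> borel_measurable borel"
  shows "ft f \<in> borel_measurable borel"
  unfolding ft_def by (rule lborel.borel_measurable_lebesgue_integral) measurable

text \<open>Parseval read from coefficients to function. Absolute summability makes the series
  bounded and justifies the Fubini step that recovers the coefficients.\<close>

lemma l2sq_circ_int_series:
  fixes c :: "int \<Rightarrow> complex"
  assumes c: "integrable (count_space UNIV) c"
  defines "\<phi> \<equiv> \<lambda>x. LINT j|count_space UNIV. c j * ec (x * of_int j)"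
  shows "l2sq circ \<phi> = (\<integral>\<^sup>+j. ennreal ((cmod (c j))\<^sup>2) \<partial>count_space UNIV)"
proof -
  have [measurable]: "\<phi> \<in> borel_measurable borel" unfolding \<phi>_def by measurable
  define K where "K = (LINT j|count_space UNIV. cmod (c j))"
  have "cmod (\<phi> x) \<le> K" for x
    unfolding \<phi>_def K_def using c
    by (intro order_trans[OF integral_norm_bound]) (simp add: norm_mult)
  then have "l2sq circ \<phi> \<le> (\<integral>\<^sup>+x. ennreal (K\<^sup>2) \<partial>circ)"
    unfolding l2sq_def by (intro nn_integral_mono ennreal_leI power_mono) auto
  then have fin: "l2sq circ \<phi> < \<infinity>" by (auto simp: le_less_trans)
  have int: "integrable (circ \<Otimes>\<^sub>M count_space UNIV) (\<lambda>(x, j). c j * ec (x * of_int j) * ec (of_int n * x))" for n :: int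
  proof (rule circ_int.Fubini_integrable)
    show "(\<lambda>(x, j). c j * ec (x * of_int j) * ec (of_int n * x)) \<in> borel_measurable (circ \<Otimes>\<^sub>M count_space UNIV)"
      by (intro measurable_pair_int) measurable
    show "AE x in circ. integrable (count_space UNIV) (\<lambda>j. case (x, j) of (x, j) \<Rightarrow> c j * ec (x * of_int j) * ec (of_int n * x))"
      by (intro AE_I2) (auto intro!: Bochner_Integration.integrable_bound[OF c] simp: norm_mult)
  qed (simp add: norm_mult)
  have "fcoeff \<phi> n = c (- n)" for n
  proof -
    have "fcoeff \<phi> n = (LINT x|circ. LINT j|count_space UNIV. c j * ec (x * of_int j) * ec (of_int n * x))"
      unfolding fcoeff_def \<phi>_def by simp
    also have "\<dots> = (LINT j|count_space UNIV. LINT x|circ. c j * ec (x * of_int j) * ec (of_int n * x))"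
      using circ_int.Fubini_integral[OF int[of n]] by simp
    also have "\<dots> = (LINT j|count_space UNIV. c j * indicator {- n} j)"
    proof (intro Bochner_Integration.integral_cong refl)
      fix j
      have "(LINT x|circ. c j * ec (x * of_int j) * ec (of_int n * x)) = c j * (LINT x|circ. ec (of_int (j + n) * x))"
        by (simp add: distrib_right ec_add mult.assoc mult.commute[of _ "of_int j"])
      then show "(LINT x|circ. c j * ec (x * of_int j) * ec (of_int n * x)) = c j * indicator {- n} j"
        unfolding integral_ec_int by (auto simp: indicator_def)
    qed
    also have "\<dots> = (LINT j|count_space UNIV. indicator {- n} j *\<^sub>R c (- n))"
      by (intro Bochner_Integration.integral_cong) (auto simp: indicator_def)
    also have "\<dots> = c (- n)" by simp
    finally show ?thesis .
  qed
  then have "l2sq circ \<phi> = (\<integral>\<^sup>+n. ennreal ((cmod (c (- n)))\<^sup>2) \<partial>count_space UNIV)"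
    using parseval_circ[OF _ fin] by simp
  also have "\<dots> = (\<integral>\<^sup>+j. ennreal ((cmod (c j))\<^sup>2) \<partial>count_space UNIV)"
    using nn_integral_bij_count_space[of "uminus :: int \<Rightarrow> int" UNIV UNIV "\<lambda>j. ennreal ((cmod (c j))\<^sup>2)"]
    by (simp add: bij_uminus)
  finally show ?thesis .
qed

text \<open>The function \<open>Z\<close> is the Zak transform of \<open>f\<close>. In \<open>t\<close> its Fourier coefficients are the values
  \<open>ft f (x + n)\<close>, in \<open>x\<close> it is (up to a phase) the Fourier series of \<open>f (t + j)\<close>; Parseval's identity
  is applied in both variables.\<close>

theorem plancherel:
  assumes f: "integrable lborel f" and fin: "l2sq lborel f < \<infinity>"
  shows "l2sq lborel (ft f) = l2sq lborel f"
proof -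
  have [measurable]: "f \<in> borel_measurable borel" using f by auto
  define Z where "Z x t = (LINT j|count_space (UNIV :: int set). f (t + of_int j) * ec (x * (t + of_int j)))" for x t
  have Zm[measurable]: "(\<lambda>(x, t). Z x t) \<in> borel_measurable (circ \<Otimes>\<^sub>M circ)"
    unfolding Z_def case_prod_beta' by (rule measurable_lint_int) measurable
  have Z_sec: "(\<integral>\<^sup>+x. ennreal ((cmod (Z x t))\<^sup>2) \<partial>circ) = (\<integral>\<^sup>+j. ennreal ((cmod (f (t + of_int j)))\<^sup>2) \<partial>count_space (UNIV :: int set))"
    if "integrable (count_space UNIV) (\<lambda>j :: int. f (t + of_int j))" for t
  proof -
    \<comment> \<open>The phase does not affect absolute values, and without it \<open>Z\<close> is
      a genuine Fourier series in \<open>x\<close>.\<close>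
    have "Z x t = ec (x * t) * (LINT j|count_space (UNIV :: int set). f (t + of_int j) * ec (x * of_int j))" for x
      unfolding Z_def by (subst integral_mult_right_zero[symmetric]) (simp add: distrib_left ec_add mult_ac)
    then have "(\<integral>\<^sup>+x. ennreal ((cmod (Z x t))\<^sup>2) \<partial>circ) = l2sq circ (\<lambda>x. LINT j|count_space (UNIV :: int set). f (t + of_int j) * ec (x * of_int j))"
      by (simp add: l2sq_def norm_mult)
    also have "\<dots> = (\<integral>\<^sup>+j. ennreal ((cmod (f (t + of_int j)))\<^sup>2) \<partial>count_space (UNIV :: int set))"
      by (rule l2sq_circ_int_series[OF that])
    finally show ?thesis .
  qed
  have "(\<integral>\<^sup>+t. \<integral>\<^sup>+x. ennreal ((cmod (Z x t))\<^sup>2) \<partial>circ \<partial>circ) = (\<integral>\<^sup>+t. \<integral>\<^sup>+j. ennreal ((cmod (f (t + of_int j)))\<^sup>2) \<partial>count_space (UNIV :: int set) \<partial>circ)"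
    using AE_integrable_unfold[OF f] by (intro nn_integral_cong_AE) (auto simp: Z_sec)
  also have "\<dots> = l2sq lborel f"
    unfolding l2sq_def by (subst nn_integral_lborel_unfold) auto
  finally have tot: "(\<integral>\<^sup>+x. l2sq circ (Z x) \<partial>circ) = l2sq lborel f"
    unfolding l2sq_def using circ2.Fubini[of "\<lambda>(x, t). ennreal ((cmod (Z x t))\<^sup>2)"] by (simp add: case_prod_beta')
  have [measurable]: "(\<lambda>x. l2sq circ (Z x)) \<in> borel_measurable circ"
    unfolding l2sq_def by (rule circ.borel_measurable_nn_integral) (simp add: case_prod_beta')
  \<comment> \<open>The double integral is finite, so almost every section \<open>Z x\<close> is
    square integrable, as \<open>parseval_unfold\<close> requires in the other variable.\<close>
  have "AE x in circ. l2sq circ (Z x) \<noteq> \<infinity>"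
    using fin tot by (intro nn_integral_PInf_AE) auto
  then have "AE x in circ. l2sq circ (Z x) = (\<integral>\<^sup>+n. ennreal ((cmod (ft f (x + of_int n)))\<^sup>2) \<partial>count_space (UNIV :: int set))"
  proof eventually_elim
    case (elim x)
    have i: "integrable lborel (\<lambda>y. f y * ec (x * y))"
      by (rule Bochner_Integration.integrable_bound[OF f]) (auto simp: norm_mult)
    have "ft f (x + of_int n) = (LINT y|lborel. f y * ec (x * y) * ec (of_int n * y))" for n :: int
      unfolding ft_def by (simp add: distrib_right ec_add mult.assoc)
    then show ?case
      using parseval_unfold[OF i] elim by (simp add: Z_def[abs_def] less_top)
  qed
  then have "(\<integral>\<^sup>+x. l2sq circ (Z x) \<partial>circ) = (\<integral>\<^sup>+x. \<integral>\<^sup>+n. ennreal ((cmod (ft f (x + of_int n)))\<^sup>2) \<partial>count_space (UNIV :: int set) \<partial>circ)"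
    by (rule nn_integral_cong_AE)
  also have "\<dots> = l2sq lborel (ft f)"
    unfolding l2sq_def by (subst nn_integral_lborel_unfold) auto
  finally show ?thesis using tot by simp
qed

section \<open>Windows with exponential decay\<close>

text \<open>Cauchy-Schwarz for 1 and \<open>x\<close> in the measure with density
  \<open>K i\<close>, whose mass is at most \<open>R\<close>; exchanging the sums then brings in the
  column bound \<open>C\<close>.\<close>

lemma schur_test:
  fixes K :: "int \<Rightarrow> int \<Rightarrow> ennreal" and x :: "int \<Rightarrow> ennreal"
  assumes row: "\<And>i. (\<integral>\<^sup>+j. K i j \<partial>count_space UNIV) \<le> R"
    and col: "\<And>j. (\<integral>\<^sup>+i. K i j \<partial>count_space UNIV) \<le> C"
  shows "(\<integral>\<^sup>+i. (\<integral>\<^sup>+j. K i j * x j \<partial>count_space UNIV)\<^sup>2 \<partial>count_space UNIV) \<le> R * C * (\<integral>\<^sup>+j. (x j)\<^sup>2 \<partial>count_space UNIV)"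
proof -
  have "(\<integral>\<^sup>+j. K i j * x j \<partial>count_space UNIV)\<^sup>2 \<le> R * (\<integral>\<^sup>+j. K i j * (x j)\<^sup>2 \<partial>count_space UNIV)" for i
  proof -
    let ?M = "density (count_space UNIV) (K i)"
    have "(\<integral>\<^sup>+j. 1 * x j \<partial>?M)\<^sup>2 \<le> (\<integral>\<^sup>+j. 1\<^sup>2 \<partial>?M) * (\<integral>\<^sup>+j. (x j)\<^sup>2 \<partial>?M)"
      by (rule Cauchy_Schwarz_nn_integral) auto
    also have "\<dots> \<le> R * (\<integral>\<^sup>+j. (x j)\<^sup>2 \<partial>?M)"
      using row[of i] by (intro mult_right_mono) (simp_all add: emeasure_density)
    finally show ?thesis by (simp add: nn_integral_density)
  qed
  then have "(\<integral>\<^sup>+i. (\<integral>\<^sup>+j. K i j * x j \<partial>count_space UNIV)\<^sup>2 \<partial>count_space UNIV)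
    \<le> (\<integral>\<^sup>+i. R * (\<integral>\<^sup>+j. K i j * (x j)\<^sup>2 \<partial>count_space UNIV) \<partial>count_space UNIV)"
    by (intro nn_integral_mono)
  also have "\<dots> = R * (\<integral>\<^sup>+j. \<integral>\<^sup>+i. K i j * (x j)\<^sup>2 \<partial>count_space UNIV \<partial>count_space UNIV)"
    by (subst nn_integral_count_space_nn_integral[symmetric]) (auto simp: nn_integral_cmult)
  also have "\<dots> = R * (\<integral>\<^sup>+j. (\<integral>\<^sup>+i. K i j \<partial>count_space UNIV) * (x j)\<^sup>2 \<partial>count_space UNIV)"
    by (simp add: nn_integral_multc)
  also have "\<dots> \<le> R * (\<integral>\<^sup>+j. C * (x j)\<^sup>2 \<partial>count_space UNIV)"
    by (intro mult_left_mono nn_integral_mono mult_right_mono col) auto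
  also have "\<dots> = R * C * (\<integral>\<^sup>+j. (x j)\<^sup>2 \<partial>count_space UNIV)"
    by (simp add: nn_integral_cmult mult.assoc)
  finally show ?thesis .
qed

lemma nn_integral_count_space_inj_le:
  fixes f :: "'b \<Rightarrow> ennreal" and h :: "'a \<Rightarrow> 'b"
  assumes "inj h"
  shows "(\<integral>\<^sup>+j. f (h j) \<partial>count_space UNIV) \<le> (\<integral>\<^sup>+m. f m \<partial>count_space UNIV)"
proof -
  have "(\<integral>\<^sup>+j. f (h j) \<partial>count_space UNIV) = (\<integral>\<^sup>+m. f m \<partial>count_space (range h))"
    using assms by (intro nn_integral_bij_count_space) (auto simp: bij_betw_def)
  also have "\<dots> = (\<integral>\<^sup>+m. f m * indicator (range h) m \<partial>count_space UNIV)"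
    by (simp add: nn_integral_count_space_indicator)
  also have "\<dots> \<le> (\<integral>\<^sup>+m. f m \<partial>count_space UNIV)"
    by (intro nn_integral_mono) (auto simp: indicator_def)
  finally show ?thesis .
qed

text \<open>A Bochner integral that does not exist has value 0, which satisfies the bound.
  \<open>T_upper\<close> can therefore be stated for arbitrary \<open>x\<close>.\<close>

lemma norm_lint_le_nn_integral:
  fixes f :: "'a \<Rightarrow> complex"
  shows "ennreal (cmod (LINT x|M. f x)) \<le> (\<integral>\<^sup>+x. ennreal (cmod (f x)) \<partial>M)"
  by (cases "integrable M f") (auto simp: integral_norm_bound_ennreal not_integrable_integral_eq)

lemma nn_integral_of_bool_le_1:
  assumes "\<And>x y. P x \<Longrightarrow> P y \<Longrightarrow> x = y"
  shows "(\<integral>\<^sup>+x. of_bool (P x) \<partial>count_space UNIV) \<le> (1 :: ennreal)"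
proof (cases "\<exists>x. P x")
  case True
  then obtain x where "P x" by blast
  with assms have "P = (\<lambda>y. y \<in> {x})" by auto
  then have "(\<lambda>y. of_bool (P y) :: ennreal) = indicator {x}" by (auto simp: indicator_def)
  then show ?thesis by simp
qed auto

section \<open>One-sided exponentials summed over lattices\<close>

definition expdec :: "real \<Rightarrow> real \<Rightarrow> real" where
  "expdec c s = (if s > 0 then exp (- c * s) else 0)"

lemma expdec_nonneg [simp]: "expdec c s \<ge> 0"
  by (simp add: expdec_def)

lemma expdec_le_1: "c > 0 \<Longrightarrow> expdec c s \<le> 1"
  by (simp add: expdec_def)

lemma measurable_expdec [measurable]: "expdec c \<in> borel_measurable borel"
  unfolding expdec_def by measurable

text \<open>Uniform in \<open>y\<close>: the first positive point of the shifted lattice contributes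
  at most 1 and each further point gains a factor \<open>exp (- c)\<close>.\<close>

lemma nn_integral_expdec_shift_le:
  assumes c: "c > 0"
  shows "(\<integral>\<^sup>+j. ennreal (expdec c (y + of_int j)) \<partial>count_space (UNIV :: int set)) \<le> ennreal (1 / (1 - exp (- c)))"
proof -
  define j0 where "j0 = \<lfloor>- y\<rfloor> + 1"
  have j0: "y + of_int j > 0 \<longleftrightarrow> j \<in> {j0..}" for j
  proof -
    have "j \<in> {j0..} \<longleftrightarrow> \<lfloor>- y\<rfloor> < j" by (auto simp: j0_def)
    also have "\<dots> \<longleftrightarrow> - y < of_int j" by (simp add: floor_less_iff)
    finally show ?thesis by auto
  qed
  have bij: "bij_betw (\<lambda>n. j0 + int n) UNIV {j0..}"
    by (rule bij_betwI[where g="\<lambda>j. nat (j - j0)"]) auto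
  have "(\<integral>\<^sup>+j. ennreal (expdec c (y + of_int j)) \<partial>count_space (UNIV :: int set)) =
     (\<integral>\<^sup>+j. ennreal (exp (- c * (y + of_int j))) * indicator {j0..} j \<partial>count_space UNIV)"
    unfolding expdec_def j0 by (intro nn_integral_cong) (simp add: indicator_def)
  also have "\<dots> = (\<integral>\<^sup>+j. ennreal (exp (- c * (y + of_int j))) \<partial>count_space {j0..})"
    by (simp add: nn_integral_count_space_indicator)
  also have "\<dots> = (\<integral>\<^sup>+n. ennreal (exp (- c * (y + of_int (j0 + int n)))) \<partial>count_space UNIV)"
    by (rule nn_integral_bij_count_space[OF bij, symmetric])
  also have "\<dots> \<le> (\<integral>\<^sup>+n. ennreal (exp (- c) ^ n) \<partial>count_space UNIV)"
  proof (intro nn_integral_mono ennreal_leI)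
    fix n :: nat
    have "y + of_int j0 > 0" using j0[of j0] by simp
    then have "c * real n \<le> c * (y + of_int (j0 + int n))"
      using c by (intro mult_left_mono) auto
    then show "exp (- c * (y + of_int (j0 + int n))) \<le> exp (- c) ^ n"
      by (simp add: exp_of_nat_mult[symmetric] mult.commute)
  qed
  also have "\<dots> = ennreal (1 / (1 - exp (- c)))"
    unfolding nn_integral_count_space_nat
  proof (rule suminf_ennreal_eq)
    show "(\<lambda>n. exp (- c) ^ n) sums (1 / (1 - exp (- c)))"
      using c by (intro geometric_sums) simp
  qed simp
  finally show ?thesis .
qed

lemma nn_integral_expdec_scaled_le:
  assumes "c > 0" "\<beta> > 0"
  shows "(\<integral>\<^sup>+m. ennreal (expdec c (s - \<beta> * of_int m)) \<partial>count_space (UNIV :: int set)) \<le> ennreal (1 / (1 - exp (- (c * \<beta>))))"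
proof -
  have *: "expdec c (s - \<beta> * of_int m) = expdec (c * \<beta>) (s / \<beta> + of_int (- m))" for m
  proof -
    have "s - \<beta> * of_int m = \<beta> * (s / \<beta> + of_int (- m))" using assms by (simp add: field_simps)
    then show ?thesis unfolding expdec_def using assms by (simp add: zero_less_mult_iff mult.assoc)
  qed
  have "(\<integral>\<^sup>+m. ennreal (expdec c (s - \<beta> * of_int m)) \<partial>count_space (UNIV :: int set))
     = (\<integral>\<^sup>+m. ennreal (expdec (c * \<beta>) (s / \<beta> + of_int m)) \<partial>count_space (UNIV :: int set))"
    unfolding * using nn_integral_bij_count_space[of "uminus :: int \<Rightarrow> int" UNIV UNIV "\<lambda>m. ennreal (expdec (c * \<beta>) (s / \<beta> + of_int m))"]
    by (simp add: bij_uminus)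
  also have "\<dots> \<le> ennreal (1 / (1 - exp (- (c * \<beta>))))"
    using assms by (intro nn_integral_expdec_shift_le) simp
  finally show ?thesis .
qed

text \<open>The parameter \<open>e k\<close> stands for \<open>a k * exp (c * b k)\<close>. The
  argument is run for dilated data as well: replacing \<open>c\<close> and \<open>b\<close> by
  \<open>c / \<alpha>\<close> and \<open>\<alpha> * b\<close> keeps every product
  \<open>c * b k\<close>, hence \<open>e\<close>, and so the bound on the tail.\<close>

locale exp_window =
  fixes c :: real and e :: "nat \<Rightarrow> complex" and b :: "nat \<Rightarrow> real"
  assumes c: "c > 0" and e0: "e 0 = 1" and b0: "b 0 = 0" and b_pos: "k \<ge> 1 \<Longrightarrow> b k > 0"
    and summable_tail: "summable (\<lambda>k. cmod (e (Suc k)))" and tail_less: "(\<Sum>k. cmod (e (Suc k))) < 1"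
begin

definition \<sigma> :: real where "\<sigma> = (\<Sum>k. cmod (e (Suc k)))"

definition H :: "real \<Rightarrow> complex" where "H s = (\<Sum>k. e k * of_bool (b k < s))"

definition \<gamma> :: "real \<Rightarrow> complex" where "\<gamma> s = exp (- c * s) * H s"

definition C :: real where "C = (\<Sum>k. cmod (e k))"

lemma summable_e: "summable (\<lambda>k. cmod (e k))"
  using summable_tail by (subst (asm) summable_Suc_iff)

lemma C_pos: "C > 0"
  unfolding C_def using summable_e e0 by (intro suminf_pos2[of _ 0]) auto

lemma summable_e_bool: "summable (\<lambda>k. cmod (e k * of_bool (Q k)))"
  by (rule summable_comparison_test[OF _ summable_e]) (auto simp: norm_mult)

lemma norm_H_le: "cmod (H s) \<le> C"
proof -
  have "cmod (H s) \<le> (\<Sum>k. cmod (e k * of_bool (b k < s)))"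
    unfolding H_def by (rule summable_norm[OF summable_e_bool])
  also have "\<dots> \<le> C"
    unfolding C_def by (intro suminf_le summable_e_bool summable_e) (auto simp: norm_mult)
  finally show ?thesis .
qed

lemma b_nonneg: "b k \<ge> 0"
  using b0 b_pos[of k] by (cases "k = 0") auto

lemma H_nonpos: "s \<le> 0 \<Longrightarrow> H s = 0"
proof -
  assume "s \<le> 0"
  then have "\<not> b k < s" for k using b_nonneg[of k] by linarith
  then show ?thesis by (simp add: H_def)
qed

lemma norm_\<gamma>_le: "cmod (\<gamma> s) \<le> C * expdec c s"
  using norm_H_le[of s] H_nonpos[of s] by (auto simp: \<gamma>_def expdec_def norm_mult mult.commute)

lemma measurable_\<gamma> [measurable]: "\<gamma> \<in> borel_measurable borel"
proof -
  have "H \<in> borel_measurable borel"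
  proof (rule borel_measurable_LIMSEQ_metric)
    show "(\<lambda>n. \<Sum>k<n. e k * of_bool (b k < s)) \<longlonglongrightarrow> H s" for s
      unfolding H_def by (intro summable_LIMSEQ summable_norm_cancel[OF summable_e_bool])
  qed measurable
  then show ?thesis unfolding \<gamma>_def[abs_def] by measurable
qed

definition T :: "real \<Rightarrow> (int \<Rightarrow> complex) \<Rightarrow> real \<Rightarrow> int \<Rightarrow> complex" where
  "T \<beta> x \<xi> m = (LINT j|count_space UNIV. x j * cnj (\<gamma> (\<xi> + of_int j - \<beta> * of_int m)))"

definition upper_const :: "real \<Rightarrow> real" where
  "upper_const \<beta> = C\<^sup>2 / ((1 - exp (- c)) * (1 - exp (- (c * \<beta>))))"

lemma upper_const_pos: "\<beta> > 0 \<Longrightarrow> upper_const \<beta> > 0"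
  unfolding upper_const_def using c C_pos by auto

text \<open>Schur test for the kernel \<open>C * expdec c\<close>. The two factors in
  \<open>upper_const\<close> are the sum over \<open>j\<close>, with spacing 1, and the sum over
  \<open>m\<close>, with spacing \<beta>.\<close>

lemma T_upper:
  assumes \<beta>: "\<beta> > 0"
  shows "(\<integral>\<^sup>+m. ennreal ((cmod (T \<beta> x \<xi> m))\<^sup>2) \<partial>count_space UNIV) \<le> upper_const \<beta> * (\<integral>\<^sup>+j. ennreal ((cmod (x j))\<^sup>2) \<partial>count_space UNIV)"
proof -
  define K where "K m j = ennreal (C * expdec c (\<xi> + of_int j - \<beta> * of_int m))" for m j :: int
  let ?R = "ennreal C * ennreal (1 / (1 - exp (- c)))" and ?C = "ennreal C * ennreal (1 / (1 - exp (- (c * \<beta>))))"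
  have "(\<integral>\<^sup>+m. ennreal ((cmod (T \<beta> x \<xi> m))\<^sup>2) \<partial>count_space UNIV) \<le>
     (\<integral>\<^sup>+m. (\<integral>\<^sup>+j. K m j * ennreal (cmod (x j)) \<partial>count_space UNIV)\<^sup>2 \<partial>count_space UNIV)"
  proof (intro nn_integral_mono)
    fix m
    have "ennreal (cmod (T \<beta> x \<xi> m)) \<le> (\<integral>\<^sup>+j. ennreal (cmod (x j * cnj (\<gamma> (\<xi> + of_int j - \<beta> * of_int m)))) \<partial>count_space UNIV)"
      unfolding T_def by (rule norm_lint_le_nn_integral)
    also have "\<dots> \<le> (\<integral>\<^sup>+j. K m j * ennreal (cmod (x j)) \<partial>count_space UNIV)"
    proof (intro nn_integral_mono)
      fix j
      have "cmod (x j * cnj (\<gamma> (\<xi> + of_int j - \<beta> * of_int m))) \<le> C * expdec c (\<xi> + of_int j - \<beta> * of_int m) * cmod (x j)"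
        unfolding norm_mult complex_mod_cnj by (subst mult.commute) (intro mult_right_mono norm_\<gamma>_le norm_ge_zero)
      then show "ennreal (cmod (x j * cnj (\<gamma> (\<xi> + of_int j - \<beta> * of_int m)))) \<le> K m j * ennreal (cmod (x j))"
        unfolding K_def using C_pos by (simp add: ennreal_leI flip: ennreal_mult)
    qed
    finally have "(ennreal (cmod (T \<beta> x \<xi> m)))\<^sup>2 \<le> (\<integral>\<^sup>+j. K m j * ennreal (cmod (x j)) \<partial>count_space UNIV)\<^sup>2"
      by (rule power_mono) simp
    then show "ennreal ((cmod (T \<beta> x \<xi> m))\<^sup>2) \<le> (\<integral>\<^sup>+j. K m j * ennreal (cmod (x j)) \<partial>count_space UNIV)\<^sup>2"
      by (simp add: ennreal_power)
  qed
  also have "\<dots> \<le> ?R * ?C * (\<integral>\<^sup>+j. (ennreal (cmod (x j)))\<^sup>2 \<partial>count_space UNIV)"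
  proof (rule schur_test)
    fix m
    have "(\<integral>\<^sup>+j. K m j \<partial>count_space UNIV) = ennreal C * (\<integral>\<^sup>+j. ennreal (expdec c ((\<xi> - \<beta> * of_int m) + of_int j)) \<partial>count_space UNIV)"
      unfolding K_def using C_pos by (simp add: ennreal_mult nn_integral_cmult algebra_simps)
    also have "\<dots> \<le> ?R" by (intro mult_left_mono nn_integral_expdec_shift_le c) simp
    finally show "(\<integral>\<^sup>+j. K m j \<partial>count_space UNIV) \<le> ?R" .
  next
    fix j
    have "(\<integral>\<^sup>+m. K m j \<partial>count_space UNIV) = ennreal C * (\<integral>\<^sup>+m. ennreal (expdec c ((\<xi> + of_int j) - \<beta> * of_int m)) \<partial>count_space UNIV)"
      unfolding K_def using C_pos by (simp add: ennreal_mult nn_integral_cmult)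
    also have "\<dots> \<le> ?C" by (intro mult_left_mono nn_integral_expdec_scaled_le c \<beta>) simp
    finally show "(\<integral>\<^sup>+m. K m j \<partial>count_space UNIV) \<le> ?C" .
  qed
  also have "?R * ?C = ennreal (upper_const \<beta>)"
    unfolding upper_const_def using c \<beta> C_pos
    by (simp add: power2_eq_square flip: ennreal_mult)
  finally show ?thesis by (simp add: ennreal_power)
qed

text \<open>The window samples are square summable: \<open>expdec c\<close> is at most 1, so it
  dominates its own square and the plain lattice sum suffices.\<close>

lemma integrable_T:
  assumes x: "(\<integral>\<^sup>+j. ennreal ((cmod (x j))\<^sup>2) \<partial>count_space UNIV) < \<infinity>"
  shows "integrable (count_space UNIV) (\<lambda>j :: int. x j * cnj (\<gamma> (y + of_int j)))"
proof (rule integrable_l2_mult)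
  show "l2sq (count_space UNIV) x < \<infinity>" using x by (simp add: l2sq_def)
  have "l2sq (count_space UNIV) (\<lambda>j :: int. cnj (\<gamma> (y + of_int j))) \<le> (\<integral>\<^sup>+j. ennreal (C\<^sup>2) * ennreal (expdec c (y + of_int j)) \<partial>count_space (UNIV :: int set))"
    unfolding l2sq_def
  proof (intro nn_integral_mono)
    fix j :: int
    let ?s = "y + of_int j"
    have "(cmod (\<gamma> ?s))\<^sup>2 \<le> (C * expdec c ?s)\<^sup>2" by (intro power_mono norm_\<gamma>_le) auto
    also have "\<dots> \<le> C\<^sup>2 * expdec c ?s"
      unfolding power_mult_distrib using expdec_le_1[OF c, of ?s]
      by (intro mult_left_mono) (auto simp: power2_eq_square mult_left_le)
    finally show "ennreal ((cmod (cnj (\<gamma> ?s)))\<^sup>2) \<le> ennreal (C\<^sup>2) * ennreal (expdec c ?s)"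
      by (simp add: ennreal_leI flip: ennreal_mult)
  qed
  also have "\<dots> \<le> ennreal (C\<^sup>2) * ennreal (1 / (1 - exp (- c)))"
    by (subst nn_integral_cmult) (auto intro!: mult_left_mono nn_integral_expdec_shift_le c)
  also have "\<dots> < \<infinity>" by (simp add: ennreal_mult_less_top)
  finally show "l2sq (count_space UNIV) (\<lambda>j :: int. cnj (\<gamma> (y + of_int j))) < \<infinity>" .
qed auto

end

section \<open>The lower bound when \<beta> is at most 1\<close>

lemma nn_integral_cmult_of_bool_le:
  fixes a :: ennreal
  assumes "\<And>x y. P x \<Longrightarrow> P y \<Longrightarrow> x = y"
  shows "(\<integral>\<^sup>+x. a * of_bool (P x) \<partial>count_space UNIV) \<le> a"
proof -
  have "(\<integral>\<^sup>+x. a * of_bool (P x) \<partial>count_space UNIV) = a * (\<integral>\<^sup>+x. of_bool (P x) \<partial>count_space UNIV)"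
    by (rule nn_integral_cmult) simp
  also have "\<dots> \<le> a * 1"
    by (intro mult_left_mono nn_integral_of_bool_le_1 assms) simp_all
  finally show ?thesis by simp
qed

text \<open>The unweighted inequality would charge \<open>2 * \<sigma>^2\<close> for the
  perturbation, which can exceed 1. With \<open>\<sigma> \<le> t < 1\<close> the charge is
  \<open>\<sigma>^2 / t \<le> t\<close> and can be absorbed.\<close>

lemma power2_sum_weighted_le:
  fixes u v t :: real
  assumes "0 < t" "t < 1"
  shows "(u + v)\<^sup>2 \<le> u\<^sup>2 / (1 - t) + v\<^sup>2 / t"
proof -
  have "0 \<le> (t * u - (1 - t) * v)\<^sup>2 / (t * (1 - t))" using assms by simp
  also have "\<dots> = u\<^sup>2 / (1 - t) + v\<^sup>2 / t - (u + v)\<^sup>2"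
    using assms by (simp add: field_simps power2_eq_square)
  finally show ?thesis by simp
qed

context exp_window
begin

lemma \<sigma>_nonneg: "\<sigma> \<ge> 0"
  unfolding \<sigma>_def by (intro suminf_nonneg summable_tail) auto

lemma \<sigma>_less: "\<sigma> < 1"
  using tail_less by (simp add: \<sigma>_def)

text \<open>The numerator is \<open>(1 - t)^2\<close> for the weight
  \<open>t = (1 + \<sigma>) / 2\<close>; the denominator bounds the squared norm of the passage from
  the values of \<open>T\<close> to their weighted differences.\<close>

definition lower_const :: "real \<Rightarrow> real" where
  "lower_const \<beta> = ((1 - \<sigma>) / 2)\<^sup>2 / (4 * exp (2 * c * \<beta>))"

lemma lower_const_pos: "lower_const \<beta> > 0"
  unfolding lower_const_def using \<sigma>_less by simp

text \<open>Moving by \<beta> and multiplying by \<open>exp (- c * \<beta>)\<close> restores the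
  same factor \<open>exp (- c * s)\<close>, so the subtraction merely switches off each term beyond
  \<open>b k + \<beta>\<close>.\<close>

lemma \<gamma>_difference:
  "\<gamma> s - exp (- c * \<beta>) * \<gamma> (s - \<beta>) = exp (- c * s) * (\<Sum>k. e k * of_bool (b k < s) - e k * of_bool (b k + \<beta> < s))"
proof -
  have "H (s - \<beta>) = (\<Sum>k. e k * of_bool (b k + \<beta> < s))"
    unfolding H_def by (simp add: less_diff_eq)
  then have "(\<Sum>k. e k * of_bool (b k < s) - e k * of_bool (b k + \<beta> < s)) = H s - H (s - \<beta>)"
    unfolding H_def
    by (simp only:) (intro suminf_diff[symmetric] summable_norm_cancel[OF summable_e_bool])
  moreover have "exp (- c * \<beta>) * exp (- c * (s - \<beta>)) = exp (- c * s)"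
    by (simp add: exp_add[symmetric] algebra_simps)
  ultimately show ?thesis
    unfolding \<gamma>_def by (simp add: right_diff_distrib flip: mult.assoc of_real_mult)
qed

text \<open>A ceiling minus one rather than a floor: the cells are open on the left and closed on
  the right, matching the strict inequality \<open>b k < s\<close> in \<open>H\<close>.\<close>

definition level :: "real \<Rightarrow> real \<Rightarrow> int \<Rightarrow> int" where
  "level \<beta> \<xi> j = \<lceil>(\<xi> + of_int j) / \<beta>\<rceil> - 1"

lemma level_iff:
  assumes "\<beta> > 0"
  shows "0 < \<xi> + of_int j - \<beta> * of_int m \<and> \<xi> + of_int j - \<beta> * of_int m \<le> \<beta> \<longleftrightarrow> m = level \<beta> \<xi> j"
proof -
  have "m = level \<beta> \<xi> j \<longleftrightarrow> \<lceil>(\<xi> + of_int j) / \<beta>\<rceil> = m + 1" by (auto simp: level_def)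
  also have "\<dots> \<longleftrightarrow> of_int (m + 1) - 1 < (\<xi> + of_int j) / \<beta> \<and> (\<xi> + of_int j) / \<beta> \<le> of_int (m + 1)"
    by (rule ceiling_eq_iff)
  also have "\<dots> \<longleftrightarrow> 0 < \<xi> + of_int j - \<beta> * of_int m \<and> \<xi> + of_int j - \<beta> * of_int m \<le> \<beta>"
    using assms by (simp add: field_simps)
  finally show ?thesis ..
qed

text \<open>Two points in one half-open cell differ by less than its length \<beta> \<le> 1, which
  is impossible for distinct points of a coset of the integers.\<close>

lemma inj_level:
  assumes "0 < \<beta>" "\<beta> \<le> 1"
  shows "inj (level \<beta> \<xi>)"
proof (rule injI)
  fix i j assume eq: "level \<beta> \<xi> i = level \<beta> \<xi> j"
  have "\<bar>of_int i - of_int j :: real\<bar> < 1"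
    using level_iff[OF assms(1), of \<xi> i "level \<beta> \<xi> i"] level_iff[OF assms(1), of \<xi> j "level \<beta> \<xi> i"] eq assms by auto
  then show "i = j" by linarith
qed

text \<open>The matrix of the map from \<open>x\<close> to the weighted differences of \<open>T\<close>, with one row for each \<open>j\<close>.\<close>

definition kern :: "real \<Rightarrow> real \<Rightarrow> int \<Rightarrow> int \<Rightarrow> complex" where
  "kern \<beta> \<xi> j j' = exp (c * (\<xi> + of_int j - \<beta> * of_int (level \<beta> \<xi> j))) *
     (\<gamma> (\<xi> + of_int j' - \<beta> * of_int (level \<beta> \<xi> j)) - exp (- c * \<beta>) * \<gamma> (\<xi> + of_int j' - \<beta> * of_int (level \<beta> \<xi> j) - \<beta>))"

text \<open>The position pattern of the \<open>k\<close>-th interval in the matrix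
  \<open>kern\<close>. For \<beta> \<le> 1 it is the diagonal when \<open>k = 0\<close>, and the
  graph of a partial injection for every \<open>k\<close>.\<close>

definition hit :: "real \<Rightarrow> real \<Rightarrow> nat \<Rightarrow> int \<Rightarrow> int \<Rightarrow> bool" where
  "hit \<beta> \<xi> k j j' \<longleftrightarrow> b k < \<xi> + of_int j' - \<beta> * of_int (level \<beta> \<xi> j) \<and> \<xi> + of_int j' - \<beta> * of_int (level \<beta> \<xi> j) \<le> b k + \<beta>"

text \<open>After the exponentials cancel, an entry is \<open>exp (c * (j - j'))\<close> times the
  sum of \<open>e k\<close> over the hits, and \<open>k = 0\<close> produces the identity. The
  exponential is at most 1 for \<open>j' \<ge> j\<close>, and for \<open>j' < j\<close> there are no
  hits, so it never amplifies the remaining terms.\<close>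

lemma norm_kern_minus_id_le:
  assumes \<beta>: "0 < \<beta>" "\<beta> \<le> 1"
  shows "cmod (kern \<beta> \<xi> j j' - of_bool (j = j')) \<le> (\<Sum>k. cmod (e (Suc k)) * of_bool (hit \<beta> \<xi> (Suc k) j j'))"
proof -
  let ?s = "\<xi> + of_int j' - \<beta> * of_int (level \<beta> \<xi> j)"
  let ?h = "\<lambda>k. hit \<beta> \<xi> k j j'"
  have summ: "summable (\<lambda>k. cmod (e (Suc k)) * of_bool (?h (Suc k)))"
    by (rule summable_comparison_test[OF _ summable_tail]) (auto simp: norm_mult)
  moreover have norm_h: "cmod (e k * of_bool (?h k)) = cmod (e k) * of_bool (?h k)" for k
    by (simp add: norm_mult)
  ultimately have summ': "summable (\<lambda>k. cmod (e (Suc k) * of_bool (?h (Suc k))))"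
    by simp
  then have summ0: "summable (\<lambda>k. e k * of_bool (?h k))"
    by (subst summable_Suc_iff[symmetric]) (rule summable_norm_cancel)
  have "e k * of_bool (b k < ?s) - e k * of_bool (b k + \<beta> < ?s) = e k * of_bool (?h k)" for k
    using \<beta> by (auto simp: hit_def)
  then have "kern \<beta> \<xi> j j' = exp (c * (\<xi> + of_int j - \<beta> * of_int (level \<beta> \<xi> j))) * (exp (- c * ?s) * (\<Sum>k. e k * of_bool (?h k)))"
    unfolding kern_def \<gamma>_difference by simp
  also have "\<dots> = complex_of_real (exp (c * (\<xi> + of_int j - \<beta> * of_int (level \<beta> \<xi> j))) * exp (- c * ?s)) * (\<Sum>k. e k * of_bool (?h k))"
    by (simp add: mult.assoc)
  also have "exp (c * (\<xi> + of_int j - \<beta> * of_int (level \<beta> \<xi> j))) * exp (- c * ?s) = exp (c * (of_int j - of_int j'))"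
    by (simp add: exp_add[symmetric] algebra_simps)
  finally have "kern \<beta> \<xi> j j' = exp (c * (of_int j - of_int j')) * (\<Sum>k. e k * of_bool (?h k))" .
  moreover have "(\<Sum>k. e k * of_bool (?h k)) = of_bool (j = j') + (\<Sum>k. e (Suc k) * of_bool (?h (Suc k)))"
  proof -
    have "?h 0 \<longleftrightarrow> level \<beta> \<xi> j = level \<beta> \<xi> j'"
      unfolding hit_def b0 using level_iff[OF \<beta>(1), of \<xi> j' "level \<beta> \<xi> j"] by simp
    also have "\<dots> \<longleftrightarrow> j = j'" using inj_level[OF \<beta>] by (auto simp: inj_def)
    finally show ?thesis
      using suminf_split_head[OF summ0] e0 by simp
  qed
  ultimately have eq: "kern \<beta> \<xi> j j' - of_bool (j = j') = exp (c * (of_int j - of_int j')) * (\<Sum>k. e (Suc k) * of_bool (?h (Suc k)))"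
    by (simp add: distrib_left)
  show ?thesis
  proof (cases "j' \<ge> j")
    case True
    then have le1: "exp (c * (of_int j - of_int j')) \<le> 1" using c by (simp add: mult_nonneg_nonpos)
    have "cmod (kern \<beta> \<xi> j j' - of_bool (j = j')) \<le> 1 * cmod (\<Sum>k. e (Suc k) * of_bool (?h (Suc k)))"
      unfolding eq norm_mult using le1 by (intro mult_right_mono) auto
    also have "\<dots> \<le> (\<Sum>k. cmod (e (Suc k) * of_bool (?h (Suc k))))"
      using summable_norm[OF summ'] by simp
    finally show ?thesis by (simp only: norm_h)
  next
    case False
    \<comment> \<open>The point of \<open>j\<close> lies at most \<beta> above its level, so one
      integer step down puts the argument at or below \<open>\<beta> - 1 \<le> 0\<close>, where
      every term of the window is off.\<close>
    then have "of_int j' \<le> (of_int j :: real) - 1" by linarith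
    moreover have "\<xi> + of_int j - \<beta> * of_int (level \<beta> \<xi> j) \<le> \<beta>"
      using level_iff[OF \<beta>(1), of \<xi> j "level \<beta> \<xi> j"] by simp
    ultimately have "?s \<le> 0" using \<beta> by linarith
    then have "\<not> ?h k" for k unfolding hit_def using b_nonneg[of k] by linarith
    then show ?thesis by (simp add: eq)
  qed
qed

text \<open>Together with \<open>hit_left_unique\<close>: each row and each column of the
  \<open>k\<close>-th pattern has at most one entry, so the Schur test bounds the
  \<open>k\<close>-th matrix by \<open>cmod (e k)\<close>.\<close>

lemma hit_right_unique:
  assumes \<beta>: "0 < \<beta>" "\<beta> \<le> 1" and "hit \<beta> \<xi> k j i" "hit \<beta> \<xi> k j i'"
  shows "i = i'"
proof -
  have "\<bar>of_int i - of_int i' :: real\<bar> < 1" using assms unfolding hit_def by linarith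
  then show ?thesis by linarith
qed

text \<open>Two hits in one column force levels at distance below \<beta> after scaling, hence equal
  levels, and a level determines its \<open>j\<close>.\<close>

lemma hit_left_unique:
  assumes \<beta>: "0 < \<beta>" "\<beta> \<le> 1" and "hit \<beta> \<xi> k i j" "hit \<beta> \<xi> k i' j"
  shows "i = i'"
proof -
  have "\<bar>\<beta> * of_int (level \<beta> \<xi> i) - \<beta> * of_int (level \<beta> \<xi> i')\<bar> < \<beta>"
    using assms unfolding hit_def by linarith
  then have "\<bar>\<beta> * of_int (level \<beta> \<xi> i - level \<beta> \<xi> i')\<bar> < \<beta> * 1" by (simp add: right_diff_distrib)
  then have "\<bar>of_int (level \<beta> \<xi> i - level \<beta> \<xi> i') :: real\<bar> < 1" unfolding abs_mult using \<beta> by simp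
  then have "level \<beta> \<xi> i = level \<beta> \<xi> i'" by linarith
  then show ?thesis using inj_level[OF \<beta>] by (auto simp: inj_def)
qed

lemma T_lower:
  assumes \<beta>: "0 < \<beta>" "\<beta> \<le> 1" and x: "(\<integral>\<^sup>+j. ennreal ((cmod (x j))\<^sup>2) \<partial>count_space UNIV) < \<infinity>"
  shows "lower_const \<beta> * (\<integral>\<^sup>+j. ennreal ((cmod (x j))\<^sup>2) \<partial>count_space UNIV) \<le> (\<integral>\<^sup>+m. ennreal ((cmod (T \<beta> x \<xi> m))\<^sup>2) \<partial>count_space UNIV)"
proof -
  \<comment> \<open>The exponential factor makes the \<open>k = 0\<close> part of
    \<open>kern\<close> equal to the identity. Its argument stems from a point in
    \<open>(0, \<beta>]\<close>, so it is at most \<open>exp (c * \<beta>)\<close>.\<close>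
  define D where "D j = exp (c * (\<xi> + of_int j - \<beta> * of_int (level \<beta> \<xi> j))) *
    (T \<beta> x \<xi> (level \<beta> \<xi> j) - exp (- c * \<beta>) * T \<beta> x \<xi> (level \<beta> \<xi> j + 1))" for j
  define K where "K j j' = (\<integral>\<^sup>+k. ennreal (cmod (e (Suc k))) * of_bool (hit \<beta> \<xi> (Suc k) j j') \<partial>count_space UNIV)" for j j'
  let ?S = "\<integral>\<^sup>+j. ennreal ((cmod (x j))\<^sup>2) \<partial>count_space UNIV"
  let ?W = "\<integral>\<^sup>+m. ennreal ((cmod (T \<beta> x \<xi> m))\<^sup>2) \<partial>count_space UNIV"
  have int: "integrable (count_space UNIV) (\<lambda>j'. x j' * cnj (kern \<beta> \<xi> j j'))" for j
  proof -
    have "integrable (count_space UNIV) (\<lambda>j'. exp (c * (\<xi> + of_int j - \<beta> * of_int (level \<beta> \<xi> j))) *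
       (x j' * cnj (\<gamma> ((\<xi> - \<beta> * of_int (level \<beta> \<xi> j)) + of_int j')) -
        exp (- c * \<beta>) * (x j' * cnj (\<gamma> ((\<xi> - \<beta> * of_int (level \<beta> \<xi> j) - \<beta>) + of_int j')))))"
      by (intro integrable_mult_right Bochner_Integration.integrable_diff integrable_T x)
    then show ?thesis
      by (rule back_subst[where P="integrable _"]) (auto simp: kern_def algebra_simps fun_eq_iff)
  qed
  have D_eq: "D j = (LINT j'|count_space UNIV. x j' * cnj (kern \<beta> \<xi> j j'))" for j
  proof -
    let ?m = "level \<beta> \<xi> j"
    have i: "integrable (count_space UNIV) (\<lambda>j'. x j' * cnj (\<gamma> (\<xi> + of_int j' - \<beta> * of_int m)))" for m
      using integrable_T[OF x, of "\<xi> - \<beta> * of_int m"] by (simp add: algebra_simps)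
    have "D j = exp (c * (\<xi> + of_int j - \<beta> * of_int ?m)) * ((LINT j'|count_space UNIV. x j' * cnj (\<gamma> (\<xi> + of_int j' - \<beta> * of_int ?m)))
       - (LINT j'|count_space UNIV. exp (- c * \<beta>) * (x j' * cnj (\<gamma> (\<xi> + of_int j' - \<beta> * of_int (?m + 1))))))"
      unfolding D_def T_def by simp
    also have "\<dots> = (LINT j'|count_space UNIV. exp (c * (\<xi> + of_int j - \<beta> * of_int ?m)) * (x j' * cnj (\<gamma> (\<xi> + of_int j' - \<beta> * of_int ?m))
        - exp (- c * \<beta>) * (x j' * cnj (\<gamma> (\<xi> + of_int j' - \<beta> * of_int (?m + 1))))))"
      by (subst Bochner_Integration.integral_diff[symmetric])
         (simp_all only: integral_mult_right_zero i integrable_mult_right)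
    also have "\<dots> = (LINT j'|count_space UNIV. x j' * cnj (kern \<beta> \<xi> j j'))"
      by (intro Bochner_Integration.integral_cong) (auto simp: kern_def algebra_simps)
    finally show ?thesis .
  qed
  define R where "R j = D j - x j" for j
  have K_eq: "ennreal (\<Sum>k. cmod (e (Suc k)) * of_bool (hit \<beta> \<xi> (Suc k) j j')) = K j j'" for j j'
  proof -
    have "K j j' = (\<Sum>k. ennreal (cmod (e (Suc k)) * of_bool (hit \<beta> \<xi> (Suc k) j j')))"
      unfolding K_def nn_integral_count_space_nat by (intro suminf_cong) auto
    also have "\<dots> = ennreal (\<Sum>k. cmod (e (Suc k)) * of_bool (hit \<beta> \<xi> (Suc k) j j'))"
      by (intro suminf_ennreal2 summable_comparison_test[OF _ summable_tail]) (auto simp: norm_mult)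
    finally show ?thesis ..
  qed
  have R_bound: "ennreal (cmod (R j)) \<le> (\<integral>\<^sup>+j'. K j j' * ennreal (cmod (x j')) \<partial>count_space UNIV)" for j
  proof -
    \<comment> \<open>The single value \<open>x j\<close> is written as an integral over
      \<open>count_space\<close> in order to subtract it from \<open>D j\<close> under one integral
      sign.\<close>
    have sing: "(\<lambda>j'. x j' * of_bool (j = j')) = (\<lambda>j'. indicator {j} j' *\<^sub>R x j)"
      by (auto simp: indicator_def)
    have ib: "integrable (count_space UNIV) (\<lambda>j'. x j' * of_bool (j = j'))"
      unfolding sing by simp
    have "x j = (LINT j'|count_space UNIV. x j' * of_bool (j = j'))" unfolding sing by simp
    then have "R j = (LINT j'|count_space UNIV. x j' * cnj (kern \<beta> \<xi> j j') - x j' * of_bool (j = j'))"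
      unfolding R_def D_eq using Bochner_Integration.integral_diff[OF int[of j] ib] by simp
    also have "\<dots> = (LINT j'|count_space UNIV. x j' * cnj (kern \<beta> \<xi> j j' - of_bool (j = j')))"
      by (intro Bochner_Integration.integral_cong) (auto simp: algebra_simps)
    finally have "ennreal (cmod (R j)) \<le> (\<integral>\<^sup>+j'. ennreal (cmod (x j' * cnj (kern \<beta> \<xi> j j' - of_bool (j = j')))) \<partial>count_space UNIV)"
      by (simp only: norm_lint_le_nn_integral)
    also have "\<dots> \<le> (\<integral>\<^sup>+j'. K j j' * ennreal (cmod (x j')) \<partial>count_space UNIV)"
    proof (intro nn_integral_mono)
      fix j'
      have "ennreal (cmod (x j' * cnj (kern \<beta> \<xi> j j' - of_bool (j = j')))) = ennreal (cmod (kern \<beta> \<xi> j j' - of_bool (j = j'))) * ennreal (cmod (x j'))"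
        unfolding norm_mult complex_mod_cnj by (simp add: ennreal_mult mult.commute)
      also have "\<dots> \<le> K j j' * ennreal (cmod (x j'))"
        unfolding K_eq[symmetric] by (intro mult_right_mono ennreal_leI norm_kern_minus_id_le \<beta>) simp
      finally show "ennreal (cmod (x j' * cnj (kern \<beta> \<xi> j j' - of_bool (j = j')))) \<le> K j j' * ennreal (cmod (x j'))" .
    qed
    finally show ?thesis .
  qed
  have tail: "(\<integral>\<^sup>+k. ennreal (cmod (e (Suc k))) \<partial>count_space UNIV) = ennreal \<sigma>"
    unfolding nn_integral_count_space_nat \<sigma>_def by (intro suminf_ennreal2 summable_tail) auto
  have R_sum: "(\<integral>\<^sup>+j. ennreal ((cmod (R j))\<^sup>2) \<partial>count_space UNIV) \<le> ennreal \<sigma> * ennreal \<sigma> * ?S"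
  proof -
    have "(\<integral>\<^sup>+j. ennreal ((cmod (R j))\<^sup>2) \<partial>count_space UNIV) \<le> (\<integral>\<^sup>+j. (\<integral>\<^sup>+j'. K j j' * ennreal (cmod (x j')) \<partial>count_space UNIV)\<^sup>2 \<partial>count_space UNIV)"
      by (intro nn_integral_mono) (simp add: ennreal_power[symmetric] power_mono R_bound)
    also have "\<dots> \<le> ennreal \<sigma> * ennreal \<sigma> * (\<integral>\<^sup>+j. (ennreal (cmod (x j)))\<^sup>2 \<partial>count_space UNIV)"
    proof (rule schur_test)
      have "(\<integral>\<^sup>+j'. K j j' \<partial>count_space UNIV) = (\<integral>\<^sup>+k. \<integral>\<^sup>+j'. ennreal (cmod (e (Suc k))) * of_bool (hit \<beta> \<xi> (Suc k) j j') \<partial>count_space UNIV \<partial>count_space UNIV)" for j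
        unfolding K_def by (intro nn_integral_count_space_nn_integral) auto
      also have "\<dots> j \<le> (\<integral>\<^sup>+k. ennreal (cmod (e (Suc k))) \<partial>count_space UNIV)" for j
        by (intro nn_integral_mono nn_integral_cmult_of_bool_le hit_right_unique[OF \<beta>])
      finally show "(\<integral>\<^sup>+j'. K j j' \<partial>count_space UNIV) \<le> ennreal \<sigma>" for j by (simp add: tail)
      have "(\<integral>\<^sup>+j. K j j' \<partial>count_space UNIV) = (\<integral>\<^sup>+k. \<integral>\<^sup>+j. ennreal (cmod (e (Suc k))) * of_bool (hit \<beta> \<xi> (Suc k) j j') \<partial>count_space UNIV \<partial>count_space UNIV)" for j'
        unfolding K_def by (intro nn_integral_count_space_nn_integral) auto
      also have "\<dots> j' \<le> (\<integral>\<^sup>+k. ennreal (cmod (e (Suc k))) \<partial>count_space UNIV)" for j'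
        by (intro nn_integral_mono nn_integral_cmult_of_bool_le hit_left_unique[OF \<beta>])
      finally show "(\<integral>\<^sup>+j. K j j' \<partial>count_space UNIV) \<le> ennreal \<sigma>" for j' by (simp add: tail)
    qed
    finally show ?thesis by (simp add: ennreal_power)
  qed
  have D_sum: "(\<integral>\<^sup>+j. ennreal ((cmod (D j))\<^sup>2) \<partial>count_space UNIV) \<le> ennreal (4 * exp (2 * c * \<beta>)) * ?W"
  proof -
    have "(\<integral>\<^sup>+j. ennreal ((cmod (D j))\<^sup>2) \<partial>count_space UNIV) \<le> (\<integral>\<^sup>+j. ennreal (2 * exp (2 * c * \<beta>)) *
       (ennreal ((cmod (T \<beta> x \<xi> (level \<beta> \<xi> j)))\<^sup>2) + ennreal ((cmod (T \<beta> x \<xi> (level \<beta> \<xi> j + 1)))\<^sup>2)) \<partial>count_space UNIV)"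
    proof (intro nn_integral_mono)
      fix j
      let ?u = "T \<beta> x \<xi> (level \<beta> \<xi> j)" and ?v = "T \<beta> x \<xi> (level \<beta> \<xi> j + 1)"
      have "exp (c * (\<xi> + of_int j - \<beta> * of_int (level \<beta> \<xi> j))) \<le> exp (c * \<beta>)"
        using level_iff[OF \<beta>(1), of \<xi> j "level \<beta> \<xi> j"] c by simp
      then have "(exp (c * (\<xi> + of_int j - \<beta> * of_int (level \<beta> \<xi> j))))\<^sup>2 \<le> (exp (c * \<beta>))\<^sup>2"
        by (intro power_mono) auto
      also have "(exp (c * \<beta>))\<^sup>2 = exp (2 * c * \<beta>)" by (simp add: exp_double[symmetric] mult_ac)
      finally have 1: "(exp (c * (\<xi> + of_int j - \<beta> * of_int (level \<beta> \<xi> j))))\<^sup>2 \<le> exp (2 * c * \<beta>)" .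
      have "cmod (exp (- c * \<beta>) * ?v) \<le> cmod ?v"
        using c \<beta> by (simp add: norm_mult mult_left_le_one_le)
      then have "(cmod (exp (- c * \<beta>) * ?v))\<^sup>2 \<le> (cmod ?v)\<^sup>2" by (rule power_mono) simp
      then have 2: "(cmod (?u - exp (- c * \<beta>) * ?v))\<^sup>2 \<le> 2 * (cmod ?u)\<^sup>2 + 2 * (cmod ?v)\<^sup>2"
        using cmod_add_power2_le[of ?u "- (exp (- c * \<beta>) * ?v)"]
        unfolding norm_minus_cancel add_uminus_conv_diff by linarith
      have "(cmod (D j))\<^sup>2 = (exp (c * (\<xi> + of_int j - \<beta> * of_int (level \<beta> \<xi> j))))\<^sup>2 * (cmod (?u - exp (- c * \<beta>) * ?v))\<^sup>2"
        unfolding D_def norm_mult power_mult_distrib by simp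
      also have "\<dots> \<le> exp (2 * c * \<beta>) * (2 * (cmod ?u)\<^sup>2 + 2 * (cmod ?v)\<^sup>2)"
        by (intro mult_mono 1 2) auto
      also have "\<dots> = 2 * exp (2 * c * \<beta>) * ((cmod ?u)\<^sup>2 + (cmod ?v)\<^sup>2)" by (simp add: algebra_simps)
      finally have "ennreal ((cmod (D j))\<^sup>2) \<le> ennreal (2 * exp (2 * c * \<beta>) * ((cmod ?u)\<^sup>2 + (cmod ?v)\<^sup>2))"
        by (rule ennreal_leI)
      then show "ennreal ((cmod (D j))\<^sup>2) \<le> ennreal (2 * exp (2 * c * \<beta>)) * (ennreal ((cmod ?u)\<^sup>2) + ennreal ((cmod ?v)\<^sup>2))"
        by (subst (asm) ennreal_mult) (auto simp: ennreal_plus)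
    qed
    also have "\<dots> = ennreal (2 * exp (2 * c * \<beta>)) * ((\<integral>\<^sup>+j. ennreal ((cmod (T \<beta> x \<xi> (level \<beta> \<xi> j)))\<^sup>2) \<partial>count_space UNIV) +
       (\<integral>\<^sup>+j. ennreal ((cmod (T \<beta> x \<xi> (level \<beta> \<xi> j + 1)))\<^sup>2) \<partial>count_space UNIV))"
      by (simp add: nn_integral_cmult nn_integral_add)
    also have "\<dots> \<le> ennreal (2 * exp (2 * c * \<beta>)) * (?W + ?W)"
    proof (intro mult_left_mono add_mono)
      show "(\<integral>\<^sup>+j. ennreal ((cmod (T \<beta> x \<xi> (level \<beta> \<xi> j)))\<^sup>2) \<partial>count_space UNIV) \<le> ?W"
        by (rule nn_integral_count_space_inj_le[OF inj_level[OF \<beta>]])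
      have "inj (\<lambda>j. level \<beta> \<xi> j + 1)" using inj_level[OF \<beta>] by (auto simp: inj_def)
      then show "(\<integral>\<^sup>+j. ennreal ((cmod (T \<beta> x \<xi> (level \<beta> \<xi> j + 1)))\<^sup>2) \<partial>count_space UNIV) \<le> ?W"
        by (rule nn_integral_count_space_inj_le)
    qed simp
    also have "\<dots> = ennreal (4 * exp (2 * c * \<beta>)) * ?W"
    proof -
      have "ennreal (4 * exp (2 * c * \<beta>)) = ennreal (2 * exp (2 * c * \<beta>)) + ennreal (2 * exp (2 * c * \<beta>))"
        by (simp flip: ennreal_plus)
      then show ?thesis by (simp only: distrib_left distrib_right)
    qed
    finally show ?thesis .
  qed
  \<comment> \<open>The midpoint of \<sigma> and 1 is positive even for \<sigma> = 0, lies below 1,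
    and is at least \<sigma>.\<close>
  define t where "t = (1 + \<sigma>) / 2"
  have t: "0 < t" "t < 1" "\<sigma> \<le> t" "1 - t = (1 - \<sigma>) / 2" using \<sigma>_nonneg \<sigma>_less by (auto simp: t_def field_simps)
  have main: "?S \<le> ennreal (1 / (1 - t)) * (ennreal (4 * exp (2 * c * \<beta>)) * ?W) + ennreal (1 / t) * (ennreal \<sigma> * ennreal \<sigma> * ?S)"
  proof -
    have "?S \<le> (\<integral>\<^sup>+j. ennreal (1 / (1 - t)) * ennreal ((cmod (D j))\<^sup>2) + ennreal (1 / t) * ennreal ((cmod (R j))\<^sup>2) \<partial>count_space UNIV)"
    proof (intro nn_integral_mono)
      fix j
      have "cmod (x j) \<le> cmod (D j) + cmod (R j)"
        using norm_triangle_ineq4[of "D j" "R j"] by (simp add: R_def)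
      then have "(cmod (x j))\<^sup>2 \<le> (cmod (D j) + cmod (R j))\<^sup>2" by (intro power_mono) auto
      also have "\<dots> \<le> 1 / (1 - t) * (cmod (D j))\<^sup>2 + 1 / t * (cmod (R j))\<^sup>2"
        using power2_sum_weighted_le[OF t(1,2)] by simp
      finally have "ennreal ((cmod (x j))\<^sup>2) \<le> ennreal (1 / (1 - t) * (cmod (D j))\<^sup>2 + 1 / t * (cmod (R j))\<^sup>2)"
        by (rule ennreal_leI)
      also have "\<dots> = ennreal (1 / (1 - t)) * ennreal ((cmod (D j))\<^sup>2) + ennreal (1 / t) * ennreal ((cmod (R j))\<^sup>2)"
        using t by (simp add: ennreal_plus ennreal_mult[symmetric])
      finally show "ennreal ((cmod (x j))\<^sup>2) \<le> ennreal (1 / (1 - t)) * ennreal ((cmod (D j))\<^sup>2) + ennreal (1 / t) * ennreal ((cmod (R j))\<^sup>2)" .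
    qed
    also have "\<dots> = ennreal (1 / (1 - t)) * (\<integral>\<^sup>+j. ennreal ((cmod (D j))\<^sup>2) \<partial>count_space UNIV) + ennreal (1 / t) * (\<integral>\<^sup>+j. ennreal ((cmod (R j))\<^sup>2) \<partial>count_space UNIV)"
      by (simp add: nn_integral_cmult nn_integral_add)
    also have "\<dots> \<le> ennreal (1 / (1 - t)) * (ennreal (4 * exp (2 * c * \<beta>)) * ?W) + ennreal (1 / t) * (ennreal \<sigma> * ennreal \<sigma> * ?S)"
      by (intro add_mono mult_left_mono D_sum R_sum) auto
    finally show ?thesis .
  qed
  \<comment> \<open>Finiteness of both sums moves the estimate to the reals, where the term
    \<open>t * S\<close> can be subtracted.\<close>
  have W: "?W < \<infinity>"
    using T_upper[OF \<beta>(1), of x \<xi>] x by (simp add: ennreal_mult_less_top order.strict_trans1)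
  obtain S W' where SW: "?S = ennreal S" "S \<ge> 0" "?W = ennreal W'" "W' \<ge> 0"
    using x W by (cases ?S; cases ?W) auto
  have "ennreal S \<le> ennreal (1 / (1 - t) * (4 * exp (2 * c * \<beta>) * W') + 1 / t * (\<sigma> * \<sigma> * S))"
    using main t(1,2) \<sigma>_nonneg unfolding SW using SW(2,4) by (simp add: ennreal_plus flip: ennreal_mult)
  then have r: "S \<le> 1 / (1 - t) * (4 * exp (2 * c * \<beta>) * W') + 1 / t * (\<sigma> * \<sigma> * S)"
    using t(1,2) SW(2,4) \<sigma>_nonneg by (subst (asm) ennreal_le_iff) auto
  have "1 / t * (\<sigma> * \<sigma> * S) \<le> 1 / t * (t * t * S)"
    using t SW(2) \<sigma>_nonneg by (intro mult_left_mono mult_right_mono mult_mono) auto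
  also have "\<dots> = t * S" using t by simp
  finally have "(1 - t) * S \<le> 1 / (1 - t) * (4 * exp (2 * c * \<beta>) * W')" using r by (simp add: algebra_simps)
  then have "lower_const \<beta> * S \<le> W'"
    unfolding lower_const_def t(4)[symmetric] using t(1,2) by (simp add: field_simps power2_eq_square)
  then show ?thesis
    unfolding SW using lower_const_pos[of \<beta>] SW(2,4) by (simp add: ennreal_leI flip: ennreal_mult)
qed

end

section \<open>Gabor sums on the Fourier side\<close>

text \<open>Gaussian elimination: an equation with nonzero coefficient at \<open>i0\<close> is
  solved for that unknown and substituted into the others, which removes one equation and one
  unknown.\<close>

lemma underdetermined_system:
  fixes a :: "'e \<Rightarrow> 'i \<Rightarrow> 'f::field"
  assumes "finite E" "finite I" "card E < card I"
  shows "\<exists>x. (\<exists>i\<in>I. x i \<noteq> 0) \<and> (\<forall>q\<in>E. (\<Sum>i\<in>I. a q i * x i) = 0)"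
  using assms
proof (induction E arbitrary: I a)
  case empty
  then have "I \<noteq> {}" by auto
  then show ?case by (intro exI[of _ "\<lambda>_. 1"]) auto
next
  case (insert p E)
  show ?case
  proof (cases "\<forall>i\<in>I. a p i = 0")
    case True
    have "card E < card I" using insert.prems insert.hyps by simp
    from insert.IH[OF insert.prems(1) this, of a] show ?thesis using True by auto
  next
    case False
    then obtain i0 where i0: "i0 \<in> I" "a p i0 \<noteq> 0" by blast
    define I' where "I' = I - {i0}"
    have I: "I = insert i0 I'" "finite I'" "i0 \<notin> I'" using i0 insert.prems by (auto simp: I'_def)
    have "card E < card I'" using insert.prems insert.hyps I by simp
    from insert.IH[OF I(2) this, of "\<lambda>q i. a q i - a q i0 * a p i / a p i0"] obtain x where
      x: "\<exists>i\<in>I'. x i \<noteq> 0" "\<And>q. q \<in> E \<Longrightarrow> (\<Sum>i\<in>I'. (a q i - a q i0 * a p i / a p i0) * x i) = 0" by blast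
    define y where "y = x(i0 := - (\<Sum>i\<in>I'. a p i * x i) / a p i0)"
    have sum_y: "(\<Sum>i\<in>I. a q i * y i) = a q i0 * (- (\<Sum>i\<in>I'. a p i * x i) / a p i0) + (\<Sum>i\<in>I'. a q i * x i)" for q
    proof -
      have "(\<Sum>i\<in>I'. a q i * y i) = (\<Sum>i\<in>I'. a q i * x i)"
        using I(3) by (intro sum.cong) (auto simp: y_def)
      then show ?thesis unfolding I(1) using I(2,3) by (simp add: y_def)
    qed
    have "(\<Sum>i\<in>I. a q i * y i) = 0" if "q \<in> E" for q
    proof -
      have "(\<Sum>i\<in>I'. (a q i - a q i0 * a p i / a p i0) * x i) = (\<Sum>i\<in>I'. a q i * x i) - a q i0 / a p i0 * (\<Sum>i\<in>I'. a p i * x i)"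
        by (simp add: left_diff_distrib sum_subtractf sum_distrib_left mult.assoc)
      then show ?thesis unfolding sum_y using x(2)[OF that] by (simp add: field_simps)
    qed
    moreover have "(\<Sum>i\<in>I. a p i * y i) = 0" unfolding sum_y using i0 by simp
    moreover have "\<exists>i\<in>I. y i \<noteq> 0" using x(1) I by (auto simp: y_def)
    ultimately show ?thesis by blast
  qed
qed

lemma norm_sum_mult_power2_le:
  fixes x y :: "'a \<Rightarrow> complex"
  shows "(cmod (\<Sum>i\<in>I. x i * y i))\<^sup>2 \<le> (\<Sum>i\<in>I. (cmod (x i))\<^sup>2) * (\<Sum>i\<in>I. (cmod (y i))\<^sup>2)"
proof -
  have "cmod (\<Sum>i\<in>I. x i * y i) \<le> (\<Sum>i\<in>I. cmod (x i) * cmod (y i))"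
    by (rule order_trans[OF norm_sum]) (simp add: norm_mult)
  then have "(cmod (\<Sum>i\<in>I. x i * y i))\<^sup>2 \<le> (\<Sum>i\<in>I. cmod (x i) * cmod (y i))\<^sup>2"
    by (rule power_mono) simp
  also have "\<dots> \<le> (\<Sum>i\<in>I. (cmod (x i))\<^sup>2) * (\<Sum>i\<in>I. (cmod (y i))\<^sup>2)"
    by (rule Cauchy_Schwarz_ineq_sum)
  finally show ?thesis .
qed

section \<open>Decomposition of the coefficient sums into fibers\<close>

context exp_window
begin

lemma l2sq_\<gamma>_shift: "l2sq lborel (\<lambda>y. \<gamma> (y - s)) < \<infinity>"
proof -
  have "l2sq lborel (\<lambda>y. \<gamma> (y - s)) \<le> (\<integral>\<^sup>+y. ennreal (C\<^sup>2) * ennreal (expdec c (y - s)) \<partial>lborel)"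
    unfolding l2sq_def
  proof (intro nn_integral_mono)
    fix y
    have "(cmod (\<gamma> (y - s)))\<^sup>2 \<le> (C * expdec c (y - s))\<^sup>2" by (intro power_mono norm_\<gamma>_le) auto
    also have "\<dots> \<le> C\<^sup>2 * expdec c (y - s)"
      unfolding power_mult_distrib using expdec_le_1[OF c, of "y - s"]
      by (intro mult_left_mono) (auto simp: power2_eq_square mult_left_le)
    finally show "ennreal ((cmod (\<gamma> (y - s)))\<^sup>2) \<le> ennreal (C\<^sup>2) * ennreal (expdec c (y - s))"
      by (simp add: ennreal_leI flip: ennreal_mult)
  qed
  also have "\<dots> = ennreal (C\<^sup>2) * (\<integral>\<^sup>+x. \<integral>\<^sup>+j. ennreal (expdec c ((x - s) + of_int j)) \<partial>count_space (UNIV :: int set) \<partial>circ)"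
    by (subst nn_integral_cmult, simp, subst nn_integral_lborel_unfold) (auto simp: algebra_simps)
  also have "\<dots> \<le> ennreal (C\<^sup>2) * (\<integral>\<^sup>+x. ennreal (1 / (1 - exp (- c))) \<partial>circ)"
    by (intro mult_left_mono nn_integral_mono nn_integral_expdec_shift_le c) auto
  also have "\<dots> < \<infinity>" by (simp add: ennreal_mult_less_top)
  finally show ?thesis .
qed

text \<open>A Gabor coefficient on the Fourier side after dilation to \<alpha> = 1, up to a phase:
  \<open>m\<close> indexes translates of the window by \<beta>, \<open>n\<close> the characters of
  period 1.\<close>

definition \<Phi> :: "real \<Rightarrow> (real \<Rightarrow> complex) \<Rightarrow> int \<Rightarrow> int \<Rightarrow> complex" where
  "\<Phi> \<beta> F m n = (LINT y|lborel. F y * cnj (\<gamma> (y - \<beta> * of_int m)) * ec (of_int n * y))"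

lemma measurable_T [measurable]:
  assumes [measurable]: "F \<in> borel_measurable borel"
  shows "(\<lambda>x. T \<beta> (\<lambda>j. F (x + of_int j)) x m) \<in> borel_measurable borel"
  unfolding T_def by measurable

text \<open>For each \<open>m\<close> the sum over \<open>n\<close> is a case of
  \<open>parseval_unfold\<close>, since the periodization of \<open>F\<close> times the shifted
  window is \<open>T\<close> on the fibers. Its square integrability comes from
  \<open>T_upper\<close>, which bounds the sum over all \<open>m\<close>.\<close>

lemma fiber_sum:
  assumes [measurable]: "F \<in> borel_measurable borel" and fin: "l2sq lborel F < \<infinity>" and \<beta>: "\<beta> > 0"
  shows "(\<integral>\<^sup>+m. \<integral>\<^sup>+n. ennreal ((cmod (\<Phi> \<beta> F m n))\<^sup>2) \<partial>count_space UNIV \<partial>count_space UNIV) =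
     (\<integral>\<^sup>+x. \<integral>\<^sup>+m. ennreal ((cmod (T \<beta> (\<lambda>j. F (x + of_int j)) x m))\<^sup>2) \<partial>count_space UNIV \<partial>circ)"
proof -
  have "(\<integral>\<^sup>+n. ennreal ((cmod (\<Phi> \<beta> F m n))\<^sup>2) \<partial>count_space UNIV) = (\<integral>\<^sup>+x. ennreal ((cmod (T \<beta> (\<lambda>j. F (x + of_int j)) x m))\<^sup>2) \<partial>circ)" for m
  proof -
    have G: "integrable lborel (\<lambda>y. F y * cnj (\<gamma> (y - \<beta> * of_int m)))"
      by (intro integrable_l2_mult fin) (use l2sq_\<gamma>_shift in \<open>auto simp: l2sq_def\<close>)
    have "(\<integral>\<^sup>+x. ennreal ((cmod (T \<beta> (\<lambda>j. F (x + of_int j)) x m))\<^sup>2) \<partial>circ) \<le>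
       (\<integral>\<^sup>+x. \<integral>\<^sup>+m. ennreal ((cmod (T \<beta> (\<lambda>j. F (x + of_int j)) x m))\<^sup>2) \<partial>count_space UNIV \<partial>circ)"
    proof (intro nn_integral_mono)
      fix x
      show "ennreal ((cmod (T \<beta> (\<lambda>j. F (x + of_int j)) x m))\<^sup>2) \<le> (\<integral>\<^sup>+m. ennreal ((cmod (T \<beta> (\<lambda>j. F (x + of_int j)) x m))\<^sup>2) \<partial>count_space UNIV)"
        using sum_le_nn_integral_count_space[of "{m}" "\<lambda>m. ennreal ((cmod (T \<beta> (\<lambda>j. F (x + of_int j)) x m))\<^sup>2)"] by simp
    qed
    also have "\<dots> \<le> (\<integral>\<^sup>+x. ennreal (upper_const \<beta>) * (\<integral>\<^sup>+j. ennreal ((cmod (F (x + of_int j)))\<^sup>2) \<partial>count_space (UNIV :: int set)) \<partial>circ)"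
      by (intro nn_integral_mono T_upper \<beta>)
    also have "\<dots> = ennreal (upper_const \<beta>) * l2sq lborel F"
      unfolding l2sq_def by (subst nn_integral_lborel_unfold) (auto intro!: nn_integral_cmult)
    also have "\<dots> < \<infinity>" using fin by (simp add: ennreal_mult_less_top)
    finally have "l2sq circ (\<lambda>x. LINT j|count_space (UNIV :: int set). F (x + of_int j) * cnj (\<gamma> (x + of_int j - \<beta> * of_int m))) < \<infinity>"
      unfolding l2sq_def T_def .
    from parseval_unfold[OF G this] show ?thesis
      unfolding l2sq_def T_def \<Phi>_def .
  qed
  then show ?thesis
    by (simp add: nn_integral_count_space_nn_integral[where M=circ, symmetric])
qed

lemma \<Phi>_upper:
  assumes [measurable]: "F \<in> borel_measurable borel" and fin: "l2sq lborel F < \<infinity>" and \<beta>: "\<beta> > 0"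
  shows "(\<integral>\<^sup>+m. \<integral>\<^sup>+n. ennreal ((cmod (\<Phi> \<beta> F m n))\<^sup>2) \<partial>count_space UNIV \<partial>count_space UNIV) \<le> ennreal (upper_const \<beta>) * l2sq lborel F"
proof -
  have "(\<integral>\<^sup>+x. \<integral>\<^sup>+m. ennreal ((cmod (T \<beta> (\<lambda>j. F (x + of_int j)) x m))\<^sup>2) \<partial>count_space UNIV \<partial>circ)
     \<le> (\<integral>\<^sup>+x. ennreal (upper_const \<beta>) * (\<integral>\<^sup>+j. ennreal ((cmod (F (x + of_int j)))\<^sup>2) \<partial>count_space (UNIV :: int set)) \<partial>circ)"
    by (intro nn_integral_mono T_upper \<beta>)
  also have "\<dots> = ennreal (upper_const \<beta>) * l2sq lborel F"
    unfolding l2sq_def by (subst nn_integral_lborel_unfold) (auto intro!: nn_integral_cmult)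
  finally show ?thesis unfolding fiber_sum[OF assms] .
qed

lemma \<Phi>_lower:
  assumes [measurable]: "F \<in> borel_measurable borel" and fin: "l2sq lborel F < \<infinity>" and \<beta>: "0 < \<beta>" "\<beta> \<le> 1"
  shows "ennreal (lower_const \<beta>) * l2sq lborel F \<le> (\<integral>\<^sup>+m. \<integral>\<^sup>+n. ennreal ((cmod (\<Phi> \<beta> F m n))\<^sup>2) \<partial>count_space UNIV \<partial>count_space UNIV)"
proof -
  have eq: "l2sq lborel F = (\<integral>\<^sup>+x. \<integral>\<^sup>+j. ennreal ((cmod (F (x + of_int j)))\<^sup>2) \<partial>count_space (UNIV :: int set) \<partial>circ)"
    unfolding l2sq_def by (subst nn_integral_lborel_unfold) auto
  \<comment> \<open>\<open>T_lower\<close> asks for a square summable fiber, which is what almost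
    every \<open>x\<close> provides.\<close>
  have "AE x in circ. (\<integral>\<^sup>+j. ennreal ((cmod (F (x + of_int j)))\<^sup>2) \<partial>count_space (UNIV :: int set)) \<noteq> \<infinity>"
    using fin unfolding eq by (intro nn_integral_PInf_AE) auto
  then have "(\<integral>\<^sup>+x. ennreal (lower_const \<beta>) * (\<integral>\<^sup>+j. ennreal ((cmod (F (x + of_int j)))\<^sup>2) \<partial>count_space (UNIV :: int set)) \<partial>circ) \<le>
     (\<integral>\<^sup>+x. \<integral>\<^sup>+m. ennreal ((cmod (T \<beta> (\<lambda>j. F (x + of_int j)) x m))\<^sup>2) \<partial>count_space UNIV \<partial>circ)"
    by (intro nn_integral_mono_AE) (auto elim!: eventually_mono intro!: T_lower \<beta> simp: less_top)
  then show ?thesis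
    unfolding fiber_sum[OF assms(1,2) \<beta>(1)] eq by (subst (asm) nn_integral_cmult) auto
qed

section \<open>Failure of the lower bound when \<beta> exceeds 1\<close>

lemma isCont_\<gamma>:
  assumes "s \<notin> range b"
  shows "isCont \<gamma> s"
proof -
  \<comment> \<open>Tannery's theorem with majorant \<open>cmod (e k)\<close>: every single term is
    constant near \<open>s\<close>, because \<open>s\<close> is not its jump
    \<open>b k\<close>.\<close>
  have "((\<lambda>u. \<Sum>k. e k * of_bool (b k < u)) \<longlongrightarrow> (\<Sum>k. e k * of_bool (b k < s))) (at s)"
  proof (rule tannerys_theorem[THEN conjunct2, THEN conjunct2])
    fix k
    have "b k \<noteq> s" using assms by auto
    then have "\<forall>\<^sub>F u in at s. (b k < u) = (b k < s)"
    proof (rule neqE)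
      assume "b k < s"
      then have "\<forall>\<^sub>F u in at s. b k < u" by (intro order_tendstoD(1)[OF tendsto_ident_at])
      then show ?thesis by (rule eventually_mono) (use \<open>b k < s\<close> in simp)
    next
      assume "s < b k"
      then have "\<forall>\<^sub>F u in at s. u < b k" by (intro order_tendstoD(2)[OF tendsto_ident_at])
      then show ?thesis by (rule eventually_mono) (use \<open>s < b k\<close> in simp)
    qed
    then have "\<forall>\<^sub>F u in at s. e k * of_bool (b k < u) = e k * of_bool (b k < s)"
      by eventually_elim simp
    then show "((\<lambda>u. e k * of_bool (b k < u)) \<longlongrightarrow> e k * of_bool (b k < s)) (at s)"
      by (rule tendsto_eventually)
  next
    show "\<forall>\<^sub>F (k, u) in at_top \<times>\<^sub>F at s. cmod (e k * of_bool (b k < u)) \<le> cmod (e k)"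
      by (intro always_eventually) (auto simp: norm_mult)
  qed (auto intro: summable_e)
  then have "isCont H s" unfolding isCont_def H_def .
  then show ?thesis unfolding \<gamma>_def[abs_def] by (intro continuous_intros)
qed

lemma T_finite_support:
  assumes "\<And>j. j \<notin> {0..<N} \<Longrightarrow> x j = 0"
  shows "T \<beta> x \<xi> m = (\<Sum>j\<in>{0..<N}. x j * cnj (\<gamma> (\<xi> + of_int j - \<beta> * of_int m)))"
proof -
  have mt1: "j \<in> {0..<N}" if "x j \<noteq> 0" for j using that assms by blast
  have "T \<beta> x \<xi> m = (\<Sum>j | x j * cnj (\<gamma> (\<xi> + of_int j - \<beta> * of_int m)) \<noteq> 0. x j * cnj (\<gamma> (\<xi> + of_int j - \<beta> * of_int m)))"
    unfolding T_def
    by (subst lebesgue_integral_count_space_finite_support)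
       (auto intro!: finite_subset[of _ "{0..<N}"] dest: mt1)
  also have "\<dots> = (\<Sum>j\<in>{0..<N}. x j * cnj (\<gamma> (\<xi> + of_int j - \<beta> * of_int m)))"
    by (intro sum.mono_neutral_left) (use assms in force)+
  finally show ?thesis .
qed

text \<open>Two geometric series: ratio \<open>exp (- (2 * c))\<close> over the columns
  \<open>j \<ge> 0\<close> and ratio \<open>exp (- (2 * c * \<beta>))\<close> over the rows.\<close>

definition tail_const :: "real \<Rightarrow> real" where
  "tail_const \<beta> = C\<^sup>2 / ((1 - exp (- (2 * c))) * (1 - exp (- (2 * c * \<beta>))))"

text \<open>For \<xi> \<ge> 0 and \<open>j \<ge> 0\<close> an entry is at most
  \<open>C * exp (- c * j) * exp (c * \<beta> * m)\<close>, and Cauchy-Schwarz in \<open>j\<close>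
  leaves a geometric sum bounded independently of \<open>N\<close>. This uniformity allows
  \<open>R\<close> to be fixed before \<open>N\<close>.\<close>

lemma T_tail:
  assumes x: "\<And>j. j \<notin> {0..<N} \<Longrightarrow> x j = 0" and \<beta>: "\<beta> > 0" and \<xi>: "\<xi> \<ge> 0"
  shows "(\<integral>\<^sup>+m. ennreal ((cmod (T \<beta> x \<xi> m))\<^sup>2) * indicator {..<- int R} m \<partial>count_space UNIV)
     \<le> ennreal (tail_const \<beta> * exp (- (2 * c * \<beta> * R)) * (\<Sum>j\<in>{0..<N}. (cmod (x j))\<^sup>2))"
proof -
  let ?X = "\<Sum>j\<in>{0..<N}. (cmod (x j))\<^sup>2"
  let ?k = "C\<^sup>2 / (1 - exp (- (2 * c))) * exp (- (2 * c * \<beta> * R)) * ?X"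
  have X: "?X \<ge> 0" by (intro sum_nonneg) auto
  have q: "1 - exp (- (2 * c)) > 0" "1 - exp (- (2 * c * \<beta>)) > 0" using c \<beta> by auto
  have k: "?k \<ge> 0" using q X by simp
  have geo: "(\<Sum>j\<in>{0..<N}. (exp (- (c * of_int j)))\<^sup>2) \<le> 1 / (1 - exp (- (2 * c)))"
  proof -
    have "(\<Sum>j\<in>{0..<N}. (exp (- (c * of_int j)))\<^sup>2) = (\<Sum>i<nat N. exp (- (2 * c)) ^ i)"
    proof (rule sum.reindex_bij_witness[of _ int nat])
      fix j :: int assume "j \<in> {0..<N}"
      then show "exp (- (2 * c)) ^ nat j = (exp (- (c * of_int j)))\<^sup>2"
        by (simp add: exp_of_nat_mult[symmetric] exp_double[symmetric] mult_ac)
    qed auto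
    also have "\<dots> \<le> (\<Sum>i. exp (- (2 * c)) ^ i)"
      using c by (intro sum_le_suminf summable_geometric) auto
    also have "\<dots> = 1 / (1 - exp (- (2 * c)))" using c by (intro suminf_geometric) auto
    finally show ?thesis .
  qed
  \<comment> \<open>The argument of \<open>expdec\<close> is positive exactly for
    \<open>m < - R\<close>, so the lattice bound for \<open>expdec\<close> also sums these
    rows.\<close>
  have "ennreal ((cmod (T \<beta> x \<xi> m))\<^sup>2) * indicator {..<- int R} m \<le> ennreal ?k * ennreal (expdec (2 * c) (- \<beta> * R - \<beta> * of_int m))" for m
  proof (cases "m < - int R")
    case True
    have "cmod (x j * cnj (\<gamma> (\<xi> + of_int j - \<beta> * of_int m))) \<le> cmod (x j) * exp (- (c * of_int j)) * (C * exp (c * \<beta> * of_int m))" for j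
    proof -
      have "cmod (\<gamma> (\<xi> + of_int j - \<beta> * of_int m)) \<le> C * exp (- c * (\<xi> + of_int j - \<beta> * of_int m))"
        using norm_\<gamma>_le[of "\<xi> + of_int j - \<beta> * of_int m"] C_pos by (auto simp: expdec_def split: if_splits intro: order_trans)
      also have "\<dots> \<le> C * (exp (- (c * of_int j)) * exp (c * \<beta> * of_int m))"
        using C_pos c \<xi> by (intro mult_left_mono) (auto simp: exp_add[symmetric] algebra_simps)
      finally have "cmod (x j) * cmod (\<gamma> (\<xi> + of_int j - \<beta> * of_int m)) \<le> cmod (x j) * (C * (exp (- (c * of_int j)) * exp (c * \<beta> * of_int m)))"
        by (rule mult_left_mono) simp
      then show ?thesis
        unfolding norm_mult complex_mod_cnj by (simp only: mult_ac)
    qed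
    moreover have "T \<beta> x \<xi> m = (\<Sum>j\<in>{0..<N}. x j * cnj (\<gamma> (\<xi> + of_int j - \<beta> * of_int m)))"
      by (rule T_finite_support) (rule x)
    ultimately have "cmod (T \<beta> x \<xi> m) \<le> (\<Sum>j\<in>{0..<N}. cmod (x j) * exp (- (c * of_int j)) * (C * exp (c * \<beta> * of_int m)))"
      by (simp only:) (intro order_trans[OF norm_sum] sum_mono)
    then have "(cmod (T \<beta> x \<xi> m))\<^sup>2 \<le> ((\<Sum>j\<in>{0..<N}. cmod (x j) * exp (- (c * of_int j))) * (C * exp (c * \<beta> * of_int m)))\<^sup>2"
      unfolding sum_distrib_right by (intro power_mono) auto
    also have "\<dots> = (\<Sum>j\<in>{0..<N}. cmod (x j) * exp (- (c * of_int j)))\<^sup>2 * (C\<^sup>2 * exp (2 * c * \<beta> * of_int m))"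
      by (simp add: power_mult_distrib exp_double[symmetric] mult_ac)
    also have "\<dots> \<le> (?X * (1 / (1 - exp (- (2 * c))))) * (C\<^sup>2 * exp (2 * c * \<beta> * of_int m))"
      by (intro mult_right_mono order_trans[OF Cauchy_Schwarz_ineq_sum] mult_left_mono geo X) auto
    also have "\<dots> = ?k * exp (- (2 * c) * (- \<beta> * R - \<beta> * of_int m))"
      by (simp add: exp_add[symmetric] algebra_simps)
    also have "exp (- (2 * c) * (- \<beta> * R - \<beta> * of_int m)) = expdec (2 * c) (- \<beta> * R - \<beta> * of_int m)"
    proof -
      have "\<beta> * (- real R - of_int m) > 0" using True \<beta> by (intro mult_pos_pos) linarith+
      then show ?thesis by (simp add: expdec_def algebra_simps)
    qed
    finally have "ennreal ((cmod (T \<beta> x \<xi> m))\<^sup>2) \<le> ennreal (?k * expdec (2 * c) (- \<beta> * R - \<beta> * of_int m))"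
      by (rule ennreal_leI)
    then have "ennreal ((cmod (T \<beta> x \<xi> m))\<^sup>2) \<le> ennreal ?k * ennreal (expdec (2 * c) (- \<beta> * R - \<beta> * of_int m))"
      by (subst ennreal_mult[symmetric, OF k expdec_nonneg])
    then show ?thesis using True by simp
  qed simp
  then have "(\<integral>\<^sup>+m. ennreal ((cmod (T \<beta> x \<xi> m))\<^sup>2) * indicator {..<- int R} m \<partial>count_space UNIV)
     \<le> (\<integral>\<^sup>+m. ennreal ?k * ennreal (expdec (2 * c) (- \<beta> * R - \<beta> * of_int m)) \<partial>count_space UNIV)"
    by (intro nn_integral_mono)
  also have "\<dots> \<le> ennreal ?k * ennreal (1 / (1 - exp (- (2 * c * \<beta>))))"
    using c \<beta> by (subst nn_integral_cmult) (auto intro!: mult_left_mono nn_integral_expdec_scaled_le)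
  also have "\<dots> = ennreal (tail_const \<beta> * exp (- (2 * c * \<beta> * R)) * ?X)"
    unfolding tail_const_def using k q by (subst ennreal_mult[symmetric]) (auto simp: mult_ac)
  finally show ?thesis .
qed

text \<open>The base point \<open>u\<close> avoids a countable set, so that \<open>\<gamma>\<close> is continuous at every \<open>u + j - \<beta> m\<close>.\<close>

lemma T_near_null_vector:
  assumes \<beta>: "\<beta> > 1" and A: "A > 0"
  obtains N :: int and x :: "int \<Rightarrow> complex" and u \<epsilon> :: real
  where "\<And>j. j \<notin> {0..<N} \<Longrightarrow> x j = 0" "(\<Sum>j\<in>{0..<N}. (cmod (x j))\<^sup>2) > 0"
    "0 < u" "0 < \<epsilon>" "u + \<epsilon> \<le> 1"
    "\<And>\<xi>. \<xi> \<in> {u..<u + \<epsilon>} \<Longrightarrow> (\<integral>\<^sup>+m. ennreal ((cmod (T \<beta> x \<xi> m))\<^sup>2) \<partial>count_space UNIV) \<le> ennreal (A * (\<Sum>j\<in>{0..<N}. (cmod (x j))\<^sup>2))"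
proof -
  have tc: "tail_const \<beta> > 0" unfolding tail_const_def using c \<beta> C_pos by auto
  \<comment> \<open>Half of the allowance \<open>A\<close> goes to the rows below
    \<open>- R\<close>, the other half to the perturbation of the base point.\<close>
  obtain R :: nat where R: "tail_const \<beta> * exp (- (2 * c * \<beta> * R)) \<le> A / 2"
  proof -
    have "(\<lambda>n. tail_const \<beta> * exp (- (2 * c * \<beta>)) ^ n) \<longlonglongrightarrow> tail_const \<beta> * 0"
      using c \<beta> by (intro tendsto_intros LIMSEQ_power_zero) auto
    then have "\<forall>\<^sub>F n in sequentially. tail_const \<beta> * exp (- (2 * c * \<beta>)) ^ n < A / 2"
      using A by (intro order_tendstoD(2)) auto
    then obtain n where "tail_const \<beta> * exp (- (2 * c * \<beta>)) ^ n < A / 2"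
      using eventually_happens'[OF sequentially_bot] by blast
    then show ?thesis by (intro that[of n]) (simp add: exp_of_nat_mult[symmetric] mult_ac)
  qed
  \<comment> \<open>There will be \<open>M + R + 1\<close> equations with
    \<open>M < (N + 1) / \<beta> + 1\<close>; their number is below \<open>N\<close> once
    \<open>N * (1 - 1 / \<beta>)\<close> exceeds \<open>1 / \<beta> + 3 + R\<close>, which is
    attainable because \<beta> > 1.\<close>
  obtain N0 :: nat where N0: "(1 / \<beta> + 3 + R) / (1 - 1 / \<beta>) < real N0"
    using reals_Archimedean2 by blast
  define N where "N = int N0"
  have \<beta>': "1 - 1 / \<beta> > 0" using \<beta> by simp
  have N: "1 / \<beta> + 3 + R < of_int N * (1 - 1 / \<beta>)"
    using N0 \<beta>' by (simp add: N_def pos_divide_less_eq)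
  \<comment> \<open>Beyond row \<open>M\<close> the argument of the window is nonpositive for all
    \<xi> < 1 and \<open>j < N\<close>, so those rows vanish throughout.\<close>
  define M where "M = \<lceil>(of_int N + 1) / \<beta>\<rceil>"
  have M_less: "of_int M < (of_int N + 1) / \<beta> + 1" unfolding M_def by linarith
  have M_ge: "\<beta> * of_int M \<ge> of_int N + 1"
  proof -
    have "(of_int N + 1) / \<beta> \<le> of_int M" unfolding M_def by (rule le_of_int_ceiling)
    then show ?thesis using \<beta> by (simp add: pos_divide_le_eq mult.commute)
  qed
  have "real_of_int M + R + 1 < of_int N"
    using M_less N by (simp add: add_divide_distrib right_diff_distrib)
  then have MN: "M + int R + 1 < N" by linarith
  let ?E = "{- int R..M}"
  have "1 / \<beta> + 3 + R > 0" using \<beta> by (simp add: add_pos_nonneg)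
  then have "N \<noteq> 0" using N by auto
  then have Npos: "N > 0" by (simp add: N_def)
  define B where "B = (\<Union>k. \<Union>j :: int. \<Union>m :: int. {b k - of_int j + \<beta> * of_int m})"
  have "countable B" unfolding B_def by auto
  then have "\<not> {0<..<1} \<subseteq> B" using uncountable_open_interval[of 0 "1::real"] countable_subset by auto
  then obtain u where "u \<in> {0<..<1}" and u3: "u \<notin> B" by blast
  then have u: "0 < u" "u < 1" by simp_all
  have "card ?E < card {0..<N}" using MN Npos by simp
  from underdetermined_system[OF _ _ this, of "\<lambda>m j. cnj (\<gamma> (u + of_int j - \<beta> * of_int m))"]
  obtain x0 where x0: "\<exists>j\<in>{0..<N}. x0 j \<noteq> 0" "\<And>m. m \<in> ?E \<Longrightarrow> (\<Sum>j\<in>{0..<N}. cnj (\<gamma> (u + of_int j - \<beta> * of_int m)) * x0 j) = 0"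
    using finite_atLeastAtMost_int finite_atLeastLessThan_int by blast
  define x where "x j = (if j \<in> {0..<N} then x0 j else 0)" for j
  have x: "x j = 0" if "j \<notin> {0..<N}" for j using that unfolding x_def by (rule if_not_P)
  let ?X = "\<Sum>j\<in>{0..<N}. (cmod (x j))\<^sup>2"
  have X: "?X > 0" using x0(1) by (auto intro!: sum_pos2 simp: x_def)
  have x_null: "(\<Sum>j\<in>{0..<N}. x j * cnj (\<gamma> (u + of_int j - \<beta> * of_int m))) = 0" if "m \<in> ?E" for m
    using x0(2)[OF that] by (simp add: x_def mult.commute)
  \<comment> \<open>Chosen so that \<open>N * \<eta>^2 * N = A / 2\<close>: one \<open>N\<close>
    counts the columns in Cauchy-Schwarz, the other bounds the number of rows in
    \<open>?E\<close>.\<close>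
  define \<eta> where "\<eta> = sqrt (A / 2) / of_int N"
  have \<eta>: "\<eta> > 0" using A Npos by (simp add: \<eta>_def)
  have "\<forall>\<^sub>F \<xi> in at u. cmod (\<gamma> (\<xi> + of_int j - \<beta> * of_int m) - \<gamma> (u + of_int j - \<beta> * of_int m)) < \<eta>" for j m :: int
  proof -
    have "u + of_int j - \<beta> * of_int m \<notin> range b"
    proof
      assume "u + of_int j - \<beta> * of_int m \<in> range b"
      then obtain k where "u + of_int j - \<beta> * of_int m = b k" by blast
      then have "u = b k - of_int j + \<beta> * of_int m" by simp
      then show False using u3 unfolding B_def by blast
    qed
    then have "isCont (\<lambda>\<xi>. \<gamma> (\<xi> + of_int j - \<beta> * of_int m)) u"
      by (intro isCont_o2[OF _ isCont_\<gamma>] continuous_intros)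
    from tendstoD[OF this[unfolded isCont_def] \<eta>] show ?thesis unfolding dist_norm .
  qed
  then have "\<forall>\<^sub>F \<xi> in at u. \<forall>j\<in>{0..<N}. \<forall>m\<in>?E. cmod (\<gamma> (\<xi> + of_int j - \<beta> * of_int m) - \<gamma> (u + of_int j - \<beta> * of_int m)) < \<eta>"
    by (intro eventually_ball_finite ballI) auto
  then obtain d where d: "d > 0" "\<And>\<xi> j m. \<xi> \<noteq> u \<Longrightarrow> dist \<xi> u < d \<Longrightarrow> j \<in> {0..<N} \<Longrightarrow> m \<in> ?E \<Longrightarrow>
      cmod (\<gamma> (\<xi> + of_int j - \<beta> * of_int m) - \<gamma> (u + of_int j - \<beta> * of_int m)) < \<eta>"
    unfolding eventually_at by blast
  \<comment> \<open>The bound \<open>1 - u\<close> keeps the interval of base points inside the unit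
    interval that indexes the fibers.\<close>
  define \<epsilon> where "\<epsilon> = min d (1 - u)"
  have \<epsilon>: "\<epsilon> > 0" "u + \<epsilon> \<le> 1" "\<epsilon> \<le> d" using d(1) u by (auto simp: \<epsilon>_def)
  have main: "(\<integral>\<^sup>+m. ennreal ((cmod (T \<beta> x \<xi> m))\<^sup>2) \<partial>count_space UNIV) \<le> ennreal (A * ?X)" if \<xi>: "\<xi> \<in> {u..<u + \<epsilon>}" for \<xi>
  proof -
    have T_eq: "T \<beta> x \<xi> m = (\<Sum>j\<in>{0..<N}. x j * cnj (\<gamma> (\<xi> + of_int j - \<beta> * of_int m)))" for m
      by (rule T_finite_support) (rule x)
    \<comment> \<open>The punctured neighbourhood obtained above omits the centre, so \<xi> =
      \<open>u\<close> is treated apart.\<close>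
    have close: "cmod (\<gamma> (\<xi> + of_int j - \<beta> * of_int m) - \<gamma> (u + of_int j - \<beta> * of_int m)) \<le> \<eta>"
      if "j \<in> {0..<N}" "m \<in> ?E" for j m
      using d(2)[of \<xi> j m] that \<xi> \<epsilon> \<eta> by (cases "\<xi> = u") (auto simp: dist_real_def)
    have high: "T \<beta> x \<xi> m = 0" if "m > M" for m
      unfolding T_eq
    proof (intro sum.neutral ballI)
      fix j assume j: "j \<in> {0..<N}"
      have "\<beta> * of_int M \<le> \<beta> * of_int m" using that \<beta> by simp
      then have "\<xi> + of_int j - \<beta> * of_int m \<le> 0" using M_ge j \<xi> \<epsilon> by simp
      then show "x j * cnj (\<gamma> (\<xi> + of_int j - \<beta> * of_int m)) = 0" by (simp add: \<gamma>_def H_nonpos)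
    qed
    have mid: "(cmod (T \<beta> x \<xi> m))\<^sup>2 \<le> ?X * (of_int N * \<eta>\<^sup>2)" if m: "m \<in> ?E" for m
    proof -
      have "T \<beta> x \<xi> m = (\<Sum>j\<in>{0..<N}. x j * cnj (\<gamma> (\<xi> + of_int j - \<beta> * of_int m) - \<gamma> (u + of_int j - \<beta> * of_int m)))"
        unfolding T_eq using x_null[OF m] by (simp add: right_diff_distrib sum_subtractf)
      then have "(cmod (T \<beta> x \<xi> m))\<^sup>2 \<le> ?X * (\<Sum>j\<in>{0..<N}. (cmod (cnj (\<gamma> (\<xi> + of_int j - \<beta> * of_int m) - \<gamma> (u + of_int j - \<beta> * of_int m))))\<^sup>2)"
        by (simp only: norm_sum_mult_power2_le)
      also have "\<dots> \<le> ?X * (\<Sum>j\<in>{0..<N}. \<eta>\<^sup>2)"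
        using X m unfolding complex_mod_cnj by (intro mult_left_mono sum_mono power_mono close) auto
      also have "\<dots> = ?X * (of_int N * \<eta>\<^sup>2)" using Npos by simp
      finally show ?thesis .
    qed
    have "ennreal ((cmod (T \<beta> x \<xi> m))\<^sup>2) \<le> ennreal ((cmod (T \<beta> x \<xi> m))\<^sup>2) * indicator {..<- int R} m + ennreal (?X * (of_int N * \<eta>\<^sup>2)) * indicator ?E m" for m
    proof (cases "m \<in> ?E")
      case True
      then show ?thesis using mid[of m] by (simp add: ennreal_leI)
    next
      case False
      then show ?thesis using high[of m] by (cases "m > M") auto
    qed
    then have "(\<integral>\<^sup>+m. ennreal ((cmod (T \<beta> x \<xi> m))\<^sup>2) \<partial>count_space UNIV) \<le>
       (\<integral>\<^sup>+m. ennreal ((cmod (T \<beta> x \<xi> m))\<^sup>2) * indicator {..<- int R} m + ennreal (?X * (of_int N * \<eta>\<^sup>2)) * indicator ?E m \<partial>count_space UNIV)"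
      by (rule nn_integral_mono)
    also have "\<dots> = (\<integral>\<^sup>+m. ennreal ((cmod (T \<beta> x \<xi> m))\<^sup>2) * indicator {..<- int R} m \<partial>count_space UNIV) + ennreal (?X * (of_int N * \<eta>\<^sup>2)) * of_nat (card ?E)"
      by (subst nn_integral_add) (auto simp: nn_integral_cmult_indicator)
    also have "\<dots> \<le> ennreal (tail_const \<beta> * exp (- (2 * c * \<beta> * R)) * ?X) + ennreal (?X * (of_int N * \<eta>\<^sup>2) * of_int N)"
    proof (intro add_mono)
      show "(\<integral>\<^sup>+m. ennreal ((cmod (T \<beta> x \<xi> m))\<^sup>2) * indicator {..<- int R} m \<partial>count_space UNIV) \<le> ennreal (tail_const \<beta> * exp (- (2 * c * \<beta> * R)) * ?X)"
        using \<xi> u \<beta> by (intro T_tail x) auto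
      have "int (card ?E) \<le> N" using MN Npos by simp
      then have "real (card ?E) \<le> of_int N" by (metis of_int_of_nat_eq of_int_le_iff)
      then have "ennreal (?X * (of_int N * \<eta>\<^sup>2) * real (card ?E)) \<le> ennreal (?X * (of_int N * \<eta>\<^sup>2) * of_int N)"
        using X Npos by (intro ennreal_leI mult_left_mono) auto
      then show "ennreal (?X * (of_int N * \<eta>\<^sup>2)) * of_nat (card ?E) \<le> ennreal (?X * (of_int N * \<eta>\<^sup>2) * of_int N)"
        using X Npos by (subst (asm) ennreal_mult) (auto simp: ennreal_of_nat_eq_real_of_nat)
    qed
    also have "?X * (of_int N * \<eta>\<^sup>2) * of_int N = A / 2 * ?X"
      using Npos A by (simp add: \<eta>_def power_divide power2_eq_square)
    also have "ennreal (tail_const \<beta> * exp (- (2 * c * \<beta> * R)) * ?X) + ennreal (A / 2 * ?X) \<le> ennreal (A / 2 * ?X) + ennreal (A / 2 * ?X)"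
      using R X by (intro add_mono ennreal_leI mult_right_mono) auto
    also have "\<dots> = ennreal (A * ?X)" using A X by (simp flip: ennreal_plus)
    finally show ?thesis .
  qed
  show ?thesis by (rule that[OF x X u(1) \<epsilon>(1,2) main])
qed

text \<open>The near-null vector is spread over a short interval of fibers: \<open>F\<close> has the
  samples \<open>x j\<close> over every base point in \<open>{u..<u + \<epsilon>}\<close> and none
  elsewhere. Being bounded with bounded support, it is integrable and square integrable.\<close>

lemma \<Phi>_not_bounded_below:
  assumes \<beta>: "\<beta> > 1" and A: "A > 0"
  obtains F where "integrable lborel F" "l2sq lborel F < \<infinity>" "l2sq lborel F > 0"
    "(\<integral>\<^sup>+m. \<integral>\<^sup>+n. ennreal ((cmod (\<Phi> \<beta> F m n))\<^sup>2) \<partial>count_space UNIV \<partial>count_space UNIV) \<le> ennreal A * l2sq lborel F"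
proof -
  from T_near_null_vector[OF \<beta> A] obtain N :: int and x u \<epsilon> where
    x: "\<And>j. j \<notin> {0..<N} \<Longrightarrow> x j = 0" and X: "(\<Sum>j\<in>{0..<N}. (cmod (x j))\<^sup>2) > 0"
    and u: "0 < u" "0 < \<epsilon>" "u + \<epsilon> \<le> 1"
    and T: "\<And>\<xi>. \<xi> \<in> {u..<u + \<epsilon>} \<Longrightarrow> (\<integral>\<^sup>+m. ennreal ((cmod (T \<beta> x \<xi> m))\<^sup>2) \<partial>count_space UNIV) \<le> ennreal (A * (\<Sum>j\<in>{0..<N}. (cmod (x j))\<^sup>2))"
    by metis
  let ?X = "\<Sum>j\<in>{0..<N}. (cmod (x j))\<^sup>2"
  define F where "F y = x \<lfloor>y\<rfloor> * indicator {u..<u + \<epsilon>} (y - of_int \<lfloor>y\<rfloor>)" for y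
  have [measurable]: "F \<in> borel_measurable borel"
    unfolding F_def by measurable
  have F_eq: "F (\<xi> + of_int j) = x j * indicator {u..<u + \<epsilon>} \<xi>" if "\<xi> \<in> {0..<1}" for \<xi> j
  proof -
    have "\<lfloor>\<xi> + of_int j\<rfloor> = j" using that by (simp add: floor_eq_iff)
    then show ?thesis by (simp add: F_def)
  qed
  have sum_x: "(\<integral>\<^sup>+j. ennreal (h (x j)) \<partial>count_space UNIV) = ennreal (\<Sum>j\<in>{0..<N}. h (x j))"
    if "h 0 = 0" "\<And>z. h z \<ge> 0" for h :: "complex \<Rightarrow> real"
  proof -
    have "(\<integral>\<^sup>+j. ennreal (h (x j)) \<partial>count_space UNIV) = (\<Sum>j\<in>{0..<N}. ennreal (h (x j)))"
      using x that(1) by (intro nn_integral_count_space') auto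
    then show ?thesis using that(2) by (simp add: sum_ennreal)
  qed
  have circ_ind: "(\<integral>\<^sup>+\<xi>. ennreal v * indicator {u..<u + \<epsilon>} \<xi> \<partial>circ) = ennreal v * ennreal \<epsilon>" for v
  proof -
    have "{0..<1} \<inter> {u..<u + \<epsilon>} = {u..<u + \<epsilon>}" using u by auto
    then show ?thesis using u by (simp add: nn_integral_cmult_indicator emeasure_circ)
  qed
  \<comment> \<open>The formula is kept general in \<open>h\<close> since both \<open>cmod\<close>
    and its square are integrated.\<close>
  have unf: "(\<integral>\<^sup>+y. ennreal (h (F y)) \<partial>lborel) = ennreal (\<Sum>j\<in>{0..<N}. h (x j)) * ennreal \<epsilon>"
    if h: "h 0 = 0" "\<And>z. h z \<ge> 0" "h \<in> borel_measurable borel" for h :: "complex \<Rightarrow> real"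
  proof -
    note [measurable] = h(3)
    have "(\<integral>\<^sup>+y. ennreal (h (F y)) \<partial>lborel) = (\<integral>\<^sup>+\<xi>. \<integral>\<^sup>+j. ennreal (h (F (\<xi> + of_int j))) \<partial>count_space (UNIV :: int set) \<partial>circ)"
      by (rule nn_integral_lborel_unfold) measurable
    also have "\<dots> = (\<integral>\<^sup>+\<xi>. ennreal (\<Sum>j\<in>{0..<N}. h (x j)) * indicator {u..<u + \<epsilon>} \<xi> \<partial>circ)"
    proof (rule nn_integral_cong_AE)
      show "AE \<xi> in circ. (\<integral>\<^sup>+j. ennreal (h (F (\<xi> + of_int j))) \<partial>count_space (UNIV :: int set)) = ennreal (\<Sum>j\<in>{0..<N}. h (x j)) * indicator {u..<u + \<epsilon>} \<xi>"
        using AE_circ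
      proof eventually_elim
        case (elim \<xi>)
        have "(\<integral>\<^sup>+j. ennreal (h (x j)) \<partial>count_space UNIV) = ennreal (\<Sum>j\<in>{0..<N}. h (x j))"
          by (rule sum_x[of h]) (auto simp: h)
        then show ?case using elim by (simp add: F_eq indicator_def h(1))
      qed
    qed
    also have "\<dots> = ennreal (\<Sum>j\<in>{0..<N}. h (x j)) * ennreal \<epsilon>" by (rule circ_ind)
    finally show ?thesis .
  qed
  have l2: "l2sq lborel F = ennreal ?X * ennreal \<epsilon>"
    unfolding l2sq_def by (rule unf[where h="\<lambda>z. (cmod z)\<^sup>2"]) auto
  have fin: "l2sq lborel F < \<infinity>" unfolding l2 by (simp add: ennreal_mult_less_top)
  show ?thesis
  proof (rule that)
    have "(\<integral>\<^sup>+y. ennreal (cmod (F y)) \<partial>lborel) = ennreal (\<Sum>j\<in>{0..<N}. cmod (x j)) * ennreal \<epsilon>"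
      by (rule unf) auto
    then show "integrable lborel F"
      by (intro integrableI_bounded) (auto simp: ennreal_mult_less_top)
    show "l2sq lborel F < \<infinity>" by (rule fin)
    show "l2sq lborel F > 0" unfolding l2 using X u by (simp add: ennreal_zero_less_mult_iff)
    have "(\<integral>\<^sup>+m. \<integral>\<^sup>+n. ennreal ((cmod (\<Phi> \<beta> F m n))\<^sup>2) \<partial>count_space UNIV \<partial>count_space UNIV) =
      (\<integral>\<^sup>+\<xi>. \<integral>\<^sup>+m. ennreal ((cmod (T \<beta> (\<lambda>j. F (\<xi> + of_int j)) \<xi> m))\<^sup>2) \<partial>count_space UNIV \<partial>circ)"
      using \<beta> by (intro fiber_sum fin) auto
    also have "\<dots> \<le> (\<integral>\<^sup>+\<xi>. ennreal (A * ?X) * indicator {u..<u + \<epsilon>} \<xi> \<partial>circ)"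
    proof (rule nn_integral_mono_AE)
      show "AE \<xi> in circ. (\<integral>\<^sup>+m. ennreal ((cmod (T \<beta> (\<lambda>j. F (\<xi> + of_int j)) \<xi> m))\<^sup>2) \<partial>count_space UNIV) \<le> ennreal (A * ?X) * indicator {u..<u + \<epsilon>} \<xi>"
        using AE_circ
      proof eventually_elim
        case (elim \<xi>)
        then show ?case
          using T[of \<xi>] by (cases "\<xi> \<in> {u..<u + \<epsilon>}") (auto simp: F_eq T_def)
      qed
    qed
    also have "\<dots> = ennreal A * l2sq lborel F"
      unfolding circ_ind l2 using A X by (simp add: ennreal_mult mult.assoc)
    finally show "(\<integral>\<^sup>+m. \<integral>\<^sup>+n. ennreal ((cmod (\<Phi> \<beta> F m n))\<^sup>2) \<partial>count_space UNIV \<partial>count_space UNIV) \<le> ennreal A * l2sq lborel F" .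
  qed
qed

end

section \<open>Frame bounds in the time domain\<close>

lemma nn_integral_eq_infsum:
  fixes h :: "'a \<Rightarrow> real"
  assumes h: "\<And>p. h p \<ge> 0" "h summable_on UNIV"
  shows "(\<integral>\<^sup>+p. ennreal (h p) \<partial>count_space UNIV) = ennreal (infsum h UNIV)"
proof -
  have "(\<lambda>p. norm (h p)) summable_on UNIV" using h by simp
  then have a: "Infinite_Set_Sum.abs_summable_on h UNIV" by (simp only: abs_summable_equivalent)
  then have "integrable (count_space UNIV) h" by (simp add: abs_summable_on_def)
  then have "(\<integral>\<^sup>+p. ennreal (h p) \<partial>count_space UNIV) = ennreal (infsetsum h UNIV)"
    unfolding infsetsum_def using h by (intro nn_integral_eq_integral) auto
  then show ?thesis by (simp add: infsetsum_infsum[OF a])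
qed

lemma summable_on_if_nn_integral_finite:
  fixes h :: "'a \<Rightarrow> real"
  assumes h: "\<And>p. h p \<ge> 0" "(\<integral>\<^sup>+p. ennreal (h p) \<partial>count_space UNIV) < \<infinity>"
  shows "h summable_on UNIV"
proof -
  have "integrable (count_space UNIV) h"
    using h by (intro integrableI_bounded) auto
  then have "Infinite_Set_Sum.abs_summable_on h UNIV" by (simp add: abs_summable_on_def)
  then have "(\<lambda>p. norm (h p)) summable_on UNIV" by (simp only: abs_summable_equivalent)
  then show ?thesis using h by simp
qed

lemma l2sq_eq_L2_normsq:
  assumes "L2 f" shows "l2sq lborel f = ennreal (L2_normsq f)"
  using assms unfolding L2_def L2_normsq_def l2sq_def
  by (intro nn_integral_eq_integral) auto

lemma L2_iff_l2sq: "L2 f \<longleftrightarrow> f \<in> borel_measurable borel \<and> l2sq lborel f < \<infinity>"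
proof
  assume "L2 f"
  then show "f \<in> borel_measurable borel \<and> l2sq lborel f < \<infinity>"
    by (simp add: l2sq_eq_L2_normsq) (simp add: L2_def)
next
  assume f: "f \<in> borel_measurable borel \<and> l2sq lborel f < \<infinity>"
  then show "L2 f" unfolding L2_def using l2sq_integrable[of f lborel] by simp
qed

lemma l2sq_cnj [simp]: "l2sq M (\<lambda>x. cnj (f x)) = l2sq M f"
  by (simp add: l2sq_def)

definition coeff_sum :: "(int \<times> int \<Rightarrow> real \<Rightarrow> complex) \<Rightarrow> (real \<Rightarrow> complex) \<Rightarrow> ennreal" where
  "coeff_sum \<phi> f = (\<integral>\<^sup>+p. ennreal ((cmod (L2_inner f (\<phi> p)))\<^sup>2) \<partial>count_space UNIV)"

text \<open>In \<open>ennreal\<close> the upper inequality encodes summability, as its right side is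
  finite for \<open>L2 f\<close>; the frame condition becomes a pair of inequalities between
  extended integrals.\<close>

lemma gabor_frame_iff:
  "gabor_frame g \<alpha> \<beta> \<longleftrightarrow> (\<exists>A B. A > 0 \<and> B > 0 \<and> (\<forall>f. L2 f \<longrightarrow>
     ennreal A * l2sq lborel f \<le> coeff_sum (\<lambda>(m, n). tf_shift (\<alpha> * of_int n) (\<beta> * of_int m) g) f \<and>
     coeff_sum (\<lambda>(m, n). tf_shift (\<alpha> * of_int n) (\<beta> * of_int m) g) f \<le> ennreal B * l2sq lborel f))"
proof -
  let ?\<phi> = "\<lambda>(m, n). tf_shift (\<alpha> * of_int n) (\<beta> * of_int m) g"
  have "((\<lambda>(m::int, n::int). (cmod (L2_inner f (tf_shift (\<alpha> * of_int n) (\<beta> * of_int m) g)))\<^sup>2) summable_on UNIV \<and>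
           A * L2_normsq f \<le> (\<Sum>\<^sub>\<infinity>(m::int, n::int). (cmod (L2_inner f (tf_shift (\<alpha> * of_int n) (\<beta> * of_int m) g)))\<^sup>2) \<and>
           (\<Sum>\<^sub>\<infinity>(m::int, n::int). (cmod (L2_inner f (tf_shift (\<alpha> * of_int n) (\<beta> * of_int m) g)))\<^sup>2) \<le> B * L2_normsq f)
    \<longleftrightarrow> ennreal A * l2sq lborel f \<le> coeff_sum ?\<phi> f \<and> coeff_sum ?\<phi> f \<le> ennreal B * l2sq lborel f" (is "?L \<longleftrightarrow> ?R")
    if "L2 f" "A > 0" "B > 0" for f A B
  proof -
    let ?h = "\<lambda>p. (cmod (L2_inner f (?\<phi> p)))\<^sup>2"
    have h: "(\<lambda>(m::int, n::int). (cmod (L2_inner f (tf_shift (\<alpha> * of_int n) (\<beta> * of_int m) g)))\<^sup>2) = ?h"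
      by (auto simp: fun_eq_iff)
    have N: "L2_normsq f \<ge> 0" by (simp add: L2_normsq_def)
    have R: "?R \<longleftrightarrow> ennreal (A * L2_normsq f) \<le> coeff_sum ?\<phi> f \<and> coeff_sum ?\<phi> f \<le> ennreal (B * L2_normsq f)"
      using that N by (simp add: l2sq_eq_L2_normsq ennreal_mult)
    show ?thesis
    proof
      assume L: ?L
      then have s: "?h summable_on UNIV" unfolding h by blast
      have c: "coeff_sum ?\<phi> f = ennreal (infsum ?h UNIV)"
        unfolding coeff_sum_def by (rule nn_integral_eq_infsum[OF _ s]) simp
      show ?R unfolding R unfolding c using L unfolding h by (simp add: ennreal_leI)
    next
      assume "?R"
      then have R': "ennreal (A * L2_normsq f) \<le> coeff_sum ?\<phi> f" "coeff_sum ?\<phi> f \<le> ennreal (B * L2_normsq f)"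
        unfolding R by auto
      then have "coeff_sum ?\<phi> f < \<infinity>" by (simp add: order_le_less_trans)
      then have s: "?h summable_on UNIV"
        unfolding coeff_sum_def by (intro summable_on_if_nn_integral_finite) auto
      have c: "coeff_sum ?\<phi> f = ennreal (infsum ?h UNIV)"
        unfolding coeff_sum_def by (rule nn_integral_eq_infsum[OF _ s]) simp
      have i: "infsum ?h UNIV \<ge> 0" by (intro infsum_nonneg) auto
      show ?L unfolding h using s R' i N that unfolding c by simp
    qed
  qed
  then show ?thesis unfolding gabor_frame_def by blast
qed

lemma integrable_L2_inner:
  assumes [measurable]: "f \<in> borel_measurable borel" "g \<in> borel_measurable borel"
    and "l2sq lborel f < \<infinity>" "l2sq lborel g < \<infinity>"
  shows "integrable lborel (\<lambda>t. f t * cnj (g t))"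
  using assms by (intro integrable_l2_mult) auto

section \<open>Extending frame bounds from integrable to square integrable functions\<close>

definition trunc :: "nat \<Rightarrow> (real \<Rightarrow> complex) \<Rightarrow> real \<Rightarrow> complex" where
  "trunc N f x = (if \<bar>x\<bar> \<le> real N then f x else 0)"

lemma trunc_tendsto: "(\<lambda>N. trunc N f x) \<longlonglongrightarrow> f x"
proof -
  obtain n :: nat where n: "\<bar>x\<bar> \<le> real n" using real_arch_simple by blast
  have "\<forall>\<^sub>F N in sequentially. trunc N f x = f x"
    using eventually_ge_at_top[of n]
  proof eventually_elim
    case (elim N)
    then have "real n \<le> real N" by simp
    then show ?case using n by (simp add: trunc_def)
  qed
  then show ?thesis by (rule tendsto_eventually)
qed

lemma norm_trunc_le: "cmod (trunc N f x) \<le> cmod (f x)"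
  by (simp add: trunc_def)

lemma measurable_trunc [measurable]:
  assumes [measurable]: "f \<in> borel_measurable borel"
  shows "trunc N f \<in> borel_measurable borel"
  unfolding trunc_def[abs_def] by measurable

lemma l2sq_mono: "(\<And>x. cmod (f x) \<le> cmod (g x)) \<Longrightarrow> l2sq M f \<le> l2sq M g"
  unfolding l2sq_def by (intro nn_integral_mono ennreal_leI power_mono) auto

lemma integrable_trunc:
  assumes [measurable]: "f \<in> borel_measurable borel" and fin: "l2sq lborel f < \<infinity>"
  shows "integrable lborel (trunc N f)"
proof -
  have "integrable lborel (\<lambda>x. f x * (if \<bar>x\<bar> \<le> real N then 1 else 0))"
  proof (rule integrable_l2_mult[OF _ _ fin])
    have "l2sq lborel (\<lambda>x :: real. if \<bar>x\<bar> \<le> real N then 1 else 0) = (\<integral>\<^sup>+x. indicator {- real N..real N} x \<partial>lborel)"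
      unfolding l2sq_def by (intro nn_integral_cong) (auto simp: indicator_def)
    then show "l2sq lborel (\<lambda>x :: real. if \<bar>x\<bar> \<le> real N then 1 else 0) < \<infinity>" by simp
  qed auto
  then show ?thesis
    by (rule back_subst[where P="integrable lborel"]) (auto simp: trunc_def fun_eq_iff)
qed

lemma l2sq_trunc_diff_tendsto:
  assumes [measurable]: "f \<in> borel_measurable borel" and fin: "l2sq lborel f < \<infinity>"
  shows "(\<lambda>N. l2sq lborel (\<lambda>x. f x - trunc N f x)) \<longlonglongrightarrow> 0"
proof -
  have "(\<lambda>N. l2sq lborel (\<lambda>x. f x - trunc N f x)) \<longlonglongrightarrow> (\<integral>\<^sup>+(x::real). 0 \<partial>lborel)"
    unfolding l2sq_def
  proof (rule nn_integral_dominated_convergence[where w="\<lambda>x. ennreal ((cmod (f x))\<^sup>2)"])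
    show "AE x in lborel. ennreal ((cmod (f x - trunc N f x))\<^sup>2) \<le> ennreal ((cmod (f x))\<^sup>2)" for N
      by (intro AE_I2 ennreal_leI power_mono) (auto simp: trunc_def)
    show "(\<integral>\<^sup>+x. ennreal ((cmod (f x))\<^sup>2) \<partial>lborel) < \<infinity>" using fin by (simp add: l2sq_def)
    show "AE x in lborel. (\<lambda>N. ennreal ((cmod (f x - trunc N f x))\<^sup>2)) \<longlonglongrightarrow> 0"
    proof (rule AE_I2)
      fix x
      have "(\<lambda>N. ennreal ((cmod (f x - trunc N f x))\<^sup>2)) \<longlonglongrightarrow> ennreal ((cmod (f x - f x))\<^sup>2)"
        by (intro tendsto_intros tendsto_ennrealI trunc_tendsto)
      then show "(\<lambda>N. ennreal ((cmod (f x - trunc N f x))\<^sup>2)) \<longlonglongrightarrow> 0" by simp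
    qed
  qed auto
  then show ?thesis by simp
qed

lemma l2sq_trunc_tendsto:
  assumes [measurable]: "f \<in> borel_measurable borel" and fin: "l2sq lborel f < \<infinity>"
  shows "(\<lambda>N. l2sq lborel (trunc N f)) \<longlonglongrightarrow> l2sq lborel f"
  unfolding l2sq_def
proof (rule nn_integral_dominated_convergence[where w="\<lambda>x. ennreal ((cmod (f x))\<^sup>2)"])
  show "AE x in lborel. ennreal ((cmod (trunc N f x))\<^sup>2) \<le> ennreal ((cmod (f x))\<^sup>2)" for N
    by (intro AE_I2 ennreal_leI power_mono norm_trunc_le) auto
  show "(\<integral>\<^sup>+x. ennreal ((cmod (f x))\<^sup>2) \<partial>lborel) < \<infinity>" using fin by (simp add: l2sq_def)
  show "AE x in lborel. (\<lambda>N. ennreal ((cmod (trunc N f x))\<^sup>2)) \<longlonglongrightarrow> ennreal ((cmod (f x))\<^sup>2)"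
    by (intro AE_I2 tendsto_intros tendsto_ennrealI trunc_tendsto)
qed auto

lemma L2_inner_trunc_tendsto:
  assumes [measurable]: "f \<in> borel_measurable borel" "g \<in> borel_measurable borel"
    and fin: "l2sq lborel f < \<infinity>" "l2sq lborel g < \<infinity>"
  shows "(\<lambda>N. L2_inner (trunc N f) g) \<longlonglongrightarrow> L2_inner f g"
  unfolding L2_inner_def
proof (rule integral_dominated_convergence[where w="\<lambda>t. cmod (f t * cnj (g t))"])
  show "integrable lborel (\<lambda>t. cmod (f t * cnj (g t)))"
    using integrable_L2_inner[OF assms] by (rule integrable_norm)
  show "AE t in lborel. (\<lambda>N. trunc N f t * cnj (g t)) \<longlonglongrightarrow> f t * cnj (g t)"
    by (intro AE_I2 tendsto_intros trunc_tendsto)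
  show "AE t in lborel. norm (trunc N f t * cnj (g t)) \<le> cmod (f t * cnj (g t))" for N
    by (intro AE_I2) (auto simp: norm_mult intro!: mult_right_mono norm_trunc_le)
qed auto

lemma coeff_sum_add_le:
  assumes [measurable]: "f \<in> borel_measurable borel" "h \<in> borel_measurable borel" "\<And>p. \<phi> p \<in> borel_measurable borel"
    and fin: "l2sq lborel f < \<infinity>" "l2sq lborel h < \<infinity>" "\<And>p. l2sq lborel (\<phi> p) < \<infinity>"
  shows "coeff_sum \<phi> (\<lambda>x. f x + h x) \<le> 2 * coeff_sum \<phi> f + 2 * coeff_sum \<phi> h"
proof -
  have "L2_inner (\<lambda>x. f x + h x) (\<phi> p) = L2_inner f (\<phi> p) + L2_inner h (\<phi> p)" for p
    unfolding L2_inner_def distrib_right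
    by (intro Bochner_Integration.integral_add integrable_L2_inner fin) auto
  then have "coeff_sum \<phi> (\<lambda>x. f x + h x) = l2sq (count_space UNIV) (\<lambda>p. L2_inner f (\<phi> p) + L2_inner h (\<phi> p))"
    by (simp add: coeff_sum_def l2sq_def)
  also have "\<dots> \<le> 2 * l2sq (count_space UNIV) (\<lambda>p. L2_inner f (\<phi> p)) + 2 * l2sq (count_space UNIV) (\<lambda>p. L2_inner h (\<phi> p))"
    by (rule l2sq_add_le) auto
  finally show ?thesis by (simp add: coeff_sum_def l2sq_def)
qed

text \<open>Fatou carries the upper bound to the limit of the truncations. For the lower bound, a
  truncation is \<open>f\<close> minus a remainder that the upper bound controls; the crude
  inequality \<open>coeff_sum_add_le\<close> costs the factor 2 in \<open>A / 2\<close>.\<close>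

lemma frame_bounds_extend:
  assumes \<phi>[measurable]: "\<And>p. \<phi> p \<in> borel_measurable borel" and \<phi>_fin: "\<And>p. l2sq lborel (\<phi> p) < \<infinity>"
    and bounds: "\<And>f. integrable lborel f \<Longrightarrow> l2sq lborel f < \<infinity> \<Longrightarrow>
      ennreal A * l2sq lborel f \<le> coeff_sum \<phi> f \<and> coeff_sum \<phi> f \<le> ennreal B * l2sq lborel f"
    and A: "A > 0" and f[measurable]: "f \<in> borel_measurable borel" and fin: "l2sq lborel f < \<infinity>"
  shows "ennreal (A / 2) * l2sq lborel f \<le> coeff_sum \<phi> f" "coeff_sum \<phi> f \<le> ennreal B * l2sq lborel f"
proof -
  \<comment> \<open>Proved for general \<open>h\<close> because it is applied again to the remainder
    \<open>f - trunc N f\<close>, which may fail to be integrable.\<close>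
  have upper: "coeff_sum \<phi> h \<le> ennreal B * l2sq lborel h"
    if [measurable]: "h \<in> borel_measurable borel" and h: "l2sq lborel h < \<infinity>" for h
  proof -
    have tfin: "l2sq lborel (trunc N h) < \<infinity>" for N
      using l2sq_mono[of "trunc N h" h, OF norm_trunc_le] h by (rule order.strict_trans1)
    have "coeff_sum \<phi> h = (\<integral>\<^sup>+p. liminf (\<lambda>N. ennreal ((cmod (L2_inner (trunc N h) (\<phi> p)))\<^sup>2)) \<partial>count_space UNIV)"
      unfolding coeff_sum_def
    proof (intro nn_integral_cong)
      fix p
      have "(\<lambda>N. ennreal ((cmod (L2_inner (trunc N h) (\<phi> p)))\<^sup>2)) \<longlonglongrightarrow> ennreal ((cmod (L2_inner h (\<phi> p)))\<^sup>2)"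
        by (intro tendsto_ennrealI tendsto_intros L2_inner_trunc_tendsto h \<phi>_fin) auto
      then show "ennreal ((cmod (L2_inner h (\<phi> p)))\<^sup>2) = liminf (\<lambda>N. ennreal ((cmod (L2_inner (trunc N h) (\<phi> p)))\<^sup>2))"
        using lim_imp_Liminf[OF sequentially_bot] by metis
    qed
    also have "\<dots> \<le> liminf (\<lambda>N. coeff_sum \<phi> (trunc N h))"
      unfolding coeff_sum_def by (rule nn_integral_liminf) simp
    also have "\<dots> \<le> liminf (\<lambda>N. ennreal B * l2sq lborel h)"
    proof (intro Liminf_mono always_eventually allI)
      fix N
      have "coeff_sum \<phi> (trunc N h) \<le> ennreal B * l2sq lborel (trunc N h)"
        using bounds integrable_trunc[OF _ h] tfin by simp
      also have "\<dots> \<le> ennreal B * l2sq lborel h"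
        by (intro mult_left_mono l2sq_mono norm_trunc_le) simp
      finally show "coeff_sum \<phi> (trunc N h) \<le> ennreal B * l2sq lborel h" .
    qed
    also have "\<dots> = ennreal B * l2sq lborel h" by (simp add: Liminf_const)
    finally show ?thesis .
  qed
  show "coeff_sum \<phi> f \<le> ennreal B * l2sq lborel f" by (rule upper[OF f fin])
  have tfin: "l2sq lborel (trunc N f) < \<infinity>" for N
    using l2sq_mono[of "trunc N f" f, OF norm_trunc_le] fin by (rule order.strict_trans1)
  have dfin: "l2sq lborel (\<lambda>x. f x - trunc N f x) < \<infinity>" for N
    by (rule order.strict_trans1[OF l2sq_mono fin]) (auto simp: trunc_def)
  have dfin': "l2sq lborel (\<lambda>x. - (f x - trunc N f x)) = l2sq lborel (\<lambda>x. f x - trunc N f x)" for N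
    by (intro l2sq_cong) (simp add: norm_minus_commute)
  have step: "ennreal A * l2sq lborel (trunc N f) \<le> 2 * coeff_sum \<phi> f + 2 * (ennreal B * l2sq lborel (\<lambda>x. f x - trunc N f x))" for N
  proof -
    have "ennreal A * l2sq lborel (trunc N f) \<le> coeff_sum \<phi> (trunc N f)"
      using bounds integrable_trunc[OF f fin] tfin by simp
    also have "coeff_sum \<phi> (trunc N f) = coeff_sum \<phi> (\<lambda>x. f x + - (f x - trunc N f x))" by simp
    also have "\<dots> \<le> 2 * coeff_sum \<phi> f + 2 * coeff_sum \<phi> (\<lambda>x. - (f x - trunc N f x))"
      by (intro coeff_sum_add_le fin \<phi>_fin) (use dfin dfin' in auto)
    also have "\<dots> \<le> 2 * coeff_sum \<phi> f + 2 * (ennreal B * l2sq lborel (\<lambda>x. - (f x - trunc N f x)))"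
      by (intro add_left_mono mult_left_mono upper) (use dfin dfin' in auto)
    finally show ?thesis unfolding dfin' .
  qed
  have "ennreal A * l2sq lborel f \<le> 2 * coeff_sum \<phi> f + 2 * (ennreal B * 0)"
  proof (rule LIMSEQ_le)
    show "(\<lambda>N. ennreal A * l2sq lborel (trunc N f)) \<longlonglongrightarrow> ennreal A * l2sq lborel f"
      by (intro ennreal_tendsto_cmult l2sq_trunc_tendsto f fin) simp
    show "(\<lambda>N. 2 * coeff_sum \<phi> f + 2 * (ennreal B * l2sq lborel (\<lambda>x. f x - trunc N f x))) \<longlonglongrightarrow> 2 * coeff_sum \<phi> f + 2 * (ennreal B * 0)"
      by (intro tendsto_add tendsto_const ennreal_tendsto_cmult l2sq_trunc_diff_tendsto f fin) simp_all
  qed (use step in blast)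
  then have le: "ennreal A * l2sq lborel f \<le> 2 * coeff_sum \<phi> f" by simp
  have "ennreal (A / 2) * l2sq lborel f = ennreal (1 / 2) * (ennreal A * l2sq lborel f)"
  proof -
    have "ennreal (A / 2) = ennreal (1 / 2) * ennreal A"
      using A by (subst ennreal_mult[symmetric]) auto
    then show ?thesis by (simp only: mult.assoc)
  qed
  also have "\<dots> \<le> ennreal (1 / 2) * (2 * coeff_sum \<phi> f)" by (intro mult_left_mono le) simp
  also have "\<dots> = coeff_sum \<phi> f"
  proof -
    have "ennreal (1 / 2) * ennreal 2 = 1" by (subst ennreal_mult[symmetric]) auto
    then have "ennreal (1 / 2) * 2 = 1" by simp
    then show ?thesis by (simp add: mult.assoc[symmetric])
  qed
  finally show "ennreal (A / 2) * l2sq lborel f \<le> coeff_sum \<phi> f" .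
qed

section \<open>Transforms of half-line exponentials\<close>

lemma ec_conv_exp': "ec (t * x) = exp (complex_of_real x * (2 * pi * \<i> * of_real t))"
  by (simp add: ec_conv_exp mult_ac)

text \<open>The modulus is free of \<open>t\<close>, so a real half-line integral settles
  integrability and norm. The value then comes from the primitive
  \<open>- exp (- z * x) / z\<close>, where \<open>z\<close> has real part \<open>c\<close> and so
  is nonzero.\<close>

lemma has_integral_exp_decay:
  fixes c b t :: real
  assumes c: "c > 0"
  defines "f \<equiv> \<lambda>x. indicator {b<..} x *\<^sub>R (exp (- c * x) * ec (t * x))"
  shows "integrable lborel f" "(LINT x|lborel. f x) = exp (- c * b) * ec (b * t) / (c - 2 * pi * \<i> * t)"
    "(LINT x|lborel. cmod (f x)) = exp (- c * b) / c"
proof -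
  have lim: "((\<lambda>x. - exp (- c * x) / c) \<longlongrightarrow> - 0 / c) at_top"
    using c by (intro tendsto_intros filterlim_compose[OF exp_at_bot]
        filterlim_tendsto_neg_mult_at_bot[OF tendsto_const _ filterlim_ident]) auto
  have "(\<integral>\<^sup>+x. ennreal (exp (- c * x)) * indicator {b..} x \<partial>lborel) = ennreal (- 0 / c - (- exp (- c * b) / c))"
    using c by (intro nn_integral_FTC_atLeast lim) (auto intro!: derivative_eq_intros)
  also have "(\<integral>\<^sup>+x. ennreal (exp (- c * x)) * indicator {b..} x \<partial>lborel) = (\<integral>\<^sup>+x. ennreal (cmod (f x)) \<partial>lborel)"
  proof (rule nn_integral_cong_AE)
    show "AE x in lborel. ennreal (exp (- c * x)) * indicator {b..} x = ennreal (cmod (f x))"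
      using AE_lborel_singleton[of b] by eventually_elim (auto simp: f_def indicator_def norm_mult)
  qed
  finally have n: "(\<integral>\<^sup>+x. ennreal (cmod (f x)) \<partial>lborel) = ennreal (exp (- c * b) / c)" by simp
  have [measurable]: "f \<in> borel_measurable lborel" unfolding f_def by measurable
  show int: "integrable lborel f" by (rule integrableI_bounded) (simp_all add: n)
  have "ennreal (LINT x|lborel. cmod (f x)) = ennreal (exp (- c * b) / c)"
    unfolding n[symmetric] using int by (intro nn_integral_eq_integral[symmetric]) auto
  then show "(LINT x|lborel. cmod (f x)) = exp (- c * b) / c"
    using c by (subst (asm) ennreal_inj) auto
  define z where "z = complex_of_real c - 2 * pi * \<i> * t"
  have z: "z \<noteq> 0" using c by (auto simp: z_def complex_eq_iff)
  have E: "exp (- c * x) * ec (t * x) = exp (- z * of_real x)" for x :: real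
    unfolding ec_conv_exp' z_def by (simp add: exp_of_real[symmetric] exp_add[symmetric] algebra_simps)
  let ?F = "\<lambda>x :: real. - exp (- z * of_real x) / z"
  have "(LBINT x=ereal b..\<infinity>. exp (- z * of_real x)) = 0 - (- exp (- z * of_real b) / z)"
  proof (rule interval_integral_FTC_integrable)
    show "set_integrable lborel (einterval (ereal b) \<infinity>) (\<lambda>x. exp (- z * of_real x))"
      using int unfolding f_def E set_integrable_def by simp
    show "(?F has_vector_derivative exp (- z * of_real x)) (at x)" for x
    proof -
      have "((\<lambda>w. - exp (- z * w) / z) has_field_derivative exp (- z * of_real x)) (at (of_real x))"
        using z by (auto intro!: derivative_eq_intros)
      then show ?thesis by (rule has_vector_derivative_real_field)
    qed
    show "isCont (\<lambda>x. exp (- z * of_real x)) x" for x :: real by (intro continuous_intros)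
    have "isCont ?F b" using z by (intro continuous_intros)
    then have "(?F \<longlongrightarrow> - exp (- z * of_real b) / z) (at_right b)"
      unfolding isCont_def by (rule filterlim_mono) (auto simp: at_le)
    then show "((?F \<circ> real_of_ereal) \<longlongrightarrow> - exp (- z * of_real b) / z) (at_right (ereal b))"
      by (simp add: ereal_tendsto_simps)
    have "(?F \<longlongrightarrow> 0) at_top"
    proof (rule tendsto_norm_zero_cancel)
      have "cmod (?F x) = exp (- c * x) / cmod z" for x
        unfolding E[symmetric] by (simp add: norm_divide norm_mult)
      moreover have "((\<lambda>x. exp (- c * x) / cmod z) \<longlongrightarrow> 0 / cmod z) at_top"
        using c z by (intro tendsto_intros filterlim_compose[OF exp_at_bot]
          filterlim_tendsto_neg_mult_at_bot[OF tendsto_const _ filterlim_ident]) auto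
      ultimately show "((\<lambda>x. cmod (?F x)) \<longlongrightarrow> 0) at_top" by simp
    qed
    then show "((?F \<circ> real_of_ereal) \<longlongrightarrow> 0) (at_left \<infinity>)"
      by (simp add: ereal_tendsto_simps)
  qed simp
  then have "(LINT x|lborel. f x) = exp (- z * of_real b) / z"
    unfolding f_def E by (simp add: interval_lebesgue_integral_def set_lebesgue_integral_def)
  then show "(LINT x|lborel. f x) = exp (- c * b) * ec (b * t) / (c - 2 * pi * \<i> * t)"
    unfolding E[symmetric] unfolding z_def by (simp only: mult.commute[of t b])
qed

lemma ft_add_cmult:
  assumes "integrable lborel f" "integrable lborel g"
  shows "ft (\<lambda>x. f x + z * g x) y = ft f y + z * ft g y"
proof -
  have i: "integrable lborel (\<lambda>x. h x * ec (y * x))" if "integrable lborel h" for h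
    by (rule Bochner_Integration.integrable_bound[OF that]) (use that in \<open>auto simp: norm_mult\<close>)
  have "ft (\<lambda>x. f x + z * g x) y = (LINT x|lborel. f x * ec (y * x) + z * (g x * ec (y * x)))"
    unfolding ft_def by (simp add: algebra_simps)
  also have "\<dots> = ft f y + z * ft g y"
    unfolding ft_def using i[OF assms(1)] i[OF assms(2)]
    by (subst Bochner_Integration.integral_add) auto
  finally show ?thesis .
qed

lemma l2sq_add_cmult_finite:
  assumes [measurable]: "f \<in> borel_measurable M" "g \<in> borel_measurable M"
    and "l2sq M f < \<infinity>" "l2sq M g < \<infinity>"
  shows "l2sq M (\<lambda>x. f x + z * g x) < \<infinity>"
proof -
  have "l2sq M (\<lambda>x. f x + z * g x) \<le> 2 * l2sq M f + 2 * l2sq M (\<lambda>x. z * g x)"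
    by (rule l2sq_add_le) auto
  also have "\<dots> < \<infinity>"
    using assms by (subst l2sq_cmult) (auto simp: ennreal_mult_less_top)
  finally show ?thesis .
qed

section \<open>Pairing identities for the transform\<close>

lemma polarization:
  fixes u v :: complex
  shows "4 * (u * cnj v) = of_real ((cmod (u + 1 * v))\<^sup>2) - of_real ((cmod (u + (- 1) * v))\<^sup>2)
     + \<i> * of_real ((cmod (u + \<i> * v))\<^sup>2) - \<i> * of_real ((cmod (u + (- \<i>) * v))\<^sup>2)"
  unfolding complex_norm_square by (simp add: algebra_simps)

lemma integral_mult_cnj_polarization:
  assumes [measurable]: "f \<in> borel_measurable M" "g \<in> borel_measurable M"
    and fin: "l2sq M f < \<infinity>" "l2sq M g < \<infinity>"
  defines "n \<equiv> \<lambda>z. complex_of_real (enn2real (l2sq M (\<lambda>x. f x + z * g x)))"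
  shows "4 * (LINT x|M. f x * cnj (g x)) = n 1 - n (- 1) + \<i> * n \<i> - \<i> * n (- \<i>)"
proof -
  have fin': "l2sq M (\<lambda>x. f x + z * g x) < \<infinity>" for z
    by (rule l2sq_add_cmult_finite) (use fin in auto)
  have i: "integrable M (\<lambda>x. complex_of_real ((cmod (f x + z * g x))\<^sup>2))" for z
    by (intro integrable_of_real l2sq_integrable fin') measurable
  have n: "n z = (LINT x|M. complex_of_real ((cmod (f x + z * g x))\<^sup>2))" for z
    unfolding n_def by (subst l2sq_eq_integral[OF _ fin'], measurable) (simp del: of_real_power)
  have "4 * (LINT x|M. f x * cnj (g x)) = (LINT x|M. 4 * (f x * cnj (g x)))" by simp
  also have "\<dots> = n 1 - n (- 1) + \<i> * n \<i> - \<i> * n (- \<i>)"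
    unfolding polarization n
    by (subst Bochner_Integration.integral_diff Bochner_Integration.integral_add,
        (intro Bochner_Integration.integrable_diff Bochner_Integration.integrable_add integrable_mult_right i)+)+
       (simp only: integral_mult_right_zero)
  finally show ?thesis .
qed

text \<open>Polarization of \<open>plancherel\<close>, for the counterexample, where the tested
  function is itself a transform.\<close>

lemma plancherel_inner:
  assumes f: "integrable lborel f" "l2sq lborel f < \<infinity>" and g: "integrable lborel g" "l2sq lborel g < \<infinity>"
  shows "(LINT y|lborel. ft f y * cnj (ft g y)) = (LINT x|lborel. f x * cnj (g x))"
proof -
  have [measurable]: "f \<in> borel_measurable borel" "g \<in> borel_measurable borel" using f g by auto
  have eq: "l2sq lborel (\<lambda>x. ft f x + z * ft g x) = l2sq lborel (\<lambda>x. f x + z * g x)" for z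
  proof -
    have "l2sq lborel (ft (\<lambda>x. f x + z * g x)) = l2sq lborel (\<lambda>x. f x + z * g x)"
      by (intro plancherel l2sq_add_cmult_finite Bochner_Integration.integrable_add integrable_mult_right f g) auto
    then show ?thesis using ft_add_cmult[OF f(1) g(1)] by (simp add: l2sq_def)
  qed
  have "4 * (LINT y|lborel. ft f y * cnj (ft g y)) = 4 * (LINT x|lborel. f x * cnj (g x))"
  proof -
    have P: "l2sq lborel (ft f) < \<infinity>" "l2sq lborel (ft g) < \<infinity>" using f g by (simp_all add: plancherel)
    have m: "f \<in> borel_measurable lborel" "g \<in> borel_measurable lborel"
      "ft f \<in> borel_measurable lborel" "ft g \<in> borel_measurable lborel" by simp_all
    show ?thesis
      unfolding integral_mult_cnj_polarization[OF m(3,4) P] integral_mult_cnj_polarization[OF m(1,2) f(2) g(2)] eq ..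
  qed
  then show ?thesis by simp
qed

text \<open>The counterpart of \<open>plancherel_inner\<close> for the frame bounds: the transform
  moves from the window to the tested function. The argument \<open>- x\<close> comes from
  conjugating the kernel.\<close>

lemma ft_fubini:
  assumes f: "integrable lborel f" and g: "integrable lborel g"
  shows "(LINT y|lborel. f y * cnj (ft g y)) = (LINT x|lborel. ft f (- x) * cnj (g x))"
proof -
  have [measurable]: "f \<in> borel_measurable borel" "g \<in> borel_measurable borel" using f g by auto
  have int: "integrable (lborel \<Otimes>\<^sub>M lborel) (\<lambda>(y, x). f y * cnj (g x) * ec (- (y * x)))"
  proof (rule lborel_pair.Fubini_integrable)
    show "integrable lborel (\<lambda>y. LINT x|lborel. norm (case (y, x) of (y, x) \<Rightarrow> f y * cnj (g x) * ec (- (y * x))))"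
      using f by (simp add: norm_mult)
    show "AE y in lborel. integrable lborel (\<lambda>x. case (y, x) of (y, x) \<Rightarrow> f y * cnj (g x) * ec (- (y * x)))"
    proof (rule AE_I2)
      fix y
      have "integrable lborel (\<lambda>x. f y * cnj (g x))" using g by simp
      then show "integrable lborel (\<lambda>x. case (y, x) of (y, x) \<Rightarrow> f y * cnj (g x) * ec (- (y * x)))"
        by (rule Bochner_Integration.integrable_bound) (auto simp: norm_mult)
    qed
  qed measurable
  have "(LINT y|lborel. f y * cnj (ft g y)) = (LINT y|lborel. LINT x|lborel. f y * cnj (g x) * ec (- (y * x)))"
  proof (intro Bochner_Integration.integral_cong refl)
    fix y
    have "f y * cnj (ft g y) = f y * (LINT x|lborel. cnj (g x * ec (y * x)))"
      unfolding ft_def by (simp only: Bochner_Integration.integral_cnj)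
    also have "\<dots> = (LINT x|lborel. f y * cnj (g x) * ec (- (y * x)))"
      by (simp add: cnj_ec mult.assoc)
    finally show "f y * cnj (ft g y) = (LINT x|lborel. f y * cnj (g x) * ec (- (y * x)))" .
  qed
  also have "\<dots> = (LINT x|lborel. LINT y|lborel. f y * cnj (g x) * ec (- (y * x)))"
    using lborel_pair.Fubini_integral[OF int] by simp
  also have "\<dots> = (LINT x|lborel. ft f (- x) * cnj (g x))"
  proof (intro Bochner_Integration.integral_cong refl)
    fix x
    have "(LINT y|lborel. f y * cnj (g x) * ec (- (y * x))) = (LINT y|lborel. f y * ec (- x * y) * cnj (g x))"
      by (simp add: mult_ac)
    then show "(LINT y|lborel. f y * cnj (g x) * ec (- (y * x))) = ft f (- x) * cnj (g x)"
      unfolding ft_def by simp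
  qed
  finally show ?thesis .
qed

lemma l2sq_reflect:
  assumes [measurable]: "f \<in> borel_measurable borel"
  shows "l2sq lborel (\<lambda>x :: real. f (- x)) = l2sq lborel f"
  unfolding l2sq_def by (subst nn_integral_real_affine[of "\<lambda>x. ennreal ((cmod (f x))\<^sup>2)" "-1" 0]) auto

text \<open>The transform exchanges the two kinds of shift: modulation by \<open>v\<close> arises
  from translation by \<open>v\<close>, translation by \<open>u\<close> from modulation by
  \<open>- u\<close>. The phase is taken at \<open>x - v\<close> because the translation acts
  last.\<close>

lemma ft_tf_shift:
  assumes h: "integrable lborel h"
  shows "tf_shift u v (ft h) = ft (\<lambda>x. h (x - v) * ec (- u * (x - v)))"
proof
  fix t
  have "tf_shift u v (ft h) t = ec (v * t) * (LINT x|lborel. h x * ec ((t - u) * x))"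
    by (simp add: tf_shift_def ft_def ec_conv_exp)
  also have "\<dots> = (LINT x|lborel. h x * ec ((t - u) * x) * ec (v * t))"
    by (simp add: mult.commute)
  also have "\<dots> = (LINT x|lborel. h (- v + 1 * x) * ec ((t - u) * (- v + 1 * x)) * ec (v * t))"
    by (subst lborel_integral_real_affine[of 1 _ "- v"]) auto
  also have "\<dots> = ft (\<lambda>x. h (x - v) * ec (- u * (x - v))) t"
    unfolding ft_def
  proof (intro Bochner_Integration.integral_cong refl)
    fix x
    have "ec ((t - u) * (- v + 1 * x)) * ec (v * t) = ec (- u * (x - v)) * ec (t * x)"
      by (simp add: ec_add[symmetric] algebra_simps)
    then show "h (- v + 1 * x) * ec ((t - u) * (- v + 1 * x)) * ec (v * t) = h (x - v) * ec (- u * (x - v)) * ec (t * x)"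
      by (simp add: mult.assoc)
  qed
  finally show "tf_shift u v (ft h) t = ft (\<lambda>x. h (x - v) * ec (- u * (x - v))) t" .
qed

context exp_window
begin

text \<open>The norms of the terms sum to at most a multiple of the sum of
  \<open>cmod (e k)\<close>, so integral and series may be exchanged; integrability and the
  transform follow together. The factor \<open>exp (- c * b k)\<close> arises because the
  \<open>k\<close>-th integral starts at \<open>b k\<close>.\<close>

lemma integrable_\<gamma>: "integrable lborel \<gamma>"
  and ft_\<gamma>: "ft \<gamma> t = (\<Sum>k. e k * exp (- c * b k) * ec (b k * t)) / (c - 2 * pi * \<i> * t)"
proof -
  define f where "f k x = e k * (indicator {b k<..} x *\<^sub>R (exp (- c * x) * ec (t * x)))" for k and x :: real
  note E = has_integral_exp_decay[OF c, where t=t]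
  have i: "integrable lborel (f k)" for k
    unfolding f_def by (intro integrable_mult_right E)
  have norm_f: "cmod (f k x) = cmod (e k) * cmod (indicator {b k<..} x *\<^sub>R (exp (- c * x) * ec (t * x)))" for k x
    by (simp add: f_def norm_mult)
  have s: "summable (\<lambda>k. cmod (f k x))" for x
  proof (rule summable_comparison_test[OF _ summable_mult2[OF summable_e, of "exp (- c * x)"]])
    show "\<exists>N. \<forall>n\<ge>N. norm (cmod (f n x)) \<le> cmod (e n) * exp (- c * x)"
      by (auto simp: norm_f norm_mult indicator_def)
  qed
  have "(LINT x|lborel. cmod (f k x)) = cmod (e k) * (exp (- c * b k) / c)" for k
    unfolding norm_f by (simp only: integral_mult_right_zero E(3))
  moreover have "summable (\<lambda>k. cmod (e k) * (exp (- c * b k) / c))"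
  proof (rule summable_comparison_test[OF _ summable_mult2[OF summable_e, of "1 / c"]])
    have "exp (- c * b n) \<le> 1" for n using c b_nonneg[of n] by simp
    then have "exp (- c * b n) / c \<le> 1 / c" for n using c by (intro divide_right_mono) auto
    then have "cmod (e n) * (exp (- c * b n) / c) \<le> cmod (e n) * (1 / c)" for n by (intro mult_left_mono) auto
    moreover have "norm (cmod (e n) * (exp (- c * b n) / c)) = cmod (e n) * (exp (- c * b n) / c)" for n
      using c by simp
    ultimately show "\<exists>N. \<forall>n\<ge>N. norm (cmod (e n) * (exp (- c * b n) / c)) \<le> cmod (e n) * (1 / c)"
      by (simp only:) blast
  qed
  ultimately have s2: "summable (\<lambda>k. LINT x|lborel. cmod (f k x))" by simp
  have sum_f: "(\<Sum>k. f k x) = \<gamma> x * ec (t * x)" for x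
  proof -
    have "f k x = (e k * of_bool (b k < x)) * (exp (- c * x) * ec (t * x))" for k
      by (simp add: f_def indicator_def)
    then have "(\<Sum>k. f k x) = (\<Sum>k. e k * of_bool (b k < x)) * (exp (- c * x) * ec (t * x))"
      using suminf_mult2[OF summable_norm_cancel[OF summable_e_bool]] by simp
    then show ?thesis by (simp add: \<gamma>_def H_def mult_ac)
  qed
  have int: "integrable lborel (\<lambda>x. \<gamma> x * ec (t * x))"
    unfolding sum_f[symmetric] by (intro integrable_suminf i s2 AE_I2 s)
  show "integrable lborel \<gamma>"
    by (rule Bochner_Integration.integrable_bound[OF int]) (auto simp: norm_mult)
  have "ft \<gamma> t = (\<Sum>k. LINT x|lborel. f k x)"
    unfolding ft_def sum_f[symmetric] by (intro integral_suminf i s2 AE_I2 s)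
  also have "\<dots> = (\<Sum>k. e k * exp (- c * b k) * ec (b k * t) * (1 / (c - 2 * pi * \<i> * t)))"
  proof (intro suminf_cong)
    fix k
    have "(LINT x|lborel. f k x) = e k * (exp (- c * b k) * ec (b k * t) / (c - 2 * pi * \<i> * t))"
      unfolding f_def integral_mult_right_zero E(2) ..
    then show "(LINT x|lborel. f k x) = e k * exp (- c * b k) * ec (b k * t) * (1 / (c - 2 * pi * \<i> * t))" by simp
  qed
  also have "\<dots> = (\<Sum>k. e k * exp (- c * b k) * ec (b k * t)) * (1 / (c - 2 * pi * \<i> * t))"
  proof (rule suminf_mult2[symmetric])
    show "summable (\<lambda>k. e k * exp (- c * b k) * ec (b k * t))"
    proof (rule summable_norm_cancel, rule summable_comparison_test[OF _ summable_e])
      have "exp (- c * b n) \<le> 1" for n using c b_nonneg[of n] by simp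
      then show "\<exists>N. \<forall>n\<ge>N. norm (cmod (e n * exp (- c * b n) * ec (b n * t))) \<le> cmod (e n)"
        by (auto simp: norm_mult intro!: mult_right_le_one_le)
    qed
  qed
  finally show "ft \<gamma> t = (\<Sum>k. e k * exp (- c * b k) * ec (b k * t)) / (c - 2 * pi * \<i> * t)" by simp
qed

section \<open>The frame set\<close>

lemma exp_window_scaled: "\<alpha> > 0 \<Longrightarrow> exp_window (c / \<alpha>) e (\<lambda>k. \<alpha> * b k)"
  using c e0 b0 b_pos summable_tail tail_less by unfold_locales auto

lemma \<gamma>_scaled: "\<alpha> > 0 \<Longrightarrow> exp_window.\<gamma> (c / \<alpha>) e (\<lambda>k. \<alpha> * b k) (\<alpha> * s) = \<gamma> s"
proof -
  assume \<alpha>: "\<alpha> > 0"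
  interpret V: exp_window "c / \<alpha>" e "\<lambda>k. \<alpha> * b k" by (rule exp_window_scaled[OF \<alpha>])
  show ?thesis unfolding \<gamma>_def V.\<gamma>_def H_def V.H_def using \<alpha> by simp
qed

text \<open>The preimage under \<open>ft\<close> of a time-frequency shift of the window, in the
  form that \<open>ft_tf_shift\<close> produces.\<close>

definition shifted :: "real \<Rightarrow> real \<Rightarrow> int \<Rightarrow> int \<Rightarrow> real \<Rightarrow> complex" where
  "shifted \<alpha> \<beta> m n x = \<gamma> (x - \<beta> * of_int m) * ec (- (\<alpha> * of_int n) * (x - \<beta> * of_int m))"

lemma measurable_shifted [measurable]: "shifted \<alpha> \<beta> m n \<in> borel_measurable borel"
  unfolding shifted_def[abs_def] by measurable

lemma integrable_shifted: "integrable lborel (shifted \<alpha> \<beta> m n)"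
proof -
  have "integrable lborel (\<lambda>x. \<gamma> (- (\<beta> * of_int m) + 1 * x))"
    by (intro lborel_integrable_real_affine integrable_\<gamma>) simp
  then have "integrable lborel (\<lambda>x. \<gamma> (x - \<beta> * of_int m))" by simp
  then show ?thesis
    by (rule Bochner_Integration.integrable_bound) (auto simp: shifted_def[abs_def] norm_mult)
qed

lemma l2sq_shifted: "l2sq lborel (shifted \<alpha> \<beta> m n) < \<infinity>"
  using l2sq_\<gamma>_shift[of "\<beta> * of_int m"] by (simp add: l2sq_def shifted_def norm_mult)

lemma tf_shift_ft_\<gamma>:
  "tf_shift (\<alpha> * of_int n) (\<beta> * of_int m) (\<lambda>t. \<kappa> * ft \<gamma> t) = (\<lambda>t. \<kappa> * ft (shifted \<alpha> \<beta> m n) t)"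
proof -
  have "tf_shift (\<alpha> * of_int n) (\<beta> * of_int m) (\<lambda>t. \<kappa> * ft \<gamma> t) = (\<lambda>t. \<kappa> * tf_shift (\<alpha> * of_int n) (\<beta> * of_int m) (ft \<gamma>) t)"
    by (auto simp: tf_shift_def mult_ac)
  then show ?thesis unfolding ft_tf_shift[OF integrable_\<gamma>] by (simp only: shifted_def[abs_def])
qed

text \<open>The phase of \<open>shifted\<close> splits into a constant, lost in the modulus, and the
  character \<open>ec (\<alpha> * n * x)\<close>. The substitution \<open>y = \<alpha> * x\<close>
  makes that character 1-periodic at the price of \<open>1 / \<alpha>\<close>.\<close>

lemma norm_pair_shifted:
  assumes \<alpha>: "\<alpha> > 0"
  shows "cmod (LINT x|lborel. F x * cnj (shifted \<alpha> \<beta> m n x)) =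
    cmod (exp_window.\<Phi> (c / \<alpha>) e (\<lambda>k. \<alpha> * b k) (\<alpha> * \<beta>) (\<lambda>y. F (y / \<alpha>)) m n) / \<alpha>"
proof -
  interpret V: exp_window "c / \<alpha>" e "\<lambda>k. \<alpha> * b k" by (rule exp_window_scaled[OF \<alpha>])
  have "F x * cnj (shifted \<alpha> \<beta> m n x) = ec (- (\<alpha> * of_int n * (\<beta> * of_int m))) * (F x * cnj (\<gamma> (x - \<beta> * of_int m)) * ec (\<alpha> * of_int n * x))" for x
  proof -
    have "ec (\<alpha> * of_int n * (x - \<beta> * of_int m)) = ec (- (\<alpha> * of_int n * (\<beta> * of_int m))) * ec (\<alpha> * of_int n * x)"
      by (simp add: ec_add[symmetric] right_diff_distrib)
    then show ?thesis by (simp add: shifted_def cnj_ec)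
  qed
  then have "cmod (LINT x|lborel. F x * cnj (shifted \<alpha> \<beta> m n x)) = cmod (LINT x|lborel. F x * cnj (\<gamma> (x - \<beta> * of_int m)) * ec (\<alpha> * of_int n * x))"
    by (simp only: integral_mult_right_zero norm_mult norm_ec mult_1)
  also have "(LINT x|lborel. F x * cnj (\<gamma> (x - \<beta> * of_int m)) * ec (\<alpha> * of_int n * x)) =
      \<bar>1 / \<alpha>\<bar> *\<^sub>R (LINT y|lborel. F (0 + 1 / \<alpha> * y) * cnj (\<gamma> (0 + 1 / \<alpha> * y - \<beta> * of_int m)) * ec (\<alpha> * of_int n * (0 + 1 / \<alpha> * y)))"
    using \<alpha> by (intro lborel_integral_real_affine) auto
  also have "(\<lambda>y. F (0 + 1 / \<alpha> * y) * cnj (\<gamma> (0 + 1 / \<alpha> * y - \<beta> * of_int m)) * ec (\<alpha> * of_int n * (0 + 1 / \<alpha> * y))) =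
      (\<lambda>y. F (y / \<alpha>) * cnj (V.\<gamma> (y - \<alpha> * \<beta> * of_int m)) * ec (of_int n * y))"
  proof
    fix y
    have "\<gamma> (y / \<alpha> - \<beta> * of_int m) = V.\<gamma> (\<alpha> * (y / \<alpha> - \<beta> * of_int m))" by (rule \<gamma>_scaled[OF \<alpha>, symmetric])
    also have "\<alpha> * (y / \<alpha> - \<beta> * of_int m) = y - \<alpha> * \<beta> * of_int m" using \<alpha> by (simp add: field_simps)
    finally show "F (0 + 1 / \<alpha> * y) * cnj (\<gamma> (0 + 1 / \<alpha> * y - \<beta> * of_int m)) * ec (\<alpha> * of_int n * (0 + 1 / \<alpha> * y)) =
       F (y / \<alpha>) * cnj (V.\<gamma> (y - \<alpha> * \<beta> * of_int m)) * ec (of_int n * y)" using \<alpha> by simp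
  qed
  finally show ?thesis using \<alpha> by (simp add: V.\<Phi>_def)
qed

text \<open>\<open>F\<close> enters only through its pairing with the shifted windows, so that both
  \<open>ft_fubini\<close>, with \<open>F x = ft f (- x)\<close>, and
  \<open>plancherel_inner\<close>, with \<open>f = ft F\<close>, can be inserted.\<close>

lemma coeff_sum_eq:
  assumes \<alpha>: "\<alpha> > 0"
    and F: "\<And>m n. (LINT t|lborel. f t * cnj (ft (shifted \<alpha> \<beta> m n) t)) = (LINT x|lborel. F x * cnj (shifted \<alpha> \<beta> m n x))"
  shows "coeff_sum (\<lambda>(m, n). tf_shift (\<alpha> * of_int n) (\<beta> * of_int m) (\<lambda>t. \<kappa> * ft \<gamma> t)) f =
    ennreal ((cmod \<kappa> / \<alpha>)\<^sup>2) * (\<integral>\<^sup>+m. \<integral>\<^sup>+n. ennreal ((cmod (exp_window.\<Phi> (c / \<alpha>) e (\<lambda>k. \<alpha> * b k) (\<alpha> * \<beta>) (\<lambda>y. F (y / \<alpha>)) m n))\<^sup>2) \<partial>count_space UNIV \<partial>count_space UNIV)"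
    (is "_ = _ * (\<integral>\<^sup>+m. \<integral>\<^sup>+n. ennreal ((cmod (?\<Phi> m n))\<^sup>2) \<partial>count_space UNIV \<partial>count_space UNIV)")
proof -
  have "cmod (L2_inner f (tf_shift (\<alpha> * of_int n) (\<beta> * of_int m) (\<lambda>t. \<kappa> * ft \<gamma> t))) = cmod \<kappa> / \<alpha> * cmod (?\<Phi> m n)" for m n
  proof -
    have "L2_inner f (tf_shift (\<alpha> * of_int n) (\<beta> * of_int m) (\<lambda>t. \<kappa> * ft \<gamma> t)) = (LINT t|lborel. cnj \<kappa> * (f t * cnj (ft (shifted \<alpha> \<beta> m n) t)))"
      unfolding L2_inner_def tf_shift_ft_\<gamma> by (simp add: mult_ac)
    also have "\<dots> = cnj \<kappa> * (LINT x|lborel. F x * cnj (shifted \<alpha> \<beta> m n x))"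
      by (simp only: integral_mult_right_zero F)
    finally show ?thesis by (simp add: norm_mult norm_pair_shifted[OF \<alpha>])
  qed
  then have "coeff_sum (\<lambda>(m, n). tf_shift (\<alpha> * of_int n) (\<beta> * of_int m) (\<lambda>t. \<kappa> * ft \<gamma> t)) f =
    (\<integral>\<^sup>+p. ennreal ((cmod \<kappa> / \<alpha>)\<^sup>2) * ennreal ((cmod (?\<Phi> (fst p) (snd p)))\<^sup>2) \<partial>count_space UNIV)"
    unfolding coeff_sum_def
    by (intro nn_integral_cong)
       (simp only: case_prod_beta' power_mult_distrib, simp only: ennreal_mult zero_le_power2)
  also have "\<dots> = ennreal ((cmod \<kappa> / \<alpha>)\<^sup>2) * (\<integral>\<^sup>+p. ennreal ((cmod (?\<Phi> (fst p) (snd p)))\<^sup>2) \<partial>count_space UNIV)"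
    by (rule nn_integral_cmult) simp
  also have "(\<integral>\<^sup>+p. ennreal ((cmod (?\<Phi> (fst p) (snd p)))\<^sup>2) \<partial>count_space UNIV) =
    (\<integral>\<^sup>+m. \<integral>\<^sup>+n. ennreal ((cmod (?\<Phi> m n))\<^sup>2) \<partial>count_space UNIV \<partial>count_space UNIV)"
    using nn_integral_fst_count_space[of "\<lambda>p. ennreal ((cmod (?\<Phi> (fst p) (snd p)))\<^sup>2)"] by simp
  finally show ?thesis .
qed

lemma l2sq_scaled:
  assumes [measurable]: "F \<in> borel_measurable borel" and \<alpha>: "\<alpha> > 0"
  shows "l2sq lborel (\<lambda>y :: real. F (y / \<alpha>)) = ennreal \<alpha> * l2sq lborel F"
  unfolding l2sq_def using \<alpha>
  by (subst nn_integral_real_affine[of "\<lambda>y. ennreal ((cmod (F (y / \<alpha>)))\<^sup>2)" \<alpha> 0]) auto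

lemma gabor_frame_ft_\<gamma>:
  assumes \<alpha>: "\<alpha> > 0" and \<beta>: "\<beta> > 0" and le: "\<alpha> * \<beta> \<le> 1" and \<kappa>: "\<kappa> \<noteq> 0"
  shows "gabor_frame (\<lambda>t. \<kappa> * ft \<gamma> t) \<alpha> \<beta>"
proof -
  interpret V: exp_window "c / \<alpha>" e "\<lambda>k. \<alpha> * b k" by (rule exp_window_scaled[OF \<alpha>])
  let ?\<phi> = "\<lambda>(m, n). tf_shift (\<alpha> * of_int n) (\<beta> * of_int m) (\<lambda>t. \<kappa> * ft \<gamma> t)"
  \<comment> \<open>The square comes from the coefficients, the last \<alpha> from the norm of the
    dilated \<open>F\<close>.\<close>
  let ?k = "(cmod \<kappa> / \<alpha>)\<^sup>2 * \<alpha>"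
  have k: "?k > 0" using \<alpha> \<kappa> by simp
  have \<alpha>\<beta>: "0 < \<alpha> * \<beta>" using \<alpha> \<beta> by simp
  define A where "A = ?k * V.lower_const (\<alpha> * \<beta>)"
  define B where "B = ?k * V.upper_const (\<alpha> * \<beta>)"
  have A: "A > 0" unfolding A_def using k V.lower_const_pos by (rule mult_pos_pos)
  have B: "B > 0" unfolding B_def using k V.upper_const_pos[OF \<alpha>\<beta>] by (rule mult_pos_pos)
  have meas: "?\<phi> p \<in> borel_measurable borel" for p
  proof (cases p)
    case (Pair m n)
    show ?thesis unfolding Pair prod.case tf_shift_ft_\<gamma> by measurable
  qed
  have fin: "l2sq lborel (?\<phi> p) < \<infinity>" for p
  proof (cases p)
    case (Pair m n)
    have "l2sq lborel (\<lambda>t. \<kappa> * ft (shifted \<alpha> \<beta> m n) t) = ennreal ((cmod \<kappa>)\<^sup>2) * l2sq lborel (shifted \<alpha> \<beta> m n)"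
      by (subst l2sq_cmult) (auto simp: plancherel[OF integrable_shifted l2sq_shifted])
    then show ?thesis using l2sq_shifted[of \<alpha> \<beta> m n] by (simp add: Pair tf_shift_ft_\<gamma> ennreal_mult_less_top)
  qed
  have dense: "ennreal A * l2sq lborel f \<le> coeff_sum ?\<phi> f \<and> coeff_sum ?\<phi> f \<le> ennreal B * l2sq lborel f"
    if f: "integrable lborel f" "l2sq lborel f < \<infinity>" for f
  proof -
    have [measurable]: "f \<in> borel_measurable borel" using f by auto
    define F where "F x = ft f (- x)" for x
    have [measurable]: "F \<in> borel_measurable borel" unfolding F_def[abs_def] by measurable
    have l2F: "l2sq lborel F = l2sq lborel f"
      unfolding F_def[abs_def] by (simp add: l2sq_reflect plancherel[OF f])
    have l2F': "l2sq lborel (\<lambda>y. F (y / \<alpha>)) = ennreal \<alpha> * l2sq lborel f"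
      by (simp add: l2sq_scaled \<alpha> l2F)
    have F'fin: "l2sq lborel (\<lambda>y. F (y / \<alpha>)) < \<infinity>" unfolding l2F' using f by (simp add: ennreal_mult_less_top)
    let ?S = "\<integral>\<^sup>+m. \<integral>\<^sup>+n. ennreal ((cmod (V.\<Phi> (\<alpha> * \<beta>) (\<lambda>y. F (y / \<alpha>)) m n))\<^sup>2) \<partial>count_space UNIV \<partial>count_space UNIV"
    have cs: "coeff_sum ?\<phi> f = ennreal ((cmod \<kappa> / \<alpha>)\<^sup>2) * ?S"
      by (rule coeff_sum_eq[OF \<alpha>]) (simp add: ft_fubini[OF f(1) integrable_shifted] F_def)
    have "ennreal A * l2sq lborel f = ennreal ((cmod \<kappa> / \<alpha>)\<^sup>2) * (ennreal (V.lower_const (\<alpha> * \<beta>)) * l2sq lborel (\<lambda>y. F (y / \<alpha>)))"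
      unfolding l2F' A_def using \<alpha> V.lower_const_pos[of "\<alpha> * \<beta>"] by (simp add: ennreal_mult mult_ac)
    also have "\<dots> \<le> coeff_sum ?\<phi> f"
      unfolding cs by (intro mult_left_mono V.\<Phi>_lower F'fin \<alpha>\<beta> le) auto
    finally have 1: "ennreal A * l2sq lborel f \<le> coeff_sum ?\<phi> f" .
    have "coeff_sum ?\<phi> f \<le> ennreal ((cmod \<kappa> / \<alpha>)\<^sup>2) * (ennreal (V.upper_const (\<alpha> * \<beta>)) * l2sq lborel (\<lambda>y. F (y / \<alpha>)))"
      unfolding cs by (intro mult_left_mono V.\<Phi>_upper F'fin \<alpha>\<beta>) auto
    also have "\<dots> = ennreal B * l2sq lborel f"
      unfolding l2F' B_def using \<alpha> V.upper_const_pos[OF \<alpha>\<beta>] by (simp add: ennreal_mult mult_ac)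
    finally show ?thesis using 1 by blast
  qed
  show ?thesis
    unfolding gabor_frame_iff
  proof (intro exI conjI allI impI)
    show "A / 2 > 0" "B > 0" using A B by auto
    fix f assume "L2 f"
    then have f: "f \<in> borel_measurable borel" "l2sq lborel f < \<infinity>" by (auto simp: L2_iff_l2sq)
    show "ennreal (A / 2) * l2sq lborel f \<le> coeff_sum ?\<phi> f"
      by (rule frame_bounds_extend(1)[OF meas fin dense A f])
    show "coeff_sum ?\<phi> f \<le> ennreal B * l2sq lborel f"
      by (rule frame_bounds_extend(2)[OF meas fin dense A f])
  qed
qed

lemma not_gabor_frame_ft_\<gamma>:
  assumes \<alpha>: "\<alpha> > 0" and gt: "\<alpha> * \<beta> > 1"
  shows "\<not> gabor_frame (\<lambda>t. \<kappa> * ft \<gamma> t) \<alpha> \<beta>"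
proof
  interpret V: exp_window "c / \<alpha>" e "\<lambda>k. \<alpha> * b k" by (rule exp_window_scaled[OF \<alpha>])
  let ?\<phi> = "\<lambda>(m, n). tf_shift (\<alpha> * of_int n) (\<beta> * of_int m) (\<lambda>t. \<kappa> * ft \<gamma> t)"
  assume "gabor_frame (\<lambda>t. \<kappa> * ft \<gamma> t) \<alpha> \<beta>"
  then obtain A where A: "A > 0" "\<And>f. L2 f \<Longrightarrow> ennreal A * l2sq lborel f \<le> coeff_sum ?\<phi> f"
    unfolding gabor_frame_iff by blast
  let ?k = "(cmod \<kappa> / \<alpha>)\<^sup>2 * \<alpha>"
  have k: "?k \<ge> 0" using \<alpha> by simp
  \<comment> \<open>The bound for \<open>G\<close> is multiplied by \<open>?k\<close> on the way
    back to \<open>F\<close>, and this choice makes \<open>?k * A' < A\<close>; adding 1 keeps the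
    denominator positive also for \<kappa> = 0.\<close>
  define A' where "A' = A / (2 * (?k + 1))"
  have "A / (2 * (K + 1)) > 0 \<and> K * (A / (2 * (K + 1))) < A" if "K \<ge> 0" for K
    using that A(1) by (auto simp: pos_divide_less_eq field_simps intro!: add_nonneg_pos mult_nonneg_nonneg)
  from this[OF k] have A': "A' > 0" "?k * A' < A" unfolding A'_def by blast+
  from V.\<Phi>_not_bounded_below[OF gt A'(1)] obtain G where
    G: "integrable lborel G" "l2sq lborel G < \<infinity>" "l2sq lborel G > 0"
      "(\<integral>\<^sup>+m. \<integral>\<^sup>+n. ennreal ((cmod (V.\<Phi> (\<alpha> * \<beta>) G m n))\<^sup>2) \<partial>count_space UNIV \<partial>count_space UNIV) \<le> ennreal A' * l2sq lborel G"
    by metis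
  have [measurable]: "G \<in> borel_measurable borel" using G by auto
  define F where "F x = G (\<alpha> * x)" for x
  have GF: "G = (\<lambda>y. F (y / \<alpha>))" using \<alpha> by (auto simp: F_def)
  have [measurable]: "F \<in> borel_measurable borel" unfolding F_def[abs_def] by measurable
  have Fi: "integrable lborel F"
    using lborel_integrable_real_affine[OF G(1), of \<alpha> 0] \<alpha> by (simp add: F_def[abs_def])
  have l2G: "l2sq lborel G = ennreal \<alpha> * l2sq lborel F"
    unfolding GF by (intro l2sq_scaled \<alpha>) simp
  have Ffin: "l2sq lborel F < \<infinity>" "l2sq lborel F > 0"
    using G(2,3) \<alpha> unfolding l2G by (auto simp: ennreal_mult_less_top ennreal_zero_less_mult_iff)
  have "L2 (ft F)" unfolding L2_iff_l2sq using Ffin by (simp add: plancherel[OF Fi])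
  then have "ennreal A * l2sq lborel F \<le> coeff_sum ?\<phi> (ft F)"
    using A(2) by (simp add: plancherel[OF Fi Ffin(1), symmetric])
  also have "\<dots> = ennreal ((cmod \<kappa> / \<alpha>)\<^sup>2) * (\<integral>\<^sup>+m. \<integral>\<^sup>+n. ennreal ((cmod (V.\<Phi> (\<alpha> * \<beta>) G m n))\<^sup>2) \<partial>count_space UNIV \<partial>count_space UNIV)"
    unfolding GF by (rule coeff_sum_eq[OF \<alpha> plancherel_inner[OF Fi Ffin(1) integrable_shifted l2sq_shifted]])
  also have "\<dots> \<le> ennreal ((cmod \<kappa> / \<alpha>)\<^sup>2) * (ennreal A' * l2sq lborel G)"
    by (intro mult_left_mono G(4)) simp
  also have "\<dots> = ennreal (?k * A') * l2sq lborel F"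
    unfolding l2G using \<alpha> A'(1) by (simp add: ennreal_mult mult_ac)
  also have "\<dots> < ennreal A * l2sq lborel F"
    using Ffin A' k A(1) by (intro ennreal_mult_strict_right_mono ennreal_lessI) auto
  finally show False by simp
qed

end

text \<open>Since c - 2 pi i t = - 2 pi i (t - i w) for c = 2 pi |w|, the window g is a multiple of the
  transform of a series of shifted one-sided exponentials.\<close>

theorem theorem1:
  fixes w :: real and a :: "nat \<Rightarrow> complex" and b :: "nat \<Rightarrow> real"
    and P g :: "real \<Rightarrow> complex"
  assumes "w < 0"
    and "a 0 = 1" and "b 0 = 0" and "\<And>k. k \<ge> 1 \<Longrightarrow> b k > 0"
    and "summable (\<lambda>k. cmod (a (Suc k)) * exp (2 * pi * \<bar>w\<bar> * b (Suc k)))"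
    and "(\<Sum>k. cmod (a (Suc k)) * exp (2 * pi * \<bar>w\<bar> * b (Suc k))) < 1"
    and "\<And>t. P t = (\<Sum>k. a k * exp (2 * pi * \<i> * of_real (b k * t)))"
    and "\<And>t. g t = P t / (of_real t - \<i> * of_real w)"
  shows "frame_set g = {(\<alpha>, \<beta>). \<alpha> > 0 \<and> \<beta> > 0 \<and> \<alpha> * \<beta> \<le> 1}"
proof -
  define c where "c = 2 * pi * \<bar>w\<bar>"
  define e where "e k = a k * exp (c * b k)" for k
  interpret W: exp_window c e b
  proof
    show "c > 0" unfolding c_def using assms(1) by (intro mult_pos_pos) auto
    show "e 0 = 1" by (simp add: e_def assms(2,3))
    show "b 0 = 0" "\<And>k. k \<ge> 1 \<Longrightarrow> b k > 0" by (rule assms)+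
    show "summable (\<lambda>k. cmod (e (Suc k)))" "(\<Sum>k. cmod (e (Suc k))) < 1"
      using assms(5,6) by (simp_all add: e_def c_def norm_mult)
  qed
  have "g t = (- 2 * pi * \<i>) * ft W.\<gamma> t" for t
  proof -
    have "e k * exp (- c * b k) = a k" for k
      by (simp add: e_def mult.assoc flip: exp_of_real exp_add)
    then have "ft W.\<gamma> t = P t / (c - 2 * pi * \<i> * t)"
      unfolding W.ft_\<gamma> assms(7) ec_conv_exp by simp
    \<comment> \<open>The real part of the right side is \<open>- 2 * pi * w\<close>, which is
      \<open>c\<close> because \<open>w\<close> is negative.\<close>
    also have "complex_of_real c - 2 * pi * \<i> * t = (- 2 * pi * \<i>) * (of_real t - \<i> * of_real w)"
      using mult_pos_neg[OF pi_gt_zero assms(1)] assms(1) by (simp add: c_def complex_eq_iff)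
    finally show ?thesis unfolding assms(8) by simp
  qed
  then have g: "g = (\<lambda>t. (- 2 * pi * \<i>) * ft W.\<gamma> t)" by blast
  have "gabor_frame g \<alpha> \<beta> \<longleftrightarrow> \<alpha> * \<beta> \<le> 1" if "\<alpha> > 0" "\<beta> > 0" for \<alpha> \<beta>
  proof (cases "\<alpha> * \<beta> \<le> 1")
    case True
    have "gabor_frame g \<alpha> \<beta>"
      unfolding g by (rule W.gabor_frame_ft_\<gamma>[OF that True]) simp
    with True show ?thesis by simp
  next
    case False
    then have "\<not> gabor_frame g \<alpha> \<beta>"
      unfolding g using that(1) by (intro W.not_gabor_frame_ft_\<gamma>) auto
    with False show ?thesis by simp
  qed
  then show ?thesis unfolding frame_set_def by auto
qed

end
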